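(* Let $\mathbb{G}$ be a totally ordered Abelian group with $\operatorname{Deg}(\mathbb{G})=\kappa$. Up to $\kappa$-Borel isomorphism, the following classes of spaces are the same (that is, every space in any one of the classes is $\kappa$-Borel isomorphic to some space in each of the other classes): (1) $f\mathrm{SC}_\kappa$-spaces; (2) $\mathrm{SC}_\kappa$-spaces; (3) $\mathbb{G}$-Polish spaces; (4) $\kappa$-additive $\mathrm{SC}_\kappa$-spaces or, equivalently, spherically complete $\mathbb{G}$-Polish spaces.
   Context: Work in ZFC; $\kappa$ is an uncountable regular cardinal with $2^{<\kappa}=\kappa$ (equivalently $\kappa^{<\kappa}=\kappa$). "Space" means regular Hausdorff topological space. $\mathrm{Bor}_\kappa(X)$ is the smallest $\kappa^+$-algebra (family closed under complements and unions of size $\le\kappa$) on $X$ containing the open sets. A $\kappa$-Borel isomorphism between spaces $X$ and $Y$ is a bijection $f$ such that $f$-preimages of sets in $\mathrm{Bor}_\kappa(Y)$ are in $\mathrm{Bor}_\kappa(X)$ and $f$-images of sets in $\mathrm{Bor}_\kappa(X)$ are in $\mathrm{Bor}_\kappa(Y)$. A space is $\kappa$-additive if its topology is closed under intersections of fewer than $\kappa$ open sets. Choquet games on $X$: players I and II play $\kappa$-many rounds. In round $\alpha<\kappa$, I plays $(U_\alpha,x_\alpha)$ with $U_\alpha$ a relatively open subset of $\bigcap_{\beta<\alpha}V_\beta$ (which is $X$ if $\alpha=0$) and $x_\alpha\in U_\alpha$; then II plays a relatively open subset $V_\alpha$ of $\bigcap_{\beta<\alpha}V_\beta$ with $x_\alpha\in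 V_\alpha\subseteq U_\alpha$. In the strong $\kappa$-Choquet game $\mathrm{G}^s_\kappa(X)$, II wins iff $\bigcap_{\alpha<\gamma}V_\alpha\ne\emptyset$ for every limit $\gamma\le\kappa$ (I wins as soon as such an intersection is empty). In the strong fair $\kappa$-Choquet game $f\mathrm{G}^s_\kappa(X)$, if $\bigcap_{\alpha<\gamma}V_\alpha=\emptyset$ for some limit $\gamma<\kappa$ the run ends and II wins; if the run lasts $\kappa$ rounds, II wins iff $\bigcap_{\alpha<\kappa}V_\alpha\ne\emptyset$. $X$ is an $\mathrm{SC}_\kappa$-space (resp. $f\mathrm{SC}_\kappa$-space) if it has weight $\le\kappa$ and II has a winning strategy in $\mathrm{G}^s_\kappa(X)$ (resp. $f\mathrm{G}^s_\kappa(X)$). (The empty space, where I has no legal move, counts as such.) For a totally ordered (with translation-invariant linear order) Abelian group $\mathbb{G}$, $\mathbb{G}^+=\{\varepsilon\in\mathbb{G}\mid 0<\varepsilon\}$ and $\operatorname{Deg}(\mathbb{G})$ is the coinitiality of $\mathbb{G}^+$. A $\mathbb{G}$-metric on $X$ is a map $d\colon X^2\to\mathbb{G}^+\cup\{0\}$ with $d(x,y)=0\iff x=y$, $d(x,y)=d(y,x)$, $d(x,z)\le d(x,y)+d(y,z)$; its topology is generated by the balls $\{y\mid d(x,y)<\varepsilon\}$, $\varepsilon\in\mathbb{G}^+$, and $d$ is compatible with a topology if it generates it. $d$ is Cauchy-complete if every $d$-Cauchy sequence of length $\kappa$ converges; it is spherically complete if every sequence of open balls decreasing with respect to inclusion has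 nonempty intersection. $X$ is $\mathbb{G}$-Polish if it has weight $\le\kappa$ and admits a compatible Cauchy-complete $\mathbb{G}$-metric; it is a spherically complete $\mathbb{G}$-Polish space if it has weight $\le\kappa$ and admits a compatible $\mathbb{G}$-metric which is both Cauchy-complete and spherically complete. *)

theory Defs
  imports "HOL-Analysis.Analysis"
begin

unbundle cardinal_syntax

section \<open>Cardinals\<close>

text \<open>
  A cardinal \<open>\<kappa>\<close> is a cardinal order in the sense of \<^theory>\<open>HOL.BNF_Cardinal_Order_Relation\<close>.
  Its elements, the ordinals below \<open>\<kappa>\<close>, are the members of \<open>Field \<kappa>\<close>;
  \<open>\<beta> < \<alpha>\<close> is \<open>\<beta> \<in> underS \<kappa> \<alpha>\<close> and \<open>\<beta> \<le> \<alpha>\<close> is \<open>\<beta> \<in> under \<kappa> \<alpha>\<close>.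
\<close>

text \<open>The cardinal \<open>2\<^sup><\<^sup>\<kappa>\<close>, as the number of binary sequences of length less than \<open>\<kappa>\<close>.\<close>

definition two_power_less :: "'k rel \<Rightarrow> ('k \<Rightarrow> bool option) rel" where
  "two_power_less \<kappa> = |{s :: 'k \<Rightarrow> bool option. \<exists>\<alpha>\<in>Field \<kappa>. dom s = underS \<kappa> \<alpha>}|"

definition limit_below :: "'k rel \<Rightarrow> 'k \<Rightarrow> bool" where
  "limit_below \<kappa> \<gamma> \<longleftrightarrow> \<gamma> \<in> Field \<kappa> \<and> underS \<kappa> \<gamma> \<noteq> {} \<and>
     (\<forall>\<beta>\<in>underS \<kappa> \<gamma>. \<exists>\<delta>\<in>underS \<kappa> \<gamma>. \<beta> \<in> underS \<kappa> \<delta>)"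

definition coinitial_in :: "'g::linorder set \<Rightarrow> 'g set \<Rightarrow> bool" where
  "coinitial_in P S \<longleftrightarrow> S \<subseteq> P \<and> (\<forall>p\<in>P. \<exists>s\<in>S. s \<le> p)"

text \<open>The least cardinality of a coinitial subset of \<open>P\<close> is \<open>\<kappa>\<close>.\<close>

definition has_coinitiality :: "'g::linorder set \<Rightarrow> 'k rel \<Rightarrow> bool" where
  "has_coinitiality P \<kappa> \<longleftrightarrow>
     (\<exists>S. coinitial_in P S \<and> |S| =o \<kappa>) \<and> (\<forall>S. coinitial_in P S \<longrightarrow> \<kappa> \<le>o |S| )"

text \<open>\<open>Deg(\<bbbG>) = \<kappa>\<close>, where \<open>\<bbbG>\<close> is the type \<open>'g\<close>.\<close>

definition has_Deg :: "'g::linordered_ab_group_add itself \<Rightarrow> 'k rel \<Rightarrow> bool" where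
  "has_Deg G \<kappa> \<longleftrightarrow> has_coinitiality {\<epsilon>::'g. 0 < \<epsilon>} \<kappa>"


section \<open>Spaces of small weight and \<open>\<kappa>\<close>-Borel sets\<close>

definition weight_le :: "'k rel \<Rightarrow> 'a topology \<Rightarrow> bool" where
  "weight_le \<kappa> X \<longleftrightarrow>
     (\<exists>\<B>. |\<B>| \<le>o \<kappa> \<and> (\<forall>V\<in>\<B>. openin X V) \<and>
          (\<forall>U x. openin X U \<and> x \<in> U \<longrightarrow> (\<exists>V\<in>\<B>. x \<in> V \<and> V \<subseteq> U)))"

definition kappa_space :: "'k rel \<Rightarrow> 'a topology \<Rightarrow> bool" where
  "kappa_space \<kappa> X \<longleftrightarrow> regular_space X \<and> Hausdorff_space X \<and> weight_le \<kappa> X"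

definition kappa_additive :: "'k rel \<Rightarrow> 'a topology \<Rightarrow> bool" where
  "kappa_additive \<kappa> X \<longleftrightarrow>
     (\<forall>\<U>. |\<U>| <o \<kappa> \<and> (\<forall>U\<in>\<U>. openin X U) \<longrightarrow> openin X (topspace X \<inter> \<Inter>\<U>))"

inductive_set kappa_Borel :: "'k rel \<Rightarrow> 'a topology \<Rightarrow> 'a set set"
  for \<kappa> :: "'k rel" and X :: "'a topology" where
  openin: "openin X U \<Longrightarrow> U \<in> kappa_Borel \<kappa> X"
| compl: "A \<in> kappa_Borel \<kappa> X \<Longrightarrow> topspace X - A \<in> kappa_Borel \<kappa> X"
| Union: "|\<A>| \<le>o \<kappa> \<Longrightarrow> (\<And>A. A \<in> \<A> \<Longrightarrow> A \<in> kappa_Borel \<kappa> X) \<Longrightarrow> \<Union>\<A> \<in> kappa_Borel \<kappa> X"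

definition kappa_Borel_isomorphism ::
    "'k rel \<Rightarrow> 'a topology \<Rightarrow> 'b topology \<Rightarrow> ('a \<Rightarrow> 'b) \<Rightarrow> bool" where
  "kappa_Borel_isomorphism \<kappa> X Y f \<longleftrightarrow>
     bij_betw f (topspace X) (topspace Y) \<and>
     (\<forall>B\<in>kappa_Borel \<kappa> Y. topspace X \<inter> f -` B \<in> kappa_Borel \<kappa> X) \<and>
     (\<forall>A\<in>kappa_Borel \<kappa> X. f ` A \<in> kappa_Borel \<kappa> Y)"

definition kappa_Borel_isomorphic :: "'k rel \<Rightarrow> 'a topology \<Rightarrow> 'b topology \<Rightarrow> bool" where
  "kappa_Borel_isomorphic \<kappa> X Y \<longleftrightarrow> (\<exists>f. kappa_Borel_isomorphism \<kappa> X Y f)"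


section \<open>Choquet games\<close>

text \<open>
  A run is given by the sequence \<open>p\<close> of the moves \<open>(U\<^sub>\<alpha>, x\<^sub>\<alpha>)\<close> of player I and the sequence \<open>V\<close>
  of the moves of player II, of which only the part that has been played matters.
\<close>

definition stage :: "'k rel \<Rightarrow> 'a topology \<Rightarrow> ('k \<Rightarrow> 'a set) \<Rightarrow> 'k \<Rightarrow> 'a set" where
  "stage \<kappa> X V \<alpha> = topspace X \<inter> (\<Inter>\<beta>\<in>underS \<kappa> \<alpha>. V \<beta>)"

definition final_stage :: "'k rel \<Rightarrow> 'a topology \<Rightarrow> ('k \<Rightarrow> 'a set) \<Rightarrow> 'a set" where
  "final_stage \<kappa> X V = topspace X \<inter> (\<Inter>\<beta>\<in>Field \<kappa>. V \<beta>)"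

definition legal_I ::
    "'k rel \<Rightarrow> 'a topology \<Rightarrow> ('k \<Rightarrow> 'a set \<times> 'a) \<Rightarrow> ('k \<Rightarrow> 'a set) \<Rightarrow> 'k \<Rightarrow> bool" where
  "legal_I \<kappa> X p V \<alpha> \<longleftrightarrow>
     (case p \<alpha> of (U, x) \<Rightarrow> openin (subtopology X (stage \<kappa> X V \<alpha>)) U \<and> x \<in> U)"

definition legal_II ::
    "'k rel \<Rightarrow> 'a topology \<Rightarrow> ('k \<Rightarrow> 'a set \<times> 'a) \<Rightarrow> ('k \<Rightarrow> 'a set) \<Rightarrow> 'k \<Rightarrow> bool" where
  "legal_II \<kappa> X p V \<alpha> \<longleftrightarrow>
     (case p \<alpha> of (U, x) \<Rightarrow>
        openin (subtopology X (stage \<kappa> X V \<alpha>)) (V \<alpha>) \<and> x \<in> V \<alpha> \<and> V \<alpha> \<subseteq> U)"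

text \<open>
  In round \<open>\<alpha>\<close> a strategy \<open>\<sigma>\<close> for II sees exactly the moves of I in the rounds up to and
  including \<open>\<alpha>\<close>: the later values of \<open>p\<close> are erased by \<^const>\<open>restrict\<close>.
\<close>

definition responses ::
    "'k rel \<Rightarrow> ('k \<Rightarrow> ('k \<Rightarrow> 'a set \<times> 'a) \<Rightarrow> 'a set) \<Rightarrow> ('k \<Rightarrow> 'a set \<times> 'a) \<Rightarrow> 'k \<Rightarrow> 'a set" where
  "responses \<kappa> \<sigma> p \<alpha> = \<sigma> \<alpha> (restrict p (under \<kappa> \<alpha>))"

definition strategy_legal ::
    "'k rel \<Rightarrow> 'a topology \<Rightarrow> ('k \<Rightarrow> ('k \<Rightarrow> 'a set \<times> 'a) \<Rightarrow> 'a set) \<Rightarrow> bool" where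
  "strategy_legal \<kappa> X \<sigma> \<longleftrightarrow>
     (\<forall>p. \<forall>\<alpha>\<in>Field \<kappa>. (\<forall>\<beta>\<in>under \<kappa> \<alpha>. legal_I \<kappa> X p (responses \<kappa> \<sigma> p) \<beta>) \<longrightarrow>
        legal_II \<kappa> X p (responses \<kappa> \<sigma> p) \<alpha>)"

text \<open>
  If \<open>stage \<kappa> X V \<gamma>\<close> is empty for some limit \<open>\<gamma> < \<kappa>\<close>, then I has no legal move in round \<open>\<gamma>\<close>.
  Hence a run with legal moves of I in all rounds below \<open>\<kappa>\<close> is one that lasts \<open>\<kappa>\<close> rounds, and
  the runs of the fair game that stop earlier, which II wins, need not be mentioned in
  \<open>fair_winning\<close>.
\<close>

definition fair_winning ::
    "'k rel \<Rightarrow> 'a topology \<Rightarrow> ('k \<Rightarrow> ('k \<Rightarrow> 'a set \<times> 'a) \<Rightarrow> 'a set) \<Rightarrow> bool" where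
  "fair_winning \<kappa> X \<sigma> \<longleftrightarrow> strategy_legal \<kappa> X \<sigma> \<and>
     (\<forall>p. (\<forall>\<alpha>\<in>Field \<kappa>. legal_I \<kappa> X p (responses \<kappa> \<sigma> p) \<alpha>) \<longrightarrow>
        final_stage \<kappa> X (responses \<kappa> \<sigma> p) \<noteq> {})"

definition strong_winning ::
    "'k rel \<Rightarrow> 'a topology \<Rightarrow> ('k \<Rightarrow> ('k \<Rightarrow> 'a set \<times> 'a) \<Rightarrow> 'a set) \<Rightarrow> bool" where
  "strong_winning \<kappa> X \<sigma> \<longleftrightarrow> strategy_legal \<kappa> X \<sigma> \<and>
     (\<forall>p \<gamma>. limit_below \<kappa> \<gamma> \<and> (\<forall>\<alpha>\<in>underS \<kappa> \<gamma>. legal_I \<kappa> X p (responses \<kappa> \<sigma> p) \<alpha>) \<longrightarrow>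
        stage \<kappa> X (responses \<kappa> \<sigma> p) \<gamma> \<noteq> {}) \<and>
     (\<forall>p. (\<forall>\<alpha>\<in>Field \<kappa>. legal_I \<kappa> X p (responses \<kappa> \<sigma> p) \<alpha>) \<longrightarrow>
        final_stage \<kappa> X (responses \<kappa> \<sigma> p) \<noteq> {})"

definition SC_space :: "'k rel \<Rightarrow> 'a topology \<Rightarrow> bool" where
  "SC_space \<kappa> X \<longleftrightarrow> kappa_space \<kappa> X \<and> (\<exists>\<sigma>. strong_winning \<kappa> X \<sigma>)"

definition fSC_space :: "'k rel \<Rightarrow> 'a topology \<Rightarrow> bool" where
  "fSC_space \<kappa> X \<longleftrightarrow> kappa_space \<kappa> X \<and> (\<exists>\<sigma>. fair_winning \<kappa> X \<sigma>)"

definition additive_SC_space :: "'k rel \<Rightarrow> 'a topology \<Rightarrow> bool" where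
  "additive_SC_space \<kappa> X \<longleftrightarrow> kappa_additive \<kappa> X \<and> SC_space \<kappa> X"


section \<open>\<open>\<bbbG>\<close>-metrics\<close>

definition G_metric :: "'a set \<Rightarrow> ('a \<Rightarrow> 'a \<Rightarrow> 'g::linordered_ab_group_add) \<Rightarrow> bool" where
  "G_metric M d \<longleftrightarrow>
     (\<forall>x\<in>M. \<forall>y\<in>M. 0 \<le> d x y \<and> (d x y = 0 \<longleftrightarrow> x = y) \<and> d x y = d y x) \<and>
     (\<forall>x\<in>M. \<forall>y\<in>M. \<forall>z\<in>M. d x z \<le> d x y + d y z)"

definition G_ball ::
    "'a set \<Rightarrow> ('a \<Rightarrow> 'a \<Rightarrow> 'g::linordered_ab_group_add) \<Rightarrow> 'a \<Rightarrow> 'g \<Rightarrow> 'a set" where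
  "G_ball M d x \<epsilon> = {y\<in>M. d x y < \<epsilon>}"

definition compatible_G_metric ::
    "'a topology \<Rightarrow> ('a \<Rightarrow> 'a \<Rightarrow> 'g::linordered_ab_group_add) \<Rightarrow> bool" where
  "compatible_G_metric X d \<longleftrightarrow> G_metric (topspace X) d \<and>
     X = topology_generated_by {G_ball (topspace X) d x \<epsilon> |x \<epsilon>. x \<in> topspace X \<and> 0 < \<epsilon>}"

definition G_Cauchy ::
    "'k rel \<Rightarrow> ('a \<Rightarrow> 'a \<Rightarrow> 'g::linordered_ab_group_add) \<Rightarrow> ('k \<Rightarrow> 'a) \<Rightarrow> bool" where
  "G_Cauchy \<kappa> d s \<longleftrightarrow>
     (\<forall>\<epsilon>>0. \<exists>\<alpha>\<in>Field \<kappa>. \<forall>\<beta> \<gamma>. (\<alpha>, \<beta>) \<in> \<kappa> \<and> (\<alpha>, \<gamma>) \<in> \<kappa> \<longrightarrow> d (s \<beta>) (s \<gamma>) < \<epsilon>)"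

definition G_converges_to ::
    "'k rel \<Rightarrow> ('a \<Rightarrow> 'a \<Rightarrow> 'g::linordered_ab_group_add) \<Rightarrow> ('k \<Rightarrow> 'a) \<Rightarrow> 'a \<Rightarrow> bool" where
  "G_converges_to \<kappa> d s l \<longleftrightarrow>
     (\<forall>\<epsilon>>0. \<exists>\<alpha>\<in>Field \<kappa>. \<forall>\<beta>. (\<alpha>, \<beta>) \<in> \<kappa> \<longrightarrow> d (s \<beta>) l < \<epsilon>)"

definition Cauchy_complete ::
    "'k rel \<Rightarrow> 'a set \<Rightarrow> ('a \<Rightarrow> 'a \<Rightarrow> 'g::linordered_ab_group_add) \<Rightarrow> bool" where
  "Cauchy_complete \<kappa> M d \<longleftrightarrow>
     (\<forall>s. (\<forall>\<alpha>\<in>Field \<kappa>. s \<alpha> \<in> M) \<and> G_Cauchy \<kappa> d s \<longrightarrow> (\<exists>l\<in>M. G_converges_to \<kappa> d s l))"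

text \<open>
  Transfinite sequences of balls, of arbitrary nonzero length, are indexed by well-orders \<open>r\<close>.
  A decreasing sequence of subsets of \<open>M\<close> is, up to repetitions, indexed by its own range, so
  that well-orders on the type \<open>'a set\<close> account for all lengths.
\<close>

definition spherically_complete ::
    "'a set \<Rightarrow> ('a \<Rightarrow> 'a \<Rightarrow> 'g::linordered_ab_group_add) \<Rightarrow> bool" where
  "spherically_complete M d \<longleftrightarrow>
     (\<forall>(r :: 'a set rel) c \<epsilon>.
        Well_order r \<and> Field r \<noteq> {} \<and> (\<forall>i\<in>Field r. c i \<in> M \<and> 0 < \<epsilon> i) \<and>
        (\<forall>i j. (i, j) \<in> r \<longrightarrow> G_ball M d (c j) (\<epsilon> j) \<subseteq> G_ball M d (c i) (\<epsilon> i)) \<longrightarrow>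
        (\<Inter>i\<in>Field r. G_ball M d (c i) (\<epsilon> i)) \<noteq> {})"

definition G_Polish ::
    "'g::linordered_ab_group_add itself \<Rightarrow> 'k rel \<Rightarrow> 'a topology \<Rightarrow> bool" where
  "G_Polish G \<kappa> X \<longleftrightarrow> kappa_space \<kappa> X \<and>
     (\<exists>d :: 'a \<Rightarrow> 'a \<Rightarrow> 'g. compatible_G_metric X d \<and> Cauchy_complete \<kappa> (topspace X) d)"

definition sph_complete_G_Polish ::
    "'g::linordered_ab_group_add itself \<Rightarrow> 'k rel \<Rightarrow> 'a topology \<Rightarrow> bool" where
  "sph_complete_G_Polish G \<kappa> X \<longleftrightarrow> kappa_space \<kappa> X \<and>
     (\<exists>d :: 'a \<Rightarrow> 'a \<Rightarrow> 'g. compatible_G_metric X d \<and> Cauchy_complete \<kappa> (topspace X) d \<and>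
        spherically_complete (topspace X) d)"


section \<open>Comparing classes of spaces\<close>

text \<open>
  Since a \<open>\<kappa>\<close>-Borel isomorphism is a bijection, a space that is \<open>\<kappa>\<close>-Borel isomorphic to \<open>X\<close>
  has a homeomorphic copy on the underlying set of \<open>X\<close>. Looking for it among the topologies on
  subsets of the same type is therefore no restriction.
\<close>

definition same_up_to_kappa_Borel_isomorphism ::
    "'k rel \<Rightarrow> ('a topology \<Rightarrow> bool) \<Rightarrow> ('a topology \<Rightarrow> bool) \<Rightarrow> bool" where
  "same_up_to_kappa_Borel_isomorphism \<kappa> \<C> \<D> \<longleftrightarrow>
     (\<forall>X. \<C> X \<longrightarrow> (\<exists>Y. \<D> Y \<and> kappa_Borel_isomorphic \<kappa> X Y)) \<and>
     (\<forall>Y. \<D> Y \<longrightarrow> (\<exists>X. \<C> X \<and> kappa_Borel_isomorphic \<kappa> Y X))"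

end

theory Submission
  imports Defs
begin

text \<open>
  All four classes lie between the additive strong Choquet spaces and the fair Choquet spaces: a
  winning strategy in the strong game also wins the fair game, and in a \<open>\<bbbG>\<close>-metric space II may
  answer with small balls around the points played by I. Completeness of the metric makes this
  strategy win the fair game, because the points played by I form a Cauchy sequence
  (\<open>G_Polish_imp_fSC_space\<close>); spherical completeness makes it win the strong game, because the
  answers are a decreasing sequence of balls (\<open>sph_complete_G_Polish_imp_additive_SC_space\<close>). It
  therefore suffices to replace a fair Choquet space \<open>X\<close> by a spherically complete \<open>\<bbbG>\<close>-Polish
  space with the same points and the same \<open>\<kappa>\<close>-Borel sets, and to show that additive strong Choquet
  spaces carry spherically complete metrics themselves.

  The link between games and metrics is a tree of partitions: for each \<open>\<alpha> < \<kappa>\<close> a partition of the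
  space, finer for larger \<open>\<alpha>\<close>, such that the partitions together separate points. If
  \<open>\<epsilon>\<close> is a decreasing coinitial sequence in \<open>\<bbbG>\<^sup>+\<close>, then \<open>d x y = \<epsilon> \<delta>\<close>, where \<open>\<delta>\<close> is the first
  level that separates \<open>x\<close> and \<open>y\<close>, is an ultrametric whose balls are intersections of classes. It
  is spherically complete if every decreasing sequence of classes, of any length, has a common
  point (\<open>spherically_complete_tree_imp_sph_complete_G_Polish\<close>).

  A tree is obtained from a winning strategy in \<open>X\<close> (\<open>winning_strategy_yields_tree\<close>). Let \<open>\<T>\<close> be the
  topology of intersections of fewer than \<open>\<kappa>\<close> open sets. As \<open>\<kappa>\<close> is uncountable and \<open>X\<close> is
  regular, \<open>\<T>\<close> has a base of clopen sets, as \<open>\<kappa>\<^sup><\<^sup>\<kappa> = \<kappa>\<close> this base has size \<open>\<kappa>\<close>, and hence \<open>\<T>\<close> has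
  the same \<open>\<kappa>\<close>-Borel sets as \<open>X\<close>. In round \<open>\<alpha>\<close>, the possible answers of II to moves \<open>(U, x)\<close> with \<open>x\<close>
  in a given class cover this class, and the cover is refined to a partition into \<open>\<T>\<close>-clopen sets.
  A branch of length \<open>\<kappa>\<close> follows a run of the game, so it has a common point. If \<open>X\<close> is additive and
  the strategy wins the strong game, then the same holds for branches of limit length, and \<open>\<T>\<close> is
  the topology of \<open>X\<close>.

  In general, branches of limit length below \<open>\<kappa>\<close> may have an empty intersection. There are
  at most \<open>\<kappa>\<^sup><\<^sup>\<kappa> = \<kappa>\<close> such gaps, and adding a point for each of them makes the tree spherically complete
  (\<open>spherically_complete_tree_filled\<close>). If \<open>X\<close> has more than \<open>\<kappa>\<close> points, then \<open>\<kappa>\<close> many of them can make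
  room for the new points, and a change on \<open>\<kappa>\<close> many points does not affect the \<open>\<kappa>\<close>-Borel sets. If
  \<open>X\<close> has at most \<open>\<kappa>\<close> points, then all its subsets are \<open>\<kappa>\<close>-Borel and the discrete topology will do.
\<close>

section \<open>Cardinal arithmetic below a regular cardinal\<close>

locale regular_cardinal =
  fixes \<kappa> :: "'k rel"
  assumes Card: "Card_order \<kappa>" and uncountable: "natLeq <o \<kappa>" and regular: "regularCard \<kappa>"
begin

lemma wo: "Well_order \<kappa>"
  using Card by (simp add: card_order_on_def)

lemma Field_infinite: "infinite (Field \<kappa>)"
proof -
  have "natLeq \<le>o |Field \<kappa>|"
    using ordLess_imp_ordLeq[OF uncountable] card_of_Field_ordIso[OF Card] ordIso_symmetric
      ordLeq_ordIso_trans by blast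
  then show ?thesis using infinite_iff_natLeq_ordLeq by blast
qed

lemma Field_nonempty: "Field \<kappa> \<noteq> {}"
  using Field_infinite by auto

lemma Cinfinite: "Cinfinite \<kappa>"
  using Field_infinite Card by (simp add: cinfinite_def)

lemma ord_refl: "\<alpha> \<in> Field \<kappa> \<Longrightarrow> (\<alpha>, \<alpha>) \<in> \<kappa>"
  using wo by (simp add: order_on_defs refl_on_def)

lemma ord_trans: "(\<alpha>, \<beta>) \<in> \<kappa> \<Longrightarrow> (\<beta>, \<gamma>) \<in> \<kappa> \<Longrightarrow> (\<alpha>, \<gamma>) \<in> \<kappa>"
  using wo unfolding order_on_defs trans_def by blast

lemma ord_antisym: "(\<alpha>, \<beta>) \<in> \<kappa> \<Longrightarrow> (\<beta>, \<alpha>) \<in> \<kappa> \<Longrightarrow> \<alpha> = \<beta>"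
  using wo unfolding order_on_defs antisym_def by blast

lemma ord_total: "\<alpha> \<in> Field \<kappa> \<Longrightarrow> \<beta> \<in> Field \<kappa> \<Longrightarrow> (\<alpha>, \<beta>) \<in> \<kappa> \<or> (\<beta>, \<alpha>) \<in> \<kappa>"
  using wo ord_refl[of \<alpha>] unfolding order_on_defs total_on_def by (cases "\<alpha> = \<beta>") auto

lemma underS_iff: "\<beta> \<in> underS \<kappa> \<alpha> \<longleftrightarrow> \<beta> \<noteq> \<alpha> \<and> (\<beta>, \<alpha>) \<in> \<kappa>"
  by (simp add: underS_def)

lemma under_iff: "\<beta> \<in> under \<kappa> \<alpha> \<longleftrightarrow> (\<beta>, \<alpha>) \<in> \<kappa>"
  by (simp add: under_def)

lemma underS_trans: "\<beta> \<in> underS \<kappa> \<alpha> \<Longrightarrow> (\<alpha>, \<gamma>) \<in> \<kappa> \<Longrightarrow> \<beta> \<in> underS \<kappa> \<gamma>"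
  "(\<gamma>, \<beta>) \<in> \<kappa> \<Longrightarrow> \<beta> \<in> underS \<kappa> \<alpha> \<Longrightarrow> \<gamma> \<in> underS \<kappa> \<alpha>"
  unfolding underS_iff by (auto dest: ord_trans ord_antisym)

lemma linear: "\<alpha> \<in> Field \<kappa> \<Longrightarrow> \<beta> \<in> Field \<kappa> \<Longrightarrow> \<beta> \<in> underS \<kappa> \<alpha> \<or> (\<alpha>, \<beta>) \<in> \<kappa>"
  using ord_total[of \<alpha> \<beta>] ord_refl[of \<alpha>] unfolding underS_iff by (cases "\<alpha> = \<beta>") auto

lemma not_underS: "(\<alpha>, \<beta>) \<in> \<kappa> \<Longrightarrow> \<beta> \<notin> underS \<kappa> \<alpha>"
  unfolding underS_iff by (auto dest: ord_antisym)

lemma in_Field: "(\<alpha>, \<beta>) \<in> \<kappa> \<Longrightarrow> \<alpha> \<in> Field \<kappa>" "(\<alpha>, \<beta>) \<in> \<kappa> \<Longrightarrow> \<beta> \<in> Field \<kappa>"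
  by (auto intro: FieldI1 FieldI2)

lemma underS_Field: "\<beta> \<in> underS \<kappa> \<alpha> \<Longrightarrow> \<beta> \<in> Field \<kappa>"
  using in_Field unfolding underS_iff by blast

lemma wf: "wf (\<kappa> - Id)"
  using wo unfolding well_order_on_def by blast

lemma ordinal_induct [consumes 1, case_names less]:
  assumes "\<alpha> \<in> Field \<kappa>"
    and "\<And>\<alpha>. \<alpha> \<in> Field \<kappa> \<Longrightarrow> (\<And>\<beta>. \<beta> \<in> underS \<kappa> \<alpha> \<Longrightarrow> P \<beta>) \<Longrightarrow> P \<alpha>"
  shows "P \<alpha>"
proof -
  have "\<alpha> \<in> Field \<kappa> \<longrightarrow> P \<alpha>"
    using wf
  proof (induction \<alpha> rule: wf_induct_rule)
    case (less \<alpha>)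
    show ?case
      using less assms(2)[of \<alpha>] in_Field unfolding underS_iff by blast
  qed
  then show ?thesis using assms(1) by blast
qed

lemma least:
  assumes "S \<subseteq> Field \<kappa>" "S \<noteq> {}"
  obtains m where "m \<in> S" "\<And>s. s \<in> S \<Longrightarrow> (m, s) \<in> \<kappa>"
proof -
  obtain s where s: "s \<in> S" using assms by blast
  obtain m where m: "m \<in> S" "\<And>y. (y, m) \<in> \<kappa> - Id \<Longrightarrow> y \<notin> S"
    using wfE_min[OF wf s] by blast
  have "(m, s) \<in> \<kappa>" if "s \<in> S" for s
    using linear[of m s] that m assms(1) unfolding underS_iff by blast
  then show ?thesis using m that by blast
qed

lemma successor:
  assumes "\<alpha> \<in> Field \<kappa>"
  obtains \<beta> where "\<beta> \<in> Field \<kappa>" "\<alpha> \<in> underS \<kappa> \<beta>"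
  using infinite_Card_order_limit[OF Card Field_infinite assms] unfolding underS_iff by blast

lemma bounded:
  assumes "S \<subseteq> Field \<kappa>" "|S| <o \<kappa>"
  obtains \<alpha> where "\<alpha> \<in> Field \<kappa>" "S \<subseteq> underS \<kappa> \<alpha>"
proof -
  have "\<not> cofinal S \<kappa>"
    using regular assms not_ordLess_ordIso unfolding regularCard_def by blast
  then obtain a where a: "a \<in> Field \<kappa>" "\<And>b. b \<in> S \<Longrightarrow> a = b \<or> (a, b) \<notin> \<kappa>"
    unfolding cofinal_def by blast
  obtain b where b: "b \<in> Field \<kappa>" "a \<in> underS \<kappa> b" using successor[OF a(1)] .
  have "S \<subseteq> underS \<kappa> b"
  proof
    fix s assume s: "s \<in> S"
    then have "s = a \<or> s \<in> underS \<kappa> a" using a linear assms(1) by blast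
    then show "s \<in> underS \<kappa> b" using b underS_trans(1)[of s a b] unfolding underS_iff by blast
  qed
  then show ?thesis using b that by blast
qed

lemma small_subset: "A \<subseteq> B \<Longrightarrow> |B| <o \<kappa> \<Longrightarrow> |A| <o \<kappa>"
  using card_of_mono1 ordLeq_ordLess_trans by blast

lemma small_image: "|A| <o \<kappa> \<Longrightarrow> |f ` A| <o \<kappa>"
  using card_of_image ordLeq_ordLess_trans by blast

lemma small_UN: "|A| <o \<kappa> \<Longrightarrow> (\<And>a. a \<in> A \<Longrightarrow> |F a| <o \<kappa>) \<Longrightarrow> |\<Union>a\<in>A. F a| <o \<kappa>"
  using card_of_UNION_ordLess_infinite_Field_regularCard[OF regular Cinfinite] by blast

lemma small_Un: "|A| <o \<kappa> \<Longrightarrow> |B| <o \<kappa> \<Longrightarrow> |A \<union> B| <o \<kappa>"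
  using card_of_Un_ordLess_infinite_Field[OF Field_infinite Card] .

lemma small_countable: "|range (f :: nat \<Rightarrow> 'b)| <o \<kappa>"
  by (rule ordLeq_ordLess_trans[OF card_of_image ordIso_ordLess_trans[OF card_of_nat uncountable]])

lemma small_finite: "finite A \<Longrightarrow> |A| <o \<kappa>"
  using finite_iff_ordLess_natLeq uncountable ordLess_transitive by blast

lemma small_underS: "\<alpha> \<in> Field \<kappa> \<Longrightarrow> |underS \<kappa> \<alpha>| <o \<kappa>"
  using card_of_underS[OF Card] .

lemma small_imp_leq: "|A| <o \<kappa> \<Longrightarrow> |A| \<le>o \<kappa>"
  by (rule ordLess_imp_ordLeq)

lemma Field_leq: "|Field \<kappa>| \<le>o \<kappa>"
  using card_of_Field_ordIso[OF Card] ordIso_imp_ordLeq by blast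

lemma leq_subset: "A \<subseteq> B \<Longrightarrow> |B| \<le>o \<kappa> \<Longrightarrow> |A| \<le>o \<kappa>"
  using card_of_mono1 ordLeq_transitive by blast

lemma leq_image: "|A| \<le>o \<kappa> \<Longrightarrow> |f ` A| \<le>o \<kappa>"
  using card_of_image ordLeq_transitive by blast

lemma leq_inj: "inj_on f A \<Longrightarrow> f ` A \<subseteq> B \<Longrightarrow> |B| \<le>o \<kappa> \<Longrightarrow> |A| \<le>o \<kappa>"
  by (rule ordLeq_transitive[OF iffD1[OF card_of_ordLeq]]) auto

lemma leq_UN: "|A| \<le>o \<kappa> \<Longrightarrow> (\<And>a. a \<in> A \<Longrightarrow> |F a| \<le>o \<kappa>) \<Longrightarrow> |\<Union>a\<in>A. F a| \<le>o \<kappa>"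
  using card_of_UNION_ordLeq_infinite_Field[OF Field_infinite Card] by blast

lemma leq_Un: "|A| \<le>o \<kappa> \<Longrightarrow> |B| \<le>o \<kappa> \<Longrightarrow> |A \<union> B| \<le>o \<kappa>"
  using card_of_Un_ordLeq_infinite_Field[OF Field_infinite _ _ Card] .

lemma leq_Times: "|A| \<le>o \<kappa> \<Longrightarrow> |B| \<le>o \<kappa> \<Longrightarrow> |A \<times> B| \<le>o \<kappa>"
  using card_of_Times_ordLeq_infinite_Field[OF Field_infinite _ _ Card] .

lemma leq_enum:
  assumes "|A| \<le>o \<kappa>" "A \<noteq> {}"
  obtains f where "f ` Field \<kappa> = A"
proof -
  have "|A| \<le>o |Field \<kappa>|"
    using assms(1) card_of_Field_ordIso[OF Card] ordIso_symmetric ordLeq_ordIso_trans by blast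
  then obtain f where "f ` Field \<kappa> = A"
    by (elim exE[OF iffD2[OF card_of_ordLeq2[OF assms(2)]]])
  then show ?thesis by (rule that)
qed

lemma leq_index:
  assumes "|A| \<le>o \<kappa>"
  obtains e where "inj_on e A" "e ` A \<subseteq> Field \<kappa>"
proof -
  have "|A| \<le>o |Field \<kappa>|"
    using assms(1) card_of_Field_ordIso[OF Card] ordIso_symmetric ordLeq_ordIso_trans by blast
  then obtain e where "inj_on e A \<and> e ` A \<subseteq> Field \<kappa>"
    by (elim exE[OF iffD2[OF card_of_ordLeq]])
  then show ?thesis using that[of e] by simp
qed

text \<open>A set of fewer than \<open>\<kappa>\<close> ordinals below \<open>\<kappa>\<close> is bounded, hence it is the support of a binary
  sequence of length below \<open>\<kappa>\<close>.\<close>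

lemma small_subsets_leq:
  assumes "two_power_less \<kappa> =o \<kappa>" "|A| \<le>o \<kappa>"
  shows "|{S. S \<subseteq> A \<and> |S| <o \<kappa>}| \<le>o \<kappa>"
proof -
  obtain e where e: "inj_on e A" "e ` A \<subseteq> Field \<kappa>" using leq_index[OF assms(2)] .
  let ?seqs = "{s :: 'k \<Rightarrow> bool option. \<exists>\<alpha>\<in>Field \<kappa>. dom s = underS \<kappa> \<alpha>}"
  have "|?seqs| \<le>o \<kappa>"
    using ordIso_imp_ordLeq[OF assms(1)] unfolding two_power_less_def .
  moreover have "{S. S \<subseteq> A \<and> |S| <o \<kappa>} \<subseteq> (\<lambda>s. {a \<in> A. s (e a) = Some True}) ` ?seqs"
  proof
    fix S assume "S \<in> {S. S \<subseteq> A \<and> |S| <o \<kappa>}"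
    then have S: "S \<subseteq> A" "|S| <o \<kappa>" by auto
    obtain \<alpha> where \<alpha>: "\<alpha> \<in> Field \<kappa>" "e ` S \<subseteq> underS \<kappa> \<alpha>"
      using bounded[of "e ` S"] small_image[OF S(2)] S(1) e(2) by blast
    let ?s = "\<lambda>\<beta>. if \<beta> \<in> underS \<kappa> \<alpha> then Some (\<beta> \<in> e ` S) else None"
    have "dom ?s = underS \<kappa> \<alpha>" by (auto simp: dom_def)
    then have s: "?s \<in> ?seqs" using \<alpha>(1) by blast
    have "?s (e a) = Some True \<longleftrightarrow> a \<in> S" if "a \<in> A" for a
    proof -
      have "e a \<in> e ` S \<longleftrightarrow> a \<in> S" using inj_on_image_mem_iff[OF e(1) that S(1)] .
      then show ?thesis using \<alpha>(2) by auto
    qed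
    then have "S = {a \<in> A. ?s (e a) = Some True}" using S(1) by blast
    then show "S \<in> (\<lambda>s. {a \<in> A. s (e a) = Some True}) ` ?seqs"
      by (rule image_eqI[OF _ s])
  qed
  ultimately show ?thesis by (metis (no_types, lifting) leq_subset leq_image)
qed

end


section \<open>Topologies given by a base\<close>

lemma openin_topology_generated_by_base:
  assumes "\<And>A B x. A \<in> \<C> \<Longrightarrow> B \<in> \<C> \<Longrightarrow> x \<in> A \<Longrightarrow> x \<in> B \<Longrightarrow> \<exists>C\<in>\<C>. x \<in> C \<and> C \<subseteq> A \<inter> B"
  shows "openin (topology_generated_by \<C>) U \<longleftrightarrow> (\<forall>x\<in>U. \<exists>C\<in>\<C>. x \<in> C \<and> C \<subseteq> U)"
proof
  assume "openin (topology_generated_by \<C>) U"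
  then have "generate_topology_on \<C> U" by (rule openin_topology_generated_by)
  then show "\<forall>x\<in>U. \<exists>C\<in>\<C>. x \<in> C \<and> C \<subseteq> U"
  proof induction
    case Empty
    then show ?case by simp
  next
    case (Int A B)
    show ?case
    proof
      fix x assume x: "x \<in> A \<inter> B"
      obtain A' B' where "A' \<in> \<C>" "x \<in> A'" "A' \<subseteq> A" "B' \<in> \<C>" "x \<in> B'" "B' \<subseteq> B"
        using Int.IH x by blast
      moreover then obtain C where "C \<in> \<C>" "x \<in> C" "C \<subseteq> A' \<inter> B'" using assms by blast
      ultimately show "\<exists>C\<in>\<C>. x \<in> C \<and> C \<subseteq> A \<inter> B" by blast
    qed
  next
    case (UN K)
    then show ?case by (metis Union_iff Union_upper subset_trans)
  next
    case (Basis S)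
    then show ?case by blast
  qed
next
  assume U: "\<forall>x\<in>U. \<exists>C\<in>\<C>. x \<in> C \<and> C \<subseteq> U"
  have "U = \<Union>{C \<in> \<C>. C \<subseteq> U}" using U by blast
  moreover have "openin (topology_generated_by \<C>) (\<Union>{C \<in> \<C>. C \<subseteq> U})"
    by (rule openin_Union) (simp add: topology_generated_by_Basis)
  ultimately show "openin (topology_generated_by \<C>) U" by simp
qed

lemma G_ball_subset_G_ball:
  assumes "G_metric M d" "x \<in> M" "y \<in> G_ball M d x \<epsilon>"
  shows "\<exists>\<delta>>0. G_ball M d y \<delta> \<subseteq> G_ball M d x \<epsilon>"
proof -
  have y: "y \<in> M" "d x y < \<epsilon>" using assms(3) by (auto simp: G_ball_def)
  have "G_ball M d y (\<epsilon> - d x y) \<subseteq> G_ball M d x \<epsilon>"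
  proof
    fix z assume "z \<in> G_ball M d y (\<epsilon> - d x y)"
    then have z: "z \<in> M" "d x y + d y z < \<epsilon>" by (auto simp: G_ball_def algebra_simps)
    moreover have "d x z \<le> d x y + d y z"
      using assms(1,2) y(1) z(1) unfolding G_metric_def by blast
    ultimately show "z \<in> G_ball M d x \<epsilon>" by (auto simp: G_ball_def)
  qed
  moreover have "0 < \<epsilon> - d x y" using y by simp
  ultimately show ?thesis by blast
qed

lemma center_in_G_ball:
  assumes "G_metric M d" "x \<in> M" "0 < \<epsilon>"
  shows "x \<in> G_ball M d x \<epsilon>"
proof -
  have "d x x = 0" using assms(1,2) unfolding G_metric_def by blast
  then show ?thesis using assms(2,3) by (simp add: G_ball_def)
qed

lemma openin_generated_by_G_balls:
  assumes "G_metric M (d :: 'a \<Rightarrow> 'a \<Rightarrow> 'g::linordered_ab_group_add)"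
  shows "openin (topology_generated_by {G_ball M d x \<epsilon> |x \<epsilon>. x \<in> M \<and> 0 < \<epsilon>}) U \<longleftrightarrow>
    U \<subseteq> M \<and> (\<forall>x\<in>U. \<exists>\<epsilon>>0. G_ball M d x \<epsilon> \<subseteq> U)"
proof -
  let ?\<C> = "{G_ball M d x \<epsilon> |x \<epsilon>. x \<in> M \<and> 0 < \<epsilon>}"
  have sub: "A \<subseteq> M" if "A \<in> ?\<C>" for A using that by (auto simp: G_ball_def)
  have inner: "\<exists>\<delta>>0. G_ball M d y \<delta> \<subseteq> A" if "A \<in> ?\<C>" "y \<in> A" for A y
    using that G_ball_subset_G_ball[OF assms] by blast
  have mono: "G_ball M d y (min \<delta> \<delta>') \<subseteq> G_ball M d y \<delta> \<inter> G_ball M d y \<delta>'" for y \<delta> \<delta>'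
    by (auto simp: G_ball_def)
  have base: "\<exists>C\<in>?\<C>. x \<in> C \<and> C \<subseteq> A \<inter> B" if A: "A \<in> ?\<C>" "x \<in> A" and B: "B \<in> ?\<C>" "x \<in> B" for A B x
  proof -
    obtain \<delta> where \<delta>: "\<delta> > 0" "G_ball M d x \<delta> \<subseteq> A" using inner[OF A] by blast
    obtain \<delta>' where \<delta>': "\<delta>' > 0" "G_ball M d x \<delta>' \<subseteq> B" using inner[OF B] by blast
    have pos: "0 < min \<delta> \<delta>'" using \<delta> \<delta>' by simp
    have x: "x \<in> M" using sub[OF A(1)] A(2) by blast
    have "G_ball M d x (min \<delta> \<delta>') \<in> ?\<C>" using pos x by blast
    moreover have "x \<in> G_ball M d x (min \<delta> \<delta>')" using center_in_G_ball[OF assms x pos] .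
    moreover have "G_ball M d x (min \<delta> \<delta>') \<subseteq> A \<inter> B" using mono[of x \<delta> \<delta>'] \<delta> \<delta>' by blast
    ultimately show ?thesis by blast
  qed
  have "(\<exists>C\<in>?\<C>. x \<in> C \<and> C \<subseteq> U) \<longleftrightarrow> x \<in> M \<and> (\<exists>\<epsilon>>0. G_ball M d x \<epsilon> \<subseteq> U)" (is "?l \<longleftrightarrow> ?r") for x
  proof
    assume ?l
    then obtain C where C: "C \<in> ?\<C>" "x \<in> C" "C \<subseteq> U" by blast
    then show ?r using inner[OF C(1,2)] sub[OF C(1)] by blast
  next
    assume ?r
    then obtain \<epsilon> where "x \<in> M" "0 < \<epsilon>" "G_ball M d x \<epsilon> \<subseteq> U" by blast
    then show ?l using center_in_G_ball[OF assms, of x \<epsilon>] by blast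
  qed
  moreover have "openin (topology_generated_by ?\<C>) U \<longleftrightarrow> (\<forall>x\<in>U. \<exists>C\<in>?\<C>. x \<in> C \<and> C \<subseteq> U)"
    by (rule openin_topology_generated_by_base) (rule base)
  ultimately show ?thesis by blast
qed

lemma openin_compatible_G_metric:
  assumes "compatible_G_metric X d"
  shows "openin X U \<longleftrightarrow>
    U \<subseteq> topspace X \<and> (\<forall>x\<in>U. \<exists>\<epsilon>>0. G_ball (topspace X) d x \<epsilon> \<subseteq> U)"
  using assms openin_generated_by_G_balls[of "topspace X" d U]
  unfolding compatible_G_metric_def by metis

lemma compatible_G_metricI:
  assumes "G_metric (topspace X) d"
    and "\<And>U. U \<subseteq> topspace X \<Longrightarrow>
      openin X U \<longleftrightarrow> (\<forall>x\<in>U. \<exists>\<epsilon>>0. G_ball (topspace X) d x \<epsilon> \<subseteq> U)"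
  shows "compatible_G_metric X d"
proof -
  have "openin X U \<longleftrightarrow>
      openin (topology_generated_by {G_ball (topspace X) d x \<epsilon> |x \<epsilon>. x \<in> topspace X \<and> 0 < \<epsilon>}) U" for U
    using assms(2)[of U] openin_subset[of X U] openin_generated_by_G_balls[OF assms(1), of U] by argo
  then show ?thesis
    using assms(1) unfolding compatible_G_metric_def topology_eq by blast
qed


section \<open>Trees of partitions\<close>

context regular_cardinal
begin

definition partition_tree :: "'a set \<Rightarrow> ('k \<Rightarrow> 'a \<Rightarrow> 'a set) \<Rightarrow> bool" where
  "partition_tree M C \<longleftrightarrow>
     (\<forall>\<alpha>\<in>Field \<kappa>. \<forall>x\<in>M. x \<in> C \<alpha> x \<and> C \<alpha> x \<subseteq> M \<and> (\<forall>y\<in>C \<alpha> x. C \<alpha> y = C \<alpha> x)) \<and>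
     (\<forall>\<alpha> \<beta>. (\<alpha>, \<beta>) \<in> \<kappa> \<longrightarrow> (\<forall>x\<in>M. C \<beta> x \<subseteq> C \<alpha> x)) \<and>
     (\<forall>x\<in>M. \<forall>y\<in>M. x \<noteq> y \<longrightarrow> (\<exists>\<alpha>\<in>Field \<kappa>. y \<notin> C \<alpha> x))"

definition classes :: "'a set \<Rightarrow> ('k \<Rightarrow> 'a \<Rightarrow> 'a set) \<Rightarrow> 'a set set" where
  "classes M C = {C \<alpha> x |\<alpha> x. \<alpha> \<in> Field \<kappa> \<and> x \<in> M}"

text \<open>A branch over a set \<open>I\<close> of levels is a decreasing sequence of classes, each given by one of its
  points.\<close>

definition branch_on :: "'a set \<Rightarrow> ('k \<Rightarrow> 'a \<Rightarrow> 'a set) \<Rightarrow> 'k set \<Rightarrow> ('k \<Rightarrow> 'a) \<Rightarrow> bool" where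
  "branch_on M C I z \<longleftrightarrow>
     (\<forall>\<alpha>\<in>I. z \<alpha> \<in> M) \<and> (\<forall>\<alpha>\<in>I. \<forall>\<beta>\<in>I. (\<alpha>, \<beta>) \<in> \<kappa> \<longrightarrow> z \<beta> \<in> C \<alpha> (z \<alpha>))"

definition complete_on :: "'a set \<Rightarrow> ('k \<Rightarrow> 'a \<Rightarrow> 'a set) \<Rightarrow> 'k set \<Rightarrow> bool" where
  "complete_on M C I \<longleftrightarrow> (\<forall>z. branch_on M C I z \<longrightarrow> (\<exists>w\<in>M. \<forall>\<alpha>\<in>I. w \<in> C \<alpha> (z \<alpha>)))"

text \<open>Arbitrary sets of levels are allowed since the levels that are met by a sequence of balls need
  not be cofinal in \<open>\<kappa>\<close>, nor have a limit as their supremum.\<close>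

definition spherically_complete_tree :: "'a set \<Rightarrow> ('k \<Rightarrow> 'a \<Rightarrow> 'a set) \<Rightarrow> bool" where
  "spherically_complete_tree M C \<longleftrightarrow>
     partition_tree M C \<and> (\<forall>I. I \<subseteq> Field \<kappa> \<and> I \<noteq> {} \<longrightarrow> complete_on M C I)"

definition tree_topology :: "'a set \<Rightarrow> ('k \<Rightarrow> 'a \<Rightarrow> 'a set) \<Rightarrow> 'a topology" where
  "tree_topology M C = topology_generated_by (classes M C)"

context
  fixes M :: "'a set" and C :: "'k \<Rightarrow> 'a \<Rightarrow> 'a set"
  assumes tree: "partition_tree M C"
begin

lemmas class_props = bspec[OF bspec[OF conjunct1[OF tree[unfolded partition_tree_def]]]]

lemma class_self: "\<alpha> \<in> Field \<kappa> \<Longrightarrow> x \<in> M \<Longrightarrow> x \<in> C \<alpha> x"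
  by (rule conjunct1[OF class_props])

lemma class_subset: "\<alpha> \<in> Field \<kappa> \<Longrightarrow> x \<in> M \<Longrightarrow> C \<alpha> x \<subseteq> M"
  by (rule conjunct1[OF conjunct2[OF class_props]])

lemma class_eq: "\<alpha> \<in> Field \<kappa> \<Longrightarrow> x \<in> M \<Longrightarrow> y \<in> C \<alpha> x \<Longrightarrow> C \<alpha> y = C \<alpha> x"
  by (rule bspec[OF conjunct2[OF conjunct2[OF class_props]]])

lemma class_mono: "(\<alpha>, \<beta>) \<in> \<kappa> \<Longrightarrow> x \<in> M \<Longrightarrow> C \<beta> x \<subseteq> C \<alpha> x"
  using conjunct1[OF conjunct2[OF tree[unfolded partition_tree_def]]] by simp

lemma class_separates: "x \<in> M \<Longrightarrow> y \<in> M \<Longrightarrow> x \<noteq> y \<Longrightarrow> \<exists>\<alpha>\<in>Field \<kappa>. y \<notin> C \<alpha> x"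
  using conjunct2[OF conjunct2[OF tree[unfolded partition_tree_def]]] by simp

lemma class_common:
  "\<alpha> \<in> Field \<kappa> \<Longrightarrow> x \<in> M \<Longrightarrow> y \<in> M \<Longrightarrow> w \<in> C \<alpha> x \<Longrightarrow> w \<in> C \<alpha> y \<Longrightarrow> C \<alpha> x = C \<alpha> y"
  using class_eq by metis

lemma class_sym: "\<alpha> \<in> Field \<kappa> \<Longrightarrow> x \<in> M \<Longrightarrow> y \<in> C \<alpha> x \<Longrightarrow> x \<in> C \<alpha> y"
  using class_eq class_self by metis

lemma class_comparable:
  assumes "(\<alpha>, \<beta>) \<in> \<kappa>" "x \<in> M" "y \<in> M" "w \<in> C \<alpha> x" "w \<in> C \<beta> y"
  shows "C \<beta> y \<subseteq> C \<alpha> x"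
proof -
  have \<alpha>: "\<alpha> \<in> Field \<kappa>" using in_Field(1)[OF assms(1)] .
  have "C \<beta> y \<subseteq> C \<alpha> y" using class_mono assms by blast
  moreover have "C \<alpha> x = C \<alpha> y" using class_common[OF \<alpha> assms(2,3,4)] calculation assms(5) by blast
  ultimately show ?thesis by simp
qed

lemma openin_tree_topology:
  "openin (tree_topology M C) U \<longleftrightarrow> U \<subseteq> M \<and> (\<forall>x\<in>U. \<exists>\<alpha>\<in>Field \<kappa>. C \<alpha> x \<subseteq> U)"
proof -
  have base: "\<exists>D\<in>classes M C. w \<in> D \<and> D \<subseteq> A \<inter> B"
    if A: "A \<in> classes M C" "w \<in> A" and B: "B \<in> classes M C" "w \<in> B" for A B w
  proof -
    obtain \<alpha> x \<beta> y where AB: "A = C \<alpha> x" "\<alpha> \<in> Field \<kappa>" "x \<in> M" "B = C \<beta> y" "\<beta> \<in> Field \<kappa>" "y \<in> M"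
      using A B unfolding classes_def by blast
    have "(\<alpha>, \<beta>) \<in> \<kappa> \<or> (\<beta>, \<alpha>) \<in> \<kappa>" using ord_total AB by blast
    then have "A \<subseteq> B \<or> B \<subseteq> A" using AB A(2) B(2) class_comparable by blast
    then show ?thesis using A B by blast
  qed
  have "(\<exists>D\<in>classes M C. x \<in> D \<and> D \<subseteq> U) \<longleftrightarrow> x \<in> M \<and> (\<exists>\<alpha>\<in>Field \<kappa>. C \<alpha> x \<subseteq> U)" (is "?l \<longleftrightarrow> ?r") for x
  proof
    assume ?l
    then obtain \<alpha> y where *: "\<alpha> \<in> Field \<kappa>" "y \<in> M" "x \<in> C \<alpha> y" "C \<alpha> y \<subseteq> U"
      unfolding classes_def by blast
    then show ?r using class_eq[OF *(1-3)] class_subset by blast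
  next
    assume ?r
    then show ?l using class_self unfolding classes_def by blast
  qed
  moreover have "openin (tree_topology M C) U \<longleftrightarrow> (\<forall>x\<in>U. \<exists>D\<in>classes M C. x \<in> D \<and> D \<subseteq> U)"
    unfolding tree_topology_def by (rule openin_topology_generated_by_base) (rule base)
  ultimately show ?thesis by blast
qed

lemma topspace_tree_topology: "topspace (tree_topology M C) = M"
proof
  show "topspace (tree_topology M C) \<subseteq> M"
    using openin_tree_topology openin_topspace by blast
  have "openin (tree_topology M C) M"
    using openin_tree_topology class_subset Field_nonempty by blast
  then show "M \<subseteq> topspace (tree_topology M C)" by (rule openin_subset)
qed

lemma openin_class: "\<alpha> \<in> Field \<kappa> \<Longrightarrow> x \<in> M \<Longrightarrow> openin (tree_topology M C) (C \<alpha> x)"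
  unfolding openin_tree_topology using class_subset class_eq by blast

lemma closedin_class:
  assumes "\<alpha> \<in> Field \<kappa>" "x \<in> M"
  shows "closedin (tree_topology M C) (C \<alpha> x)"
proof -
  have "C \<alpha> y \<subseteq> M - C \<alpha> x" if "y \<in> M - C \<alpha> x" for y
    using that assms class_subset[of \<alpha> y] class_self[of \<alpha> y] class_common[of \<alpha> x y] by blast
  then have "openin (tree_topology M C) (M - C \<alpha> x)"
    unfolding openin_tree_topology using assms(1) by blast
  then show ?thesis
    using class_subset[OF assms] by (simp add: closedin_def topspace_tree_topology)
qed

lemma kappa_space_tree_topology:
  assumes "|classes M C| \<le>o \<kappa>"
  shows "kappa_space \<kappa> (tree_topology M C)"
  unfolding kappa_space_def
proof (intro conjI)
  let ?T = "tree_topology M C"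
  show "regular_space ?T"
    unfolding neighbourhood_base_of_closedin[symmetric] neighbourhood_base_of
  proof (intro allI impI)
    fix W x assume "openin ?T W \<and> x \<in> W"
    then obtain \<alpha> where *: "\<alpha> \<in> Field \<kappa>" "x \<in> M" "C \<alpha> x \<subseteq> W"
      unfolding openin_tree_topology by blast
    show "\<exists>U V. openin ?T U \<and> closedin ?T V \<and> x \<in> U \<and> U \<subseteq> V \<and> V \<subseteq> W"
      by (intro exI[of _ "C \<alpha> x"] conjI openin_class closedin_class class_self * order_refl)
  qed
  show "Hausdorff_space ?T"
    unfolding Hausdorff_space_def topspace_tree_topology
  proof (intro allI impI)
    fix x y assume xy: "x \<in> M \<and> y \<in> M \<and> x \<noteq> y"
    then obtain \<alpha> where \<alpha>: "\<alpha> \<in> Field \<kappa>" "y \<notin> C \<alpha> x" using class_separates by blast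
    have "disjnt (C \<alpha> x) (C \<alpha> y)"
      unfolding disjnt_iff using class_common[OF \<alpha>(1), of x y] class_self[of \<alpha> y] \<alpha> xy by blast
    then show "\<exists>U V. openin ?T U \<and> openin ?T V \<and> x \<in> U \<and> y \<in> V \<and> disjnt U V"
      using openin_class[OF \<alpha>(1)] class_self[OF \<alpha>(1)] xy
      by (intro exI[of _ "C \<alpha> x"] exI[of _ "C \<alpha> y"]) simp
  qed
  have "\<forall>V\<in>classes M C. openin ?T V" unfolding classes_def using openin_class by blast
  moreover have "\<exists>V\<in>classes M C. x \<in> V \<and> V \<subseteq> U" if "openin ?T U" "x \<in> U" for U x
    using that class_self unfolding openin_tree_topology classes_def by blast
  ultimately show "weight_le \<kappa> ?T"
    unfolding weight_le_def using assms by blast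
qed

end

end


section \<open>From spherically complete trees to metrics\<close>

lemma G_ball_iff: "y \<in> G_ball M d x \<epsilon> \<longleftrightarrow> y \<in> M \<and> d x y < \<epsilon>"
  by (simp add: G_ball_def)

context regular_cardinal
begin

text \<open>Fewer than \<open>\<kappa>\<close> radii cannot be coinitial, so some radius lies strictly below all of them.\<close>

lemma small_set_has_positive_lower_bound:
  assumes "has_Deg TYPE('g::linordered_ab_group_add) \<kappa>"
    and "|T| <o \<kappa>" "\<And>t. t \<in> T \<Longrightarrow> (0::'g) < t"
  shows "\<exists>p>0. \<forall>t\<in>T. p < t"
proof -
  have "\<not> coinitial_in {\<epsilon>::'g. 0 < \<epsilon>} T"
  proof
    assume "coinitial_in {\<epsilon>::'g. 0 < \<epsilon>} T"
    then have "\<kappa> \<le>o |T|"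
      using assms(1) unfolding has_Deg_def has_coinitiality_def by simp
    then show False using not_ordLess_ordLeq[OF assms(2)] by simp
  qed
  then obtain p where "0 < p" "\<forall>t\<in>T. \<not> t \<le> p"
    using assms(3) unfolding coinitial_in_def by (auto simp: subset_iff)
  then show ?thesis by (auto simp: not_le)
qed

lemma coinitial_sequence:
  assumes "has_Deg TYPE('g::linordered_ab_group_add) \<kappa>"
  obtains e :: "'k \<Rightarrow> 'g::linordered_ab_group_add" where "\<And>\<alpha>. \<alpha> \<in> Field \<kappa> \<Longrightarrow> 0 < e \<alpha>"
    "\<And>p. 0 < p \<Longrightarrow> \<exists>\<alpha>\<in>Field \<kappa>. e \<alpha> \<le> p"
proof -
  obtain S where S: "coinitial_in {\<epsilon>::'g. 0 < \<epsilon>} S" and card: "|S| =o \<kappa>"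
    using assms unfolding has_Deg_def has_coinitiality_def by blast
  have "S \<noteq> {}"
  proof
    assume "S = {}"
    then have "|S| <o \<kappa>" by (simp add: small_finite)
    then show False using card not_ordLess_ordIso by blast
  qed
  then obtain e where "e ` Field \<kappa> = S"
    using leq_enum[OF ordIso_imp_ordLeq[OF card]] by metis
  then show ?thesis
    using S that[of e] unfolding coinitial_in_def by (simp add: subset_iff) blast
qed

lemma strictly_decreasing_coinitial_sequence:
  assumes "has_Deg TYPE('g::linordered_ab_group_add) \<kappa>"
  obtains \<epsilon> :: "'k \<Rightarrow> 'g::linordered_ab_group_add" where "\<And>\<alpha>. \<alpha> \<in> Field \<kappa> \<Longrightarrow> 0 < \<epsilon> \<alpha>"
    "\<And>\<alpha> \<beta>. \<alpha> \<in> Field \<kappa> \<Longrightarrow> \<beta> \<in> underS \<kappa> \<alpha> \<Longrightarrow> \<epsilon> \<alpha> < \<epsilon> \<beta>"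
    "\<And>p. 0 < p \<Longrightarrow> \<exists>\<alpha>\<in>Field \<kappa>. \<epsilon> \<alpha> < p"
proof -
  obtain e :: "'k \<Rightarrow> 'g" where e: "\<And>\<alpha>. \<alpha> \<in> Field \<kappa> \<Longrightarrow> 0 < e \<alpha>"
    "\<And>p. 0 < p \<Longrightarrow> \<exists>\<alpha>\<in>Field \<kappa>. e \<alpha> \<le> p"
    using coinitial_sequence[OF assms] by blast
  define H where "H f \<alpha> = (SOME p::'g. 0 < p \<and> (\<forall>t\<in>insert (e \<alpha>) (f ` underS \<kappa> \<alpha>). p < t))" for f \<alpha>
  define \<epsilon> where "\<epsilon> = wfrec (\<kappa> - Id) H"
  have \<epsilon>: "\<epsilon> \<alpha> = H \<epsilon> \<alpha>" for \<alpha>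
  proof -
    have "\<epsilon> \<alpha> = H (cut \<epsilon> (\<kappa> - Id) \<alpha>) \<alpha>"
      unfolding \<epsilon>_def by (rule wfrec[OF wf])
    moreover have "cut \<epsilon> (\<kappa> - Id) \<alpha> ` underS \<kappa> \<alpha> = \<epsilon> ` underS \<kappa> \<alpha>"
      by (rule image_cong) (auto simp: cut_def underS_iff)
    ultimately show ?thesis by (simp add: H_def)
  qed
  have *: "0 < \<epsilon> \<alpha> \<and> (\<forall>t\<in>insert (e \<alpha>) (\<epsilon> ` underS \<kappa> \<alpha>). \<epsilon> \<alpha> < t)" if "\<alpha> \<in> Field \<kappa>" for \<alpha>
    using that
  proof (induction rule: ordinal_induct)
    case (less \<alpha>)
    let ?T = "insert (e \<alpha>) (\<epsilon> ` underS \<kappa> \<alpha>)"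
    have card: "|?T| <o \<kappa>"
      using small_Un[of "{e \<alpha>}" "\<epsilon> ` underS \<kappa> \<alpha>"] small_finite[of "{e \<alpha>}"]
        small_image[OF small_underS[OF less.hyps], of \<epsilon>] by simp
    have pos: "0 < t" if "t \<in> ?T" for t using that less e(1) by blast
    obtain p where "0 < p" "\<And>t. t \<in> ?T \<Longrightarrow> p < t"
      using small_set_has_positive_lower_bound[OF assms card pos] by blast
    then have "0 < p \<and> (\<forall>t\<in>?T. p < t)" by blast
    then show ?case unfolding \<epsilon>[of \<alpha>] H_def by (rule someI)
  qed
  show ?thesis
  proof (rule that[of \<epsilon>])
    show "0 < \<epsilon> \<alpha>" if "\<alpha> \<in> Field \<kappa>" for \<alpha> using *[OF that] by simp
    show "\<epsilon> \<alpha> < \<epsilon> \<beta>" if "\<alpha> \<in> Field \<kappa>" "\<beta> \<in> underS \<kappa> \<alpha>" for \<alpha> \<beta> using *[OF that(1)] that(2) by simp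
    show "\<exists>\<alpha>\<in>Field \<kappa>. \<epsilon> \<alpha> < p" if p: "0 < p" for p
    proof -
      obtain \<alpha> where "\<alpha> \<in> Field \<kappa>" "e \<alpha> \<le> p" using e(2)[OF p] by blast
      then show ?thesis using *[of \<alpha>] by force
    qed
  qed
qed

text \<open>The distance of two points is \<open>\<epsilon> \<delta>\<close> for the first level \<open>\<delta>\<close> that separates them. All that is
  needed later is that \<open>d x y < \<epsilon> \<alpha>\<close> says that \<open>y\<close> is in the class of \<open>x\<close> at level \<open>\<alpha>\<close>, and that
  the sequence \<open>\<epsilon>\<close> takes all nonzero distances as values.\<close>

lemma tree_metric:
  assumes deg: "has_Deg TYPE('g::linordered_ab_group_add) \<kappa>" and tree: "partition_tree M C"
  obtains d :: "'a \<Rightarrow> 'a \<Rightarrow> 'g::linordered_ab_group_add" and \<epsilon> :: "'k \<Rightarrow> 'g"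
  where "G_metric M d"
    "\<And>\<alpha>. \<alpha> \<in> Field \<kappa> \<Longrightarrow> 0 < \<epsilon> \<alpha>"
    "\<And>p. 0 < p \<Longrightarrow> \<exists>\<alpha>\<in>Field \<kappa>. \<epsilon> \<alpha> < p"
    "\<And>\<alpha> x y. \<alpha> \<in> Field \<kappa> \<Longrightarrow> x \<in> M \<Longrightarrow> y \<in> M \<Longrightarrow> d x y < \<epsilon> \<alpha> \<longleftrightarrow> y \<in> C \<alpha> x"
    "\<And>x y. x \<in> M \<Longrightarrow> y \<in> M \<Longrightarrow> x \<noteq> y \<Longrightarrow> d x y \<in> \<epsilon> ` Field \<kappa>"
proof -
  obtain \<epsilon> :: "'k \<Rightarrow> 'g" where pos: "\<And>\<alpha>. \<alpha> \<in> Field \<kappa> \<Longrightarrow> 0 < \<epsilon> \<alpha>"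
    and decr: "\<And>\<alpha> \<beta>. \<alpha> \<in> Field \<kappa> \<Longrightarrow> \<beta> \<in> underS \<kappa> \<alpha> \<Longrightarrow> \<epsilon> \<alpha> < \<epsilon> \<beta>"
    and coinit: "\<And>p. 0 < p \<Longrightarrow> \<exists>\<alpha>\<in>Field \<kappa>. \<epsilon> \<alpha> < p"
    using strictly_decreasing_coinitial_sequence[OF deg] by blast
  have "\<exists>\<delta>. \<delta> \<in> Field \<kappa> \<and> (\<forall>\<alpha>\<in>Field \<kappa>. y \<in> C \<alpha> x \<longleftrightarrow> \<alpha> \<in> underS \<kappa> \<delta>)"
    if xy: "x \<in> M" "y \<in> M" "x \<noteq> y" for x y
  proof -
    let ?S = "{\<alpha> \<in> Field \<kappa>. y \<notin> C \<alpha> x}"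
    have "?S \<noteq> {}" using class_separates[OF tree xy] by blast
    then obtain \<delta> where \<delta>: "\<delta> \<in> ?S" "\<And>\<alpha>. \<alpha> \<in> ?S \<Longrightarrow> (\<delta>, \<alpha>) \<in> \<kappa>" using least[of ?S] by blast
    have "y \<in> C \<alpha> x \<longleftrightarrow> \<alpha> \<in> underS \<kappa> \<delta>" if \<alpha>: "\<alpha> \<in> Field \<kappa>" for \<alpha>
    proof
      assume "y \<in> C \<alpha> x"
      then have "(\<delta>, \<alpha>) \<notin> \<kappa>" using class_mono[OF tree _ xy(1), of \<delta> \<alpha>] \<delta>(1) by blast
      then show "\<alpha> \<in> underS \<kappa> \<delta>" using linear[of \<delta> \<alpha>] \<delta>(1) \<alpha> by blast
    next
      assume "\<alpha> \<in> underS \<kappa> \<delta>"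
      then have "(\<delta>, \<alpha>) \<notin> \<kappa>" using not_underS by blast
      then show "y \<in> C \<alpha> x" using \<delta>(2) \<alpha> by blast
    qed
    then show ?thesis using \<delta>(1) by blast
  qed
  then obtain \<Delta> where \<Delta>: "\<And>x y. x \<in> M \<Longrightarrow> y \<in> M \<Longrightarrow> x \<noteq> y \<Longrightarrow> \<Delta> x y \<in> Field \<kappa> \<and>
      (\<forall>\<alpha>\<in>Field \<kappa>. y \<in> C \<alpha> x \<longleftrightarrow> \<alpha> \<in> underS \<kappa> (\<Delta> x y))"
    by metis
  define d where "d x y = (if x = y then 0 else \<epsilon> (\<Delta> x y))" for x y
  have key: "d x y < \<epsilon> \<alpha> \<longleftrightarrow> y \<in> C \<alpha> x" if \<alpha>: "\<alpha> \<in> Field \<kappa>" and xy: "x \<in> M" "y \<in> M" for \<alpha> x y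
  proof (cases "x = y")
    case True
    then show ?thesis using class_self[OF tree \<alpha> xy(1)] pos[OF \<alpha>] by (simp add: d_def)
  next
    case False
    have \<delta>: "\<Delta> x y \<in> Field \<kappa>" using \<Delta>[OF xy False] by blast
    have "\<epsilon> (\<Delta> x y) < \<epsilon> \<alpha> \<longleftrightarrow> \<alpha> \<in> underS \<kappa> (\<Delta> x y)"
    proof
      assume less: "\<epsilon> (\<Delta> x y) < \<epsilon> \<alpha>"
      show "\<alpha> \<in> underS \<kappa> (\<Delta> x y)"
      proof (rule ccontr)
        assume "\<alpha> \<notin> underS \<kappa> (\<Delta> x y)"
        then have "\<Delta> x y = \<alpha> \<or> \<Delta> x y \<in> underS \<kappa> \<alpha>"
          using linear[OF \<delta> \<alpha>] unfolding underS_iff by blast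
        then show False using less decr[OF \<alpha>, of "\<Delta> x y"] by auto
      qed
    qed (rule decr[OF \<delta>])
    then show ?thesis using \<Delta>[OF xy False] \<alpha> False by (simp add: d_def)
  qed
  have vals: "d x y \<in> \<epsilon> ` Field \<kappa>" if "x \<in> M" "y \<in> M" "x \<noteq> y" for x y
    using \<Delta>[OF that] that(3) by (simp add: d_def)
  have pos_d: "0 \<le> d x y \<and> (d x y = 0 \<longleftrightarrow> x = y)" if xy: "x \<in> M" "y \<in> M" for x y
  proof (cases "x = y")
    case False
    then show ?thesis using vals[OF xy False] pos by auto (metis less_imp_le, metis less_irrefl)
  qed (simp add: d_def)
  have le_swap: "d y x \<le> d x y" if xy: "x \<in> M" "y \<in> M" for x y
  proof (cases "x = y")
    case False
    then obtain \<delta> where \<delta>: "\<delta> \<in> Field \<kappa>" "d y x = \<epsilon> \<delta>" using vals[of y x] xy by auto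
    have "\<not> d x y < \<epsilon> \<delta>"
      using key[OF \<delta>(1) xy] key[OF \<delta>(1) xy(2,1)] \<delta>(2) class_sym[OF tree \<delta>(1) xy(1)] by auto
    then show ?thesis using \<delta>(2) by simp
  qed simp
  have ultra: "d x z \<le> d x y \<or> d x z \<le> d y z" if xyz: "x \<in> M" "y \<in> M" "z \<in> M" for x y z
  proof (cases "x = z")
    case False
    then obtain \<delta> where \<delta>: "\<delta> \<in> Field \<kappa>" "d x z = \<epsilon> \<delta>" using vals[of x z] xyz by auto
    have "z \<notin> C \<delta> x" using key[OF \<delta>(1) xyz(1,3)] \<delta>(2) by simp
    then have "\<not> (d x y < \<epsilon> \<delta> \<and> d y z < \<epsilon> \<delta>)"
      using key[OF \<delta>(1) xyz(1,2)] key[OF \<delta>(1) xyz(2,3)] class_eq[OF tree \<delta>(1) xyz(1), of y] by auto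
    then show ?thesis using \<delta>(2) by auto
  qed (use pos_d xyz in \<open>simp add: d_def\<close>)
  have "d x z \<le> d x y + d y z" if xyz: "x \<in> M" "y \<in> M" "z \<in> M" for x y z
    using ultra[OF xyz] pos_d[OF xyz(1,2)] pos_d[OF xyz(2,3)]
    by (meson add_increasing add_increasing2 order_trans)
  then have "G_metric M d"
    unfolding G_metric_def using pos_d le_swap by (auto intro: order_antisym)
  then show ?thesis using that pos coinit key vals by blast
qed

text \<open>The ball of radius \<open>\<eta>\<close> around \<open>x\<close> is the intersection of the classes of \<open>x\<close> at the levels
  \<open>\<beta>\<close> with \<open>\<eta> \<le> \<epsilon> \<beta>\<close>. Hence a decreasing sequence of balls amounts to a branch over all levels that
  occur in this way, and a Cauchy sequence determines a branch over all levels.\<close>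

lemma spherically_complete_tree_imp_sph_complete_G_Polish:
  assumes deg: "has_Deg TYPE('g::linordered_ab_group_add) \<kappa>"
    and sct: "spherically_complete_tree M C"
    and space: "kappa_space \<kappa> X" "topspace X = M"
    and X: "\<And>U. openin X U \<longleftrightarrow> U \<subseteq> M \<and> (\<forall>x\<in>U. \<exists>\<alpha>\<in>Field \<kappa>. C \<alpha> x \<subseteq> U)"
  shows "sph_complete_G_Polish TYPE('g) \<kappa> X"
proof -
  have tree: "partition_tree M C" using sct by (simp add: spherically_complete_tree_def)
  obtain d :: "'a \<Rightarrow> 'a \<Rightarrow> 'g" and \<epsilon> :: "'k \<Rightarrow> 'g" where metric: "G_metric M d"
    and pos: "\<And>\<alpha>. \<alpha> \<in> Field \<kappa> \<Longrightarrow> 0 < \<epsilon> \<alpha>"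
    and coinit: "\<And>p. 0 < p \<Longrightarrow> \<exists>\<alpha>\<in>Field \<kappa>. \<epsilon> \<alpha> < p"
    and key: "\<And>\<alpha> x y. \<alpha> \<in> Field \<kappa> \<Longrightarrow> x \<in> M \<Longrightarrow> y \<in> M \<Longrightarrow> d x y < \<epsilon> \<alpha> \<longleftrightarrow> y \<in> C \<alpha> x"
    and vals: "\<And>x y. x \<in> M \<Longrightarrow> y \<in> M \<Longrightarrow> x \<noteq> y \<Longrightarrow> d x y \<in> \<epsilon> ` Field \<kappa>"
    by (rule tree_metric[OF deg tree]) (rule that)
  have zero: "d x x = 0" if "x \<in> M" for x using metric that unfolding G_metric_def by blast
  have full: "\<exists>w\<in>M. \<forall>\<alpha>\<in>I. w \<in> C \<alpha> (z \<alpha>)" if "I \<subseteq> Field \<kappa>" "I \<noteq> {}" "branch_on M C I z" for I z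
    using sct that unfolding spherically_complete_tree_def complete_on_def by blast
  define L where "L \<eta> = {\<beta> \<in> Field \<kappa>. \<eta> \<le> \<epsilon> \<beta>}" for \<eta>
  have ball: "y \<in> G_ball M d x \<eta> \<longleftrightarrow> y \<in> M \<and> (\<forall>\<beta>\<in>L \<eta>. y \<in> C \<beta> x)" if x: "x \<in> M" and \<eta>: "0 < \<eta>" for x y \<eta>
  proof -
    have "d x y < \<eta> \<longleftrightarrow> (\<forall>\<beta>\<in>L \<eta>. y \<in> C \<beta> x)" if y: "y \<in> M"
    proof
      assume "d x y < \<eta>"
      then have "d x y < \<epsilon> \<beta>" if "\<beta> \<in> L \<eta>" for \<beta> using that unfolding L_def by auto
      then show "\<forall>\<beta>\<in>L \<eta>. y \<in> C \<beta> x" using key[OF _ x y] unfolding L_def by blast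
    next
      assume *: "\<forall>\<beta>\<in>L \<eta>. y \<in> C \<beta> x"
      show "d x y < \<eta>"
      proof (cases "x = y")
        case True
        then show ?thesis using zero[OF x] \<eta> by simp
      next
        case False
        then obtain \<delta> where \<delta>: "\<delta> \<in> Field \<kappa>" "d x y = \<epsilon> \<delta>" using vals[OF x y] by blast
        have "\<delta> \<notin> L \<eta>" using * key[OF \<delta>(1) x y] \<delta>(2) by auto
        then show ?thesis using \<delta> by (simp add: L_def)
      qed
    qed
    then show ?thesis by (auto simp: G_ball_iff)
  qed
  \<comment> \<open>Classes are balls, and every ball contains a class with the same centre.\<close>
  have class_ball: "C \<alpha> x = G_ball M d x (\<epsilon> \<alpha>)" if "\<alpha> \<in> Field \<kappa>" "x \<in> M" for \<alpha> x
    using key[OF that] class_subset[OF tree that] by (auto simp: G_ball_iff)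
  have ball_class: "\<exists>\<alpha>\<in>Field \<kappa>. C \<alpha> x \<subseteq> G_ball M d x \<eta>" if x: "x \<in> M" and \<eta>: "0 < \<eta>" for x \<eta>
  proof -
    obtain \<alpha> where \<alpha>: "\<alpha> \<in> Field \<kappa>" "\<epsilon> \<alpha> < \<eta>" using coinit[OF \<eta>] by blast
    have "C \<alpha> x \<subseteq> G_ball M d x \<eta>"
      unfolding class_ball[OF \<alpha>(1) x] using \<alpha>(2) by (auto simp: G_ball_iff)
    then show ?thesis using \<alpha>(1) by blast
  qed
  have "compatible_G_metric X d"
  proof (rule compatible_G_metricI)
    show "G_metric (topspace X) d" using metric space(2) by simp
    fix U assume U: "U \<subseteq> topspace X"
    have "(\<exists>\<alpha>\<in>Field \<kappa>. C \<alpha> x \<subseteq> U) \<longleftrightarrow> (\<exists>\<epsilon>>0. G_ball M d x \<epsilon> \<subseteq> U)" if "x \<in> U" for x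
    proof
      have x: "x \<in> M" using that U space(2) by blast
      show "\<exists>\<epsilon>>0. G_ball M d x \<epsilon> \<subseteq> U" if "\<exists>\<alpha>\<in>Field \<kappa>. C \<alpha> x \<subseteq> U"
        using that class_ball[OF _ x] pos by metis
      show "\<exists>\<alpha>\<in>Field \<kappa>. C \<alpha> x \<subseteq> U" if "\<exists>\<epsilon>>0. G_ball M d x \<epsilon> \<subseteq> U"
        using that ball_class[OF x] by (meson subset_trans)
    qed
    then show "openin X U \<longleftrightarrow> (\<forall>x\<in>U. \<exists>\<epsilon>>0. G_ball (topspace X) d x \<epsilon> \<subseteq> U)"
      unfolding X space(2) using U space(2) by simp
  qed
  moreover have "Cauchy_complete \<kappa> M d"
    unfolding Cauchy_complete_def
  proof (intro allI impI)
    fix s assume s: "(\<forall>\<alpha>\<in>Field \<kappa>. s \<alpha> \<in> M) \<and> G_Cauchy \<kappa> d s"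
    have "\<exists>b\<in>Field \<kappa>. \<forall>\<beta> \<gamma>. (b, \<beta>) \<in> \<kappa> \<and> (b, \<gamma>) \<in> \<kappa> \<longrightarrow> d (s \<beta>) (s \<gamma>) < \<epsilon> \<alpha>" if "\<alpha> \<in> Field \<kappa>" for \<alpha>
      using s pos[OF that] unfolding G_Cauchy_def by blast
    then obtain b where b: "\<And>\<alpha>. \<alpha> \<in> Field \<kappa> \<Longrightarrow> b \<alpha> \<in> Field \<kappa> \<and>
        (\<forall>\<beta> \<gamma>. (b \<alpha>, \<beta>) \<in> \<kappa> \<and> (b \<alpha>, \<gamma>) \<in> \<kappa> \<longrightarrow> d (s \<beta>) (s \<gamma>) < \<epsilon> \<alpha>)"
      by metis
    have sM: "s (b \<alpha>) \<in> M" if "\<alpha> \<in> Field \<kappa>" for \<alpha> using b[OF that] s by blast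
    have tail: "s \<gamma> \<in> C \<alpha> (s (b \<alpha>))" if "\<alpha> \<in> Field \<kappa>" "(b \<alpha>, \<gamma>) \<in> \<kappa>" for \<alpha> \<gamma>
    proof -
      have "d (s (b \<alpha>)) (s \<gamma>) < \<epsilon> \<alpha>" using b[OF that(1)] that(2) ord_refl by blast
      then show ?thesis using key[OF that(1) sM[OF that(1)], of "s \<gamma>"] s in_Field(2)[OF that(2)] by blast
    qed
    have "branch_on M C (Field \<kappa>) (\<lambda>\<alpha>. s (b \<alpha>))"
      unfolding branch_on_def
    proof (intro conjI ballI impI)
      fix \<alpha> \<beta> assume \<alpha>: "\<alpha> \<in> Field \<kappa>" and \<beta>: "\<beta> \<in> Field \<kappa>" and le: "(\<alpha>, \<beta>) \<in> \<kappa>"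
      obtain \<gamma> where \<gamma>: "(b \<alpha>, \<gamma>) \<in> \<kappa>" "(b \<beta>, \<gamma>) \<in> \<kappa>"
        using ord_total[of "b \<alpha>" "b \<beta>"] ord_refl b \<alpha> \<beta> by blast
      have "C \<beta> (s (b \<beta>)) \<subseteq> C \<alpha> (s (b \<alpha>))"
        using class_comparable[OF tree le sM[OF \<alpha>] sM[OF \<beta>] tail[OF \<alpha> \<gamma>(1)] tail[OF \<beta> \<gamma>(2)]] .
      then show "s (b \<beta>) \<in> C \<alpha> (s (b \<alpha>))" using class_self[OF tree \<beta> sM[OF \<beta>]] by blast
    qed (rule sM)
    then obtain w where w: "w \<in> M" "\<And>\<alpha>. \<alpha> \<in> Field \<kappa> \<Longrightarrow> w \<in> C \<alpha> (s (b \<alpha>))"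
      using full[of "Field \<kappa>"] Field_nonempty by blast
    have "G_converges_to \<kappa> d s w"
      unfolding G_converges_to_def
    proof (intro allI impI)
      fix \<eta> :: 'g assume "0 < \<eta>"
      then obtain \<alpha> where \<alpha>: "\<alpha> \<in> Field \<kappa>" "\<epsilon> \<alpha> < \<eta>" using coinit by blast
      have "d (s \<beta>) w < \<eta>" if \<beta>: "(b \<alpha>, \<beta>) \<in> \<kappa>" for \<beta>
      proof -
        have sb: "s \<beta> \<in> M" using s in_Field(2)[OF \<beta>] by blast
        have "w \<in> C \<alpha> (s \<beta>)" using class_eq[OF tree \<alpha>(1) sM[OF \<alpha>(1)] tail[OF \<alpha>(1) \<beta>]] w(2)[OF \<alpha>(1)] by simp
        then show ?thesis using key[OF \<alpha>(1) sb w(1)] \<alpha>(2) by auto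
      qed
      then show "\<exists>\<alpha>\<in>Field \<kappa>. \<forall>\<beta>. (\<alpha>, \<beta>) \<in> \<kappa> \<longrightarrow> d (s \<beta>) w < \<eta>" using b[OF \<alpha>(1)] by blast
    qed
    then show "\<exists>l\<in>M. G_converges_to \<kappa> d s l" using w(1) by blast
  qed
  moreover have "spherically_complete M d"
    unfolding spherically_complete_def
  proof (intro allI impI, elim conjE)
    fix r :: "'a set rel" and c \<eta>
    assume r: "Well_order r" "Field r \<noteq> {}"
      and c: "\<forall>i\<in>Field r. c i \<in> M \<and> 0 < \<eta> i"
      and decreasing: "\<forall>i j. (i, j) \<in> r \<longrightarrow> G_ball M d (c j) (\<eta> j) \<subseteq> G_ball M d (c i) (\<eta> i)"
    let ?I = "\<Union>i\<in>Field r. L (\<eta> i)"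
    have meet: "\<exists>w\<in>M. (\<forall>\<beta>\<in>L (\<eta> i). w \<in> C \<beta> (c i)) \<and> (\<forall>\<beta>\<in>L (\<eta> j). w \<in> C \<beta> (c j))"
      if i: "i \<in> Field r" and j: "j \<in> Field r" for i j
    proof -
      have "(i, j) \<in> r \<or> (j, i) \<in> r"
        using r(1) i j unfolding order_on_defs total_on_def refl_on_def by metis
      then have "G_ball M d (c j) (\<eta> j) \<subseteq> G_ball M d (c i) (\<eta> i) \<or> G_ball M d (c i) (\<eta> i) \<subseteq> G_ball M d (c j) (\<eta> j)"
        using decreasing by blast
      moreover have "c i \<in> G_ball M d (c i) (\<eta> i)" "c j \<in> G_ball M d (c j) (\<eta> j)"
        using center_in_G_ball[OF metric] c i j by blast+
      ultimately obtain w where "w \<in> G_ball M d (c i) (\<eta> i)" "w \<in> G_ball M d (c j) (\<eta> j)" by blast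
      then show ?thesis using ball c i j by blast
    qed
    have same_class: "C \<beta> (c i) = C \<beta> (c j)"
      if ij: "i \<in> Field r" "j \<in> Field r" "\<beta> \<in> L (\<eta> i)" "\<beta> \<in> L (\<eta> j)" for i j \<beta>
    proof -
      obtain w where w: "w \<in> C \<beta> (c i)" "w \<in> C \<beta> (c j)" using meet[OF ij(1,2)] ij(3,4) by blast
      have \<beta>: "\<beta> \<in> Field \<kappa>" using ij(3) by (simp add: L_def)
      show ?thesis using class_common[OF tree \<beta> _ _ w] c ij by blast
    qed
    have "\<exists>w\<in>M. \<forall>i\<in>Field r. \<forall>\<beta>\<in>L (\<eta> i). w \<in> C \<beta> (c i)"
    proof (cases "?I = {}")
      case True
      then show ?thesis using r(2) c by blast
    next
      case False
      have "\<forall>\<beta>\<in>?I. \<exists>i. i \<in> Field r \<and> \<beta> \<in> L (\<eta> i)" by blast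
      then obtain i where i: "\<And>\<beta>. \<beta> \<in> ?I \<Longrightarrow> i \<beta> \<in> Field r \<and> \<beta> \<in> L (\<eta> (i \<beta>))" by metis
      have I: "?I \<subseteq> Field \<kappa>" by (auto simp: L_def)
      have "branch_on M C ?I (\<lambda>\<beta>. c (i \<beta>))"
        unfolding branch_on_def
      proof (intro conjI ballI impI)
        show "c (i \<alpha>) \<in> M" if "\<alpha> \<in> ?I" for \<alpha> using i[OF that] c by blast
        fix \<alpha> \<beta> assume \<alpha>: "\<alpha> \<in> ?I" and \<beta>: "\<beta> \<in> ?I" and le: "(\<alpha>, \<beta>) \<in> \<kappa>"
        obtain w where w: "w \<in> C \<alpha> (c (i \<alpha>))" "w \<in> C \<beta> (c (i \<beta>))"
          using meet[of "i \<alpha>" "i \<beta>"] i[OF \<alpha>] i[OF \<beta>] by blast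
        have M: "c (i \<alpha>) \<in> M" "c (i \<beta>) \<in> M" using i[OF \<alpha>] i[OF \<beta>] c by blast+
        have "C \<beta> (c (i \<beta>)) \<subseteq> C \<alpha> (c (i \<alpha>))" using class_comparable[OF tree le M w] .
        then show "c (i \<beta>) \<in> C \<alpha> (c (i \<alpha>))" using class_self[OF tree in_Field(2)[OF le] M(2)] by blast
      qed
      then obtain w where w: "w \<in> M" "\<And>\<beta>. \<beta> \<in> ?I \<Longrightarrow> w \<in> C \<beta> (c (i \<beta>))"
        using full[OF I False] by blast
      have "w \<in> C \<beta> (c j)" if j: "j \<in> Field r" "\<beta> \<in> L (\<eta> j)" for j \<beta>
      proof -
        have \<beta>: "\<beta> \<in> ?I" using j by blast
        show ?thesis using w(2)[OF \<beta>] same_class[of "i \<beta>" j \<beta>] i[OF \<beta>] j by blast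
      qed
      then show ?thesis using w(1) by blast
    qed
    then obtain w where w: "w \<in> M" "\<And>i. i \<in> Field r \<Longrightarrow> \<forall>\<beta>\<in>L (\<eta> i). w \<in> C \<beta> (c i)" by blast
    have "w \<in> G_ball M d (c i) (\<eta> i)" if "i \<in> Field r" for i
      using ball[of "c i" "\<eta> i" w] c that w by blast
    then show "(\<Inter>i\<in>Field r. G_ball M d (c i) (\<eta> i)) \<noteq> {}" by blast
  qed
  ultimately show ?thesis
    unfolding sph_complete_G_Polish_def using space by blast
qed

end


section \<open>Winning strategies from metrics\<close>

lemma G_metric_triangle:
  "G_metric M d \<Longrightarrow> x \<in> M \<Longrightarrow> y \<in> M \<Longrightarrow> z \<in> M \<Longrightarrow> d x z \<le> d x y + d y z"
  unfolding G_metric_def by blast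

lemma G_metric_sym: "G_metric M d \<Longrightarrow> x \<in> M \<Longrightarrow> y \<in> M \<Longrightarrow> d x y = d y x"
  unfolding G_metric_def by (elim conjE) simp

context regular_cardinal
begin

text \<open>There is no least positive element, since \<open>\<kappa>\<close> is infinite.\<close>

lemma exists_half:
  assumes "has_Deg TYPE('g::linordered_ab_group_add) \<kappa>" "0 < (\<epsilon>::'g)"
  shows "\<exists>\<delta>>0. \<delta> + \<delta> \<le> \<epsilon>"
proof -
  obtain p where p: "0 < p" "p < \<epsilon>"
    using small_set_has_positive_lower_bound[OF assms(1) small_finite[of "{\<epsilon>}"]] assms(2) by auto
  have "min p (\<epsilon> - p) + min p (\<epsilon> - p) \<le> p + (\<epsilon> - p)" by (intro add_mono) simp_all
  then have "min p (\<epsilon> - p) + min p (\<epsilon> - p) \<le> \<epsilon>" by simp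
  moreover have "0 < min p (\<epsilon> - p)" using p by simp
  ultimately show ?thesis by blast
qed

lemma kappa_additive_if_compatible_G_metric:
  assumes deg: "has_Deg TYPE('g::linordered_ab_group_add) \<kappa>"
    and d: "compatible_G_metric X (d :: 'a \<Rightarrow> 'a \<Rightarrow> 'g)"
  shows "kappa_additive \<kappa> X"
  unfolding kappa_additive_def
proof (intro allI impI, elim conjE)
  fix \<U> assume small: "|\<U>| <o \<kappa>" and op: "\<forall>U\<in>\<U>. openin X U"
  let ?M = "topspace X"
  have "\<exists>\<epsilon>>0. G_ball ?M d x \<epsilon> \<subseteq> ?M \<inter> \<Inter>\<U>" if x: "x \<in> ?M \<inter> \<Inter>\<U>" for x
  proof -
    have "\<forall>U\<in>\<U>. \<exists>\<epsilon>. 0 < \<epsilon> \<and> G_ball ?M d x \<epsilon> \<subseteq> U"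
      using op x unfolding openin_compatible_G_metric[OF d] by blast
    then obtain \<epsilon> where \<epsilon>: "\<And>U. U \<in> \<U> \<Longrightarrow> 0 < \<epsilon> U \<and> G_ball ?M d x (\<epsilon> U) \<subseteq> U" by metis
    have "\<exists>p>0. \<forall>t\<in>\<epsilon> ` \<U>. p < t"
      by (rule small_set_has_positive_lower_bound[OF deg small_image[OF small]]) (use \<epsilon> in blast)
    then obtain p where p: "0 < p" "\<And>U. U \<in> \<U> \<Longrightarrow> p < \<epsilon> U" by blast
    have "G_ball ?M d x p \<subseteq> U" if "U \<in> \<U>" for U
    proof -
      have "G_ball ?M d x p \<subseteq> G_ball ?M d x (\<epsilon> U)" using p(2)[OF that] by (auto simp: G_ball_def)
      then show ?thesis using \<epsilon>[OF that] by blast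
    qed
    then have "G_ball ?M d x p \<subseteq> ?M \<inter> \<Inter>\<U>" by (auto simp: G_ball_def)
    then show ?thesis using p(1) by blast
  qed
  then show "openin X (?M \<inter> \<Inter>\<U>)" unfolding openin_compatible_G_metric[OF d] by blast
qed

lemma openin_stage:
  assumes "kappa_additive \<kappa> X" "\<alpha> \<in> Field \<kappa>" "\<And>\<beta>. \<beta> \<in> underS \<kappa> \<alpha> \<Longrightarrow> openin X (V \<beta>)"
  shows "openin X (stage \<kappa> X V \<alpha>)"
proof -
  have "|V ` underS \<kappa> \<alpha>| <o \<kappa>" by (rule small_image[OF small_underS[OF assms(2)]])
  then show ?thesis
    using assms(1,3) unfolding kappa_additive_def stage_def by blast
qed

text \<open>Spherical completeness speaks of sequences indexed by well-orders of sets of points, so a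
  decreasing sequence of balls is re-indexed by its own range, ordered by reverse inclusion.\<close>

lemma decreasing_balls_meet:
  assumes sph: "spherically_complete M d"
    and I: "I \<subseteq> Field \<kappa>" "I \<noteq> {}"
    and c: "\<And>\<alpha>. \<alpha> \<in> I \<Longrightarrow> c \<alpha> \<in> M \<and> 0 < r \<alpha>"
    and decr: "\<And>\<alpha> \<beta>. \<alpha> \<in> I \<Longrightarrow> \<beta> \<in> I \<Longrightarrow> (\<alpha>, \<beta>) \<in> \<kappa> \<Longrightarrow>
      G_ball M d (c \<beta>) (r \<beta>) \<subseteq> G_ball M d (c \<alpha>) (r \<alpha>)"
  shows "\<exists>w\<in>M. \<forall>\<alpha>\<in>I. w \<in> G_ball M d (c \<alpha>) (r \<alpha>)"
proof -
  define B where "B \<alpha> = G_ball M d (c \<alpha>) (r \<alpha>)" for \<alpha>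
  define R where "R = {(A, A'). A \<in> B ` I \<and> A' \<in> B ` I \<and> A' \<subseteq> A}"
  have decr': "B \<beta> \<subseteq> B \<alpha>" if "\<alpha> \<in> I" "\<beta> \<in> I" "(\<alpha>, \<beta>) \<in> \<kappa>" for \<alpha> \<beta>
    using decr[OF that] by (simp add: B_def)
  have comparable: "A \<subseteq> A' \<or> A' \<subseteq> A" if A: "A \<in> B ` I" "A' \<in> B ` I" for A A'
  proof -
    obtain \<alpha> \<beta> where "\<alpha> \<in> I" "\<beta> \<in> I" "A = B \<alpha>" "A' = B \<beta>" using A by blast
    then show ?thesis using ord_total[of \<alpha> \<beta>] I(1) decr'[of \<alpha> \<beta>] decr'[of \<beta> \<alpha>] by blast
  qed
  have Field: "Field R = B ` I" unfolding Field_def R_def by blast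
  have "wf (R - Id)"
  proof (rule wfI_min)
    fix A Q assume A: "(A :: 'a set) \<in> Q"
    show "\<exists>z\<in>Q. \<forall>y. (y, z) \<in> R - Id \<longrightarrow> y \<notin> Q"
    proof (cases "A \<in> B ` I")
      case True
      then have "{\<alpha> \<in> I. B \<alpha> \<in> Q} \<noteq> {}" using A by blast
      then obtain \<alpha> where \<alpha>: "\<alpha> \<in> I" "B \<alpha> \<in> Q" "\<And>\<beta>. \<beta> \<in> {\<alpha> \<in> I. B \<alpha> \<in> Q} \<Longrightarrow> (\<alpha>, \<beta>) \<in> \<kappa>"
        using least[of "{\<alpha> \<in> I. B \<alpha> \<in> Q}"] I(1) by blast
      have "y \<notin> Q" if y: "(y, B \<alpha>) \<in> R - Id" for y
      proof
        assume "y \<in> Q"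
        obtain \<beta> where \<beta>: "\<beta> \<in> I" "y = B \<beta>" "B \<alpha> \<subset> B \<beta>" using y unfolding R_def by blast
        then have "(\<alpha>, \<beta>) \<in> \<kappa>" using \<alpha>(3) \<open>y \<in> Q\<close> by blast
        then show False using decr'[OF \<alpha>(1) \<beta>(1)] \<beta>(3) by blast
      qed
      then show ?thesis using \<alpha>(2) by blast
    next
      case False
      then show ?thesis using A unfolding R_def by blast
    qed
  qed
  then have R: "Well_order R"
    unfolding order_on_defs Field using comparable
    by (auto simp: R_def refl_on_def trans_def antisym_def total_on_def)
  have "\<forall>A\<in>B ` I. \<exists>\<alpha>\<in>I. B \<alpha> = A" by blast
  then obtain idx where idx: "\<And>A. A \<in> B ` I \<Longrightarrow> idx A \<in> I \<and> B (idx A) = A" by metis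
  have ball_idx: "G_ball M d (c (idx A)) (r (idx A)) = A" if "A \<in> B ` I" for A
    using idx[OF that] by (simp add: B_def)
  have "\<forall>i j. (i, j) \<in> R \<longrightarrow>
      G_ball M d (c (idx j)) (r (idx j)) \<subseteq> G_ball M d (c (idx i)) (r (idx i))"
    using ball_idx unfolding R_def by auto
  moreover have "\<forall>i\<in>Field R. c (idx i) \<in> M \<and> 0 < r (idx i)" using idx c unfolding Field by blast
  moreover have "Field R \<noteq> {}" using I(2) Field by blast
  ultimately have "(\<Inter>A\<in>Field R. G_ball M d (c (idx A)) (r (idx A))) \<noteq> {}"
    using sph[unfolded spherically_complete_def, rule_format, of R "\<lambda>A. c (idx A)" "\<lambda>A. r (idx A)"] R
    by blast
  then obtain w where w: "w \<in> (\<Inter>A\<in>B ` I. G_ball M d (c (idx A)) (r (idx A)))"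
    unfolding Field by blast
  have "w \<in> B \<alpha>" if \<alpha>: "\<alpha> \<in> I" for \<alpha>
    using w \<alpha> ball_idx[OF imageI[OF \<alpha>, of B]] by (auto dest: INT_D)
  then have "\<forall>\<alpha>\<in>I. w \<in> B \<alpha>" by blast
  moreover have "w \<in> M" using I(2) calculation by (auto simp: B_def G_ball_def)
  ultimately show ?thesis unfolding B_def by blast
qed

end

text \<open>II answers a move \<open>(U, x)\<close> of I in round \<open>\<alpha>\<close> by a ball of radius at most \<open>e \<alpha>\<close> around \<open>x\<close>,
  taken so small that even the closed ball of that radius lies within \<open>U\<close>.\<close>

definition ball_strategy ::
    "'a set \<Rightarrow> ('a \<Rightarrow> 'a \<Rightarrow> 'g::linordered_ab_group_add) \<Rightarrow> ('k \<Rightarrow> 'g) \<Rightarrow>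
      'k \<Rightarrow> ('k \<Rightarrow> 'a set \<times> 'a) \<Rightarrow> 'a set" where
  "ball_strategy M d e \<alpha> q = (case q \<alpha> of (U, x) \<Rightarrow>
     G_ball M d x (SOME r. 0 < r \<and> r \<le> e \<alpha> \<and> {y \<in> M. d x y \<le> r} \<subseteq> U))"

locale G_metric_game = regular_cardinal \<kappa> for \<kappa> :: "'k rel" +
  fixes X :: "'a topology" and d :: "'a \<Rightarrow> 'a \<Rightarrow> 'g::linordered_ab_group_add" and e :: "'k \<Rightarrow> 'g"
  assumes deg: "has_Deg TYPE('g) \<kappa>"
    and compat: "compatible_G_metric X d"
    and e_pos: "\<And>\<alpha>. \<alpha> \<in> Field \<kappa> \<Longrightarrow> 0 < e \<alpha>"
    and e_coinitial: "\<And>p. 0 < p \<Longrightarrow> \<exists>\<alpha>\<in>Field \<kappa>. e \<alpha> \<le> p"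
begin

abbreviation "M \<equiv> topspace X"
abbreviation "\<sigma> \<equiv> ball_strategy M d e"
abbreviation "V \<equiv> responses \<kappa> \<sigma>"
abbreviation "legal p \<equiv> legal_I \<kappa> X p (V p)"

lemma metric: "G_metric M d"
  using compat by (simp add: compatible_G_metric_def)

lemma additive: "kappa_additive \<kappa> X"
  by (rule kappa_additive_if_compatible_G_metric[OF deg compat])

text \<open>The radius used by \<^const>\<open>ball_strategy\<close> in round \<open>\<alpha>\<close> when I plays \<open>p\<close>.\<close>

definition radius :: "('k \<Rightarrow> 'a set \<times> 'a) \<Rightarrow> 'k \<Rightarrow> 'g" where
  "radius p \<alpha> = (SOME r. 0 < r \<and> r \<le> e \<alpha> \<and> {y \<in> M. d (snd (p \<alpha>)) y \<le> r} \<subseteq> fst (p \<alpha>))"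

lemma responses_eq_ball:
  "\<alpha> \<in> Field \<kappa> \<Longrightarrow> V p \<alpha> = G_ball M d (snd (p \<alpha>)) (radius p \<alpha>)"
  by (simp add: responses_def ball_strategy_def radius_def under_iff ord_refl split: prod.split)

lemma radius:
  assumes "\<alpha> \<in> Field \<kappa>" "openin X (fst (p \<alpha>))" "snd (p \<alpha>) \<in> fst (p \<alpha>)"
  shows "0 < radius p \<alpha>" "radius p \<alpha> \<le> e \<alpha>"
    "{y \<in> M. d (snd (p \<alpha>)) y \<le> radius p \<alpha>} \<subseteq> fst (p \<alpha>)"
proof -
  obtain \<delta> where \<delta>: "0 < \<delta>" "G_ball M d (snd (p \<alpha>)) \<delta> \<subseteq> fst (p \<alpha>)"
    using assms(2,3) unfolding openin_compatible_G_metric[OF compat] by blast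
  have "\<exists>r>0. \<forall>t\<in>{\<delta>, e \<alpha>}. r < t"
    by (rule small_set_has_positive_lower_bound[OF deg small_finite]) (use \<delta>(1) e_pos[OF assms(1)] in auto)
  then obtain r where r: "0 < r" "r < \<delta>" "r < e \<alpha>" by blast
  have "{y \<in> M. d (snd (p \<alpha>)) y \<le> r} \<subseteq> G_ball M d (snd (p \<alpha>)) \<delta>"
    using r(2) by (auto simp: G_ball_def)
  then have "\<exists>r>0. r \<le> e \<alpha> \<and> {y \<in> M. d (snd (p \<alpha>)) y \<le> r} \<subseteq> fst (p \<alpha>)"
    using r \<delta>(2) less_imp_le by blast
  then have "0 < radius p \<alpha> \<and> radius p \<alpha> \<le> e \<alpha> \<and>
      {y \<in> M. d (snd (p \<alpha>)) y \<le> radius p \<alpha>} \<subseteq> fst (p \<alpha>)"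
    unfolding radius_def by (rule someI_ex)
  then show "0 < radius p \<alpha>" "radius p \<alpha> \<le> e \<alpha>"
    "{y \<in> M. d (snd (p \<alpha>)) y \<le> radius p \<alpha>} \<subseteq> fst (p \<alpha>)" by blast+
qed

lemma openin_G_ball: "x \<in> M \<Longrightarrow> openin X (G_ball M d x \<epsilon>)"
  unfolding openin_compatible_G_metric[OF compat]
  using G_ball_subset_G_ball[OF metric] by (auto simp: G_ball_def)

text \<open>Since \<open>X\<close> is \<open>\<kappa>\<close>-additive, relatively open moves are open.\<close>

lemma moves:
  assumes "\<alpha> \<in> Field \<kappa>" "\<And>\<beta>. \<beta> \<in> under \<kappa> \<alpha> \<Longrightarrow> legal p \<beta>"
  shows "openin X (stage \<kappa> X (V p) \<alpha>) \<and> openin X (fst (p \<alpha>)) \<and>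
    snd (p \<alpha>) \<in> fst (p \<alpha>) \<and> fst (p \<alpha>) \<subseteq> stage \<kappa> X (V p) \<alpha> \<and>
    openin X (V p \<alpha>)"
  using assms
proof (induction rule: ordinal_induct)
  case (less \<alpha>)
  have "openin X (V p \<beta>)" if \<beta>: "\<beta> \<in> underS \<kappa> \<alpha>" for \<beta>
  proof -
    have "legal p \<gamma>" if "\<gamma> \<in> under \<kappa> \<beta>" for \<gamma>
      using less.prems[of \<gamma>] that \<beta> ord_trans unfolding under_iff underS_iff by blast
    then show ?thesis using less.IH[OF \<beta>] by blast
  qed
  then have stage: "openin X (stage \<kappa> X (V p) \<alpha>)"
    using openin_stage[OF additive less.hyps] by blast
  have "legal p \<alpha>"
    using less.prems ord_refl[OF less.hyps] by (simp add: under_iff)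
  then have U: "openin (subtopology X (stage \<kappa> X (V p) \<alpha>)) (fst (p \<alpha>))" "snd (p \<alpha>) \<in> fst (p \<alpha>)"
    by (auto simp: legal_I_def split: prod.splits)
  have op: "openin X (fst (p \<alpha>))" "fst (p \<alpha>) \<subseteq> stage \<kappa> X (V p) \<alpha>"
    using U(1) stage by (simp_all add: openin_open_subtopology)
  have "snd (p \<alpha>) \<in> M" using op(1) U(2) openin_subset by blast
  then have "openin X (V p \<alpha>)" using responses_eq_ball[OF less.hyps] openin_G_ball by simp
  then show ?case using stage U(2) op by blast
qed

lemma strategy_legal: "strategy_legal \<kappa> X \<sigma>"
  unfolding strategy_legal_def
proof (intro allI ballI impI)
  fix p \<alpha> assume \<alpha>: "\<alpha> \<in> Field \<kappa>" and leg: "\<forall>\<beta>\<in>under \<kappa> \<alpha>. legal p \<beta>"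
  have m: "openin X (stage \<kappa> X (V p) \<alpha>)" "openin X (fst (p \<alpha>))" "snd (p \<alpha>) \<in> fst (p \<alpha>)"
    "fst (p \<alpha>) \<subseteq> stage \<kappa> X (V p) \<alpha>" "openin X (V p \<alpha>)"
    using moves[OF \<alpha>, of p] leg by blast+
  note r = radius[of \<alpha> p, OF \<alpha> m(2,3)]
  have x: "snd (p \<alpha>) \<in> M" using m(2,3) openin_subset by blast
  have "snd (p \<alpha>) \<in> V p \<alpha>"
    unfolding responses_eq_ball[OF \<alpha>] using center_in_G_ball[OF metric x r(1)] .
  moreover have "V p \<alpha> \<subseteq> fst (p \<alpha>)"
    unfolding responses_eq_ball[OF \<alpha>] using r(3) by (auto simp: G_ball_def)
  moreover have "openin (subtopology X (stage \<kappa> X (V p) \<alpha>)) (V p \<alpha>)"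
    using m calculation(2) by (auto simp: openin_open_subtopology)
  ultimately show "legal_II \<kappa> X p (V p) \<alpha>"
    by (cases "p \<alpha>") (simp add: legal_II_def)
qed

lemma run:
  assumes I: "I \<subseteq> Field \<kappa>" "\<forall>\<alpha>\<in>I. under \<kappa> \<alpha> \<subseteq> I"
    and leg: "\<forall>\<alpha>\<in>I. legal p \<alpha>"
  shows "\<And>\<alpha>. \<alpha> \<in> I \<Longrightarrow> openin X (fst (p \<alpha>)) \<and> snd (p \<alpha>) \<in> fst (p \<alpha>)"
    and "\<And>\<alpha>. \<alpha> \<in> I \<Longrightarrow> snd (p \<alpha>) \<in> M"
    and "\<And>\<alpha>. \<alpha> \<in> I \<Longrightarrow> snd (p \<alpha>) \<in> V p \<alpha>"
    and "\<And>\<alpha> \<beta>. \<beta> \<in> I \<Longrightarrow> \<alpha> \<in> underS \<kappa> \<beta> \<Longrightarrow> fst (p \<beta>) \<subseteq> V p \<alpha>"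
    and "\<And>\<alpha> \<beta>. \<beta> \<in> I \<Longrightarrow> (\<alpha>, \<beta>) \<in> \<kappa> \<Longrightarrow> V p \<beta> \<subseteq> V p \<alpha>"
proof -
  have leg': "\<forall>\<beta>\<in>under \<kappa> \<alpha>. legal p \<beta>" if "\<alpha> \<in> I" for \<alpha>
    using that I(2) leg by blast
  have m: "openin X (fst (p \<alpha>)) \<and> snd (p \<alpha>) \<in> fst (p \<alpha>) \<and> fst (p \<alpha>) \<subseteq> stage \<kappa> X (V p) \<alpha>" if "\<alpha> \<in> I" for \<alpha>
    using moves[of \<alpha> p] leg'[OF that] I(1) that by blast
  have II: "snd (p \<alpha>) \<in> V p \<alpha> \<and> V p \<alpha> \<subseteq> fst (p \<alpha>)" if "\<alpha> \<in> I" for \<alpha>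
  proof -
    have "legal_II \<kappa> X p (V p) \<alpha>"
      using strategy_legal leg'[OF that] I(1) that unfolding strategy_legal_def by blast
    then show ?thesis by (auto simp: legal_II_def split: prod.splits)
  qed
  show 1: "openin X (fst (p \<alpha>)) \<and> snd (p \<alpha>) \<in> fst (p \<alpha>)" if "\<alpha> \<in> I" for \<alpha> using m[OF that] by blast
  show "snd (p \<alpha>) \<in> M" if "\<alpha> \<in> I" for \<alpha> using 1[OF that] openin_subset by blast
  show "snd (p \<alpha>) \<in> V p \<alpha>" if "\<alpha> \<in> I" for \<alpha> using II[OF that] by blast
  show 2: "fst (p \<beta>) \<subseteq> V p \<alpha>" if "\<beta> \<in> I" "\<alpha> \<in> underS \<kappa> \<beta>" for \<alpha> \<beta>
    using m[OF that(1)] that(2) unfolding stage_def by blast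
  show "V p \<beta> \<subseteq> V p \<alpha>" if "\<beta> \<in> I" "(\<alpha>, \<beta>) \<in> \<kappa>" for \<alpha> \<beta>
    using 2[OF that(1), of \<alpha>] II[OF that(1)] that(2) by (cases "\<alpha> = \<beta>") (auto simp: underS_iff)
qed

lemma responses_meet:
  assumes "spherically_complete M d"
    and I: "I \<subseteq> Field \<kappa>" "I \<noteq> {}" "\<forall>\<alpha>\<in>I. under \<kappa> \<alpha> \<subseteq> I"
    and leg: "\<forall>\<alpha>\<in>I. legal p \<alpha>"
  shows "M \<inter> (\<Inter>\<alpha>\<in>I. V p \<alpha>) \<noteq> {}"
proof -
  note run = run[OF I(1,3) leg]
  have ball: "V p \<alpha> = G_ball M d (snd (p \<alpha>)) (radius p \<alpha>)" if "\<alpha> \<in> I" for \<alpha>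
    using responses_eq_ball I(1) that by blast
  have "\<exists>w\<in>M. \<forall>\<alpha>\<in>I. w \<in> G_ball M d (snd (p \<alpha>)) (radius p \<alpha>)"
  proof (rule decreasing_balls_meet[OF assms(1) I(1,2)])
    show "snd (p \<alpha>) \<in> M \<and> 0 < radius p \<alpha>" if "\<alpha> \<in> I" for \<alpha>
      using run(1,2)[OF that] radius(1)[of \<alpha> p] I that by blast
    show "G_ball M d (snd (p \<beta>)) (radius p \<beta>) \<subseteq> G_ball M d (snd (p \<alpha>)) (radius p \<alpha>)"
      if "\<alpha> \<in> I" "\<beta> \<in> I" "(\<alpha>, \<beta>) \<in> \<kappa>" for \<alpha> \<beta>
      using run(5)[OF that(2,3)] ball that(1,2) I by simp
  qed
  then show ?thesis using ball by blast
qed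

lemma strong_winning:
  assumes "spherically_complete M d"
  shows "strong_winning \<kappa> X \<sigma>"
  unfolding strong_winning_def
proof (intro conjI allI impI)
  show "strategy_legal \<kappa> X \<sigma>" by (rule strategy_legal)
  fix p
  show "stage \<kappa> X (V p) \<gamma> \<noteq> {}"
    if "limit_below \<kappa> \<gamma> \<and> (\<forall>\<alpha>\<in>underS \<kappa> \<gamma>. legal p \<alpha>)" for \<gamma>
    unfolding stage_def
  proof (rule responses_meet[OF assms])
    show "underS \<kappa> \<gamma> \<subseteq> Field \<kappa>" using underS_Field by blast
    show "underS \<kappa> \<gamma> \<noteq> {}" using that unfolding limit_below_def by blast
    show "\<forall>\<alpha>\<in>underS \<kappa> \<gamma>. under \<kappa> \<alpha> \<subseteq> underS \<kappa> \<gamma>"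
      using underS_trans(2) by (auto simp: under_iff)
  qed (use that in blast)
  show "final_stage \<kappa> X (V p) \<noteq> {}"
    if "\<forall>\<alpha>\<in>Field \<kappa>. legal p \<alpha>"
    unfolding final_stage_def
    by (rule responses_meet[OF assms]) (use that Field_nonempty in_Field in \<open>auto simp: under_iff\<close>)
qed

text \<open>The points played by I form a Cauchy sequence. Its limit belongs to the closed balls around
  them, hence to the sets played by I, hence to the sets played by II before.\<close>

lemma fair_winning:
  assumes complete: "Cauchy_complete \<kappa> M d"
  shows "fair_winning \<kappa> X \<sigma>"
  unfolding fair_winning_def
proof (intro conjI allI impI)
  show "strategy_legal \<kappa> X \<sigma>" by (rule strategy_legal)
  fix p assume leg: "\<forall>\<alpha>\<in>Field \<kappa>. legal p \<alpha>"
  let ?x = "\<lambda>\<alpha>. snd (p \<alpha>)"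
  have down: "\<forall>\<alpha>\<in>Field \<kappa>. under \<kappa> \<alpha> \<subseteq> Field \<kappa>" using in_Field by (auto simp: under_iff)
  note run = run[OF order_refl down leg]
  have xM: "?x \<alpha> \<in> M" if "\<alpha> \<in> Field \<kappa>" for \<alpha> using run(2) that by blast
  have rad: "0 < radius p \<alpha>" "radius p \<alpha> \<le> e \<alpha>" "{y \<in> M. d (?x \<alpha>) y \<le> radius p \<alpha>} \<subseteq> fst (p \<alpha>)"
    if "\<alpha> \<in> Field \<kappa>" for \<alpha>
    using radius[OF that, of p] run(1)[of \<alpha>] that by blast+
  have near: "d (?x \<alpha>) (?x \<beta>) < radius p \<alpha>" if "(\<alpha>, \<beta>) \<in> \<kappa>" for \<alpha> \<beta>
  proof -
    have \<beta>: "\<beta> \<in> Field \<kappa>" and \<alpha>: "\<alpha> \<in> Field \<kappa>" using in_Field that by blast+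
    have "?x \<beta> \<in> V p \<alpha>" using run(3)[of \<beta>] run(5)[of \<beta> \<alpha>] \<beta> that by blast
    then show ?thesis unfolding responses_eq_ball[OF \<alpha>] by (simp add: G_ball_def)
  qed
  have "G_Cauchy \<kappa> d ?x"
    unfolding G_Cauchy_def
  proof (intro allI impI)
    fix \<epsilon> :: 'g assume "0 < \<epsilon>"
    then obtain \<delta> where \<delta>: "0 < \<delta>" "\<delta> + \<delta> \<le> \<epsilon>" using exists_half[OF deg] by blast
    obtain \<alpha> where \<alpha>: "\<alpha> \<in> Field \<kappa>" "e \<alpha> \<le> \<delta>" using e_coinitial[OF \<delta>(1)] by blast
    have "d (?x \<beta>) (?x \<gamma>) < \<epsilon>" if *: "(\<alpha>, \<beta>) \<in> \<kappa>" "(\<alpha>, \<gamma>) \<in> \<kappa>" for \<beta> \<gamma>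
    proof -
      have M: "?x \<alpha> \<in> M" "?x \<beta> \<in> M" "?x \<gamma> \<in> M" using xM in_Field * by blast+
      have "d (?x \<beta>) (?x \<gamma>) \<le> d (?x \<beta>) (?x \<alpha>) + d (?x \<alpha>) (?x \<gamma>)"
        by (rule G_metric_triangle[OF metric M(2,1,3)])
      also have "\<dots> < \<delta> + \<delta>"
        using near[OF *(1)] near[OF *(2)] rad(2)[OF \<alpha>(1)] \<alpha>(2) G_metric_sym[OF metric M(1,2)]
        by (intro add_strict_mono) auto
      finally show ?thesis using \<delta>(2) by simp
    qed
    then show "\<exists>\<alpha>\<in>Field \<kappa>. \<forall>\<beta> \<gamma>. (\<alpha>, \<beta>) \<in> \<kappa> \<and> (\<alpha>, \<gamma>) \<in> \<kappa> \<longrightarrow> d (?x \<beta>) (?x \<gamma>) < \<epsilon>"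
      using \<alpha>(1) by blast
  qed
  then obtain l where l: "l \<in> M" "G_converges_to \<kappa> d ?x l"
    using complete[unfolded Cauchy_complete_def, rule_format, of ?x] xM by blast
  have U: "l \<in> fst (p \<alpha>)" if \<alpha>: "\<alpha> \<in> Field \<kappa>" for \<alpha>
  proof -
    have "d (?x \<alpha>) l \<le> radius p \<alpha>"
    proof (rule ccontr)
      assume "\<not> d (?x \<alpha>) l \<le> radius p \<alpha>"
      then have "0 < d (?x \<alpha>) l - radius p \<alpha>" by simp
      then obtain \<beta> where \<beta>: "\<beta> \<in> Field \<kappa>" "\<And>\<gamma>. (\<beta>, \<gamma>) \<in> \<kappa> \<Longrightarrow> d (?x \<gamma>) l < d (?x \<alpha>) l - radius p \<alpha>"
        using l(2) unfolding G_converges_to_def by blast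
      obtain \<gamma> where \<gamma>: "(\<alpha>, \<gamma>) \<in> \<kappa>" "(\<beta>, \<gamma>) \<in> \<kappa>" using ord_total[of \<alpha> \<beta>] ord_refl \<alpha> \<beta>(1) by blast
      have "d (?x \<alpha>) l \<le> d (?x \<alpha>) (?x \<gamma>) + d (?x \<gamma>) l"
        by (rule G_metric_triangle[OF metric xM[OF \<alpha>] xM[OF in_Field(2)[OF \<gamma>(1)]] l(1)])
      also have "\<dots> < radius p \<alpha> + (d (?x \<alpha>) l - radius p \<alpha>)"
        by (rule add_strict_mono[OF near[OF \<gamma>(1)] \<beta>(2)[OF \<gamma>(2)]])
      finally show False by simp
    qed
    then show ?thesis using rad(3)[OF \<alpha>] l(1) by blast
  qed
  have "l \<in> V p \<alpha>" if \<alpha>: "\<alpha> \<in> Field \<kappa>" for \<alpha>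
  proof -
    obtain \<beta> where "\<beta> \<in> Field \<kappa>" "\<alpha> \<in> underS \<kappa> \<beta>" using successor[OF \<alpha>] .
    then show ?thesis using run(4)[of \<beta> \<alpha>] U by blast
  qed
  then show "final_stage \<kappa> X (V p) \<noteq> {}" unfolding final_stage_def using l(1) by blast
qed

end

context regular_cardinal
begin

lemma sph_complete_G_Polish_imp_additive_SC_space:
  assumes deg: "has_Deg TYPE('g::linordered_ab_group_add) \<kappa>"
    and X: "sph_complete_G_Polish TYPE('g) \<kappa> X"
  shows "additive_SC_space \<kappa> X"
proof -
  obtain d :: "'a \<Rightarrow> 'a \<Rightarrow> 'g" where d: "compatible_G_metric X d" "spherically_complete (topspace X) d"
    using X unfolding sph_complete_G_Polish_def by blast
  obtain e :: "'k \<Rightarrow> 'g" where e: "\<And>\<alpha>. \<alpha> \<in> Field \<kappa> \<Longrightarrow> 0 < e \<alpha>"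
    "\<And>p. 0 < p \<Longrightarrow> \<exists>\<alpha>\<in>Field \<kappa>. e \<alpha> \<le> p"
    using coinitial_sequence[OF deg] by blast
  interpret G_metric_game \<kappa> X d e by unfold_locales (use deg d e in auto)
  show ?thesis
    using additive strong_winning[OF d(2)] X
    unfolding additive_SC_space_def SC_space_def sph_complete_G_Polish_def by blast
qed

lemma G_Polish_imp_fSC_space:
  assumes deg: "has_Deg TYPE('g::linordered_ab_group_add) \<kappa>"
    and X: "G_Polish TYPE('g) \<kappa> X"
  shows "fSC_space \<kappa> X"
proof -
  obtain d :: "'a \<Rightarrow> 'a \<Rightarrow> 'g" where d: "compatible_G_metric X d" "Cauchy_complete \<kappa> (topspace X) d"
    using X unfolding G_Polish_def by blast
  obtain e :: "'k \<Rightarrow> 'g" where e: "\<And>\<alpha>. \<alpha> \<in> Field \<kappa> \<Longrightarrow> 0 < e \<alpha>"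
    "\<And>p. 0 < p \<Longrightarrow> \<exists>\<alpha>\<in>Field \<kappa>. e \<alpha> \<le> p"
    using coinitial_sequence[OF deg] by blast
  interpret G_metric_game \<kappa> X d e by unfold_locales (use deg d e in auto)
  show ?thesis
    using fair_winning[OF d(2)] X unfolding fSC_space_def G_Polish_def by blast
qed

end


section \<open>The additive refinement of a topology\<close>

lemma responses_cong:
  "(\<And>\<beta>. \<beta> \<in> under \<kappa> \<alpha> \<Longrightarrow> p \<beta> = q \<beta>) \<Longrightarrow> responses \<kappa> \<sigma> p \<alpha> = responses \<kappa> \<sigma> q \<alpha>"
  unfolding responses_def by (metis restrict_ext)

lemma stage_cong:
  "(\<And>\<beta>. \<beta> \<in> underS \<kappa> \<alpha> \<Longrightarrow> V \<beta> = W \<beta>) \<Longrightarrow> stage \<kappa> X V \<alpha> = stage \<kappa> X W \<alpha>"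
  by (simp add: stage_def)

locale small_weight_space = regular_cardinal \<kappa> for \<kappa> :: "'k rel" +
  fixes X :: "'a topology" and \<B> :: "'a set set"
  assumes two_power: "two_power_less \<kappa> =o \<kappa>"
    and regular_X: "regular_space X" and Hausdorff_X: "Hausdorff_space X"
    and \<B>_leq: "|\<B>| \<le>o \<kappa>" and \<B>_open: "\<And>B. B \<in> \<B> \<Longrightarrow> openin X B"
    and \<B>_base: "\<And>U x. openin X U \<Longrightarrow> x \<in> U \<Longrightarrow> \<exists>B\<in>\<B>. x \<in> B \<and> B \<subseteq> U"
begin

abbreviation "M \<equiv> topspace X"

text \<open>These sets form a base of clopen sets for the topology whose basic open sets are the
  intersections of fewer than \<open>\<kappa>\<close> open sets.\<close>

definition \<C> :: "'a set set" where
  "\<C> = {M \<inter> \<Inter>S |S. S \<subseteq> \<B> \<and> |S| <o \<kappa> \<and> closedin X (M \<inter> \<Inter>S)}"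

definition \<T> :: "'a topology" where
  "\<T> = topology_generated_by \<C>"

lemma \<C>_leq: "|\<C>| \<le>o \<kappa>"
proof -
  have "\<C> \<subseteq> (\<lambda>S. M \<inter> \<Inter>S) ` {S. S \<subseteq> \<B> \<and> |S| <o \<kappa>}" unfolding \<C>_def by blast
  then show ?thesis
    by (rule leq_subset[OF _ leq_image[OF small_subsets_leq[OF two_power \<B>_leq]]])
qed

lemma \<C>_closed: "C \<in> \<C> \<Longrightarrow> closedin X C"
  unfolding \<C>_def by blast

lemma \<C>_Inter:
  assumes "\<D> \<subseteq> \<C>" "|\<D>| <o \<kappa>"
  shows "M \<inter> \<Inter>\<D> \<in> \<C>"
proof -
  have "\<forall>D\<in>\<D>. \<exists>S. S \<subseteq> \<B> \<and> |S| <o \<kappa> \<and> D = M \<inter> \<Inter>S" using assms(1) unfolding \<C>_def by blast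
  then obtain S where S: "\<And>D. D \<in> \<D> \<Longrightarrow> S D \<subseteq> \<B> \<and> |S D| <o \<kappa> \<and> D = M \<inter> \<Inter>(S D)" by metis
  have eq: "M \<inter> \<Inter>\<D> = M \<inter> \<Inter>(\<Union>D\<in>\<D>. S D)"
  proof
    show "M \<inter> \<Inter>\<D> \<subseteq> M \<inter> \<Inter>(\<Union>D\<in>\<D>. S D)" using S by blast
    show "M \<inter> \<Inter>(\<Union>D\<in>\<D>. S D) \<subseteq> M \<inter> \<Inter>\<D>"
    proof
      fix x assume x: "x \<in> M \<inter> \<Inter>(\<Union>D\<in>\<D>. S D)"
      have "x \<in> D" if "D \<in> \<D>" for D
      proof -
        have "x \<in> M \<inter> \<Inter>(S D)" using x that by blast
        then show ?thesis using S[OF that] by simp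
      qed
      then show "x \<in> M \<inter> \<Inter>\<D>" using x by blast
    qed
  qed
  have "closedin X (\<Inter>(insert M \<D>))"
    using assms(1) \<C>_closed by (intro closedin_Inter) auto
  then have "closedin X (M \<inter> \<Inter>(\<Union>D\<in>\<D>. S D))" using eq by simp
  moreover have "|\<Union>D\<in>\<D>. S D| <o \<kappa>" using small_UN[OF assms(2)] S by blast
  moreover have "(\<Union>D\<in>\<D>. S D) \<subseteq> \<B>" using S by blast
  ultimately show ?thesis
    unfolding \<C>_def eq by (intro CollectI exI[of _ "\<Union>D\<in>\<D>. S D"] conjI refl)
qed

lemma regular_base:
  assumes "openin X U" "x \<in> U"
  shows "\<exists>B\<in>\<B>. x \<in> B \<and> X closure_of B \<subseteq> U"
proof -
  obtain V K where V: "openin X V" "closedin X K" "x \<in> V" "V \<subseteq> K" "K \<subseteq> U"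
    using regular_X assms
    unfolding neighbourhood_base_of_closedin[symmetric] neighbourhood_base_of by metis
  obtain B where B: "B \<in> \<B>" "x \<in> B" "B \<subseteq> V" using \<B>_base[OF V(1,3)] by blast
  have "X closure_of B \<subseteq> K" by (rule closure_of_minimal[OF _ V(2)]) (use B V in blast)
  then show ?thesis using B V(5) by blast
qed

text \<open>Iterating regularity \<open>\<omega>\<close> times gives an intersection of countably many open sets that is also
  an intersection of closed sets. Here it matters that \<open>\<kappa>\<close> is uncountable.\<close>

lemma \<C>_base_X:
  assumes U: "openin X U" "x \<in> U"
  shows "\<exists>C\<in>\<C>. x \<in> C \<and> C \<subseteq> U"
proof -
  have "\<exists>W. \<forall>n. (W n \<in> \<B> \<and> x \<in> W n \<and> W n \<subseteq> U) \<and> X closure_of (W (Suc n)) \<subseteq> W n"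
  proof (rule dependent_nat_choice)
    show "\<exists>B. B \<in> \<B> \<and> x \<in> B \<and> B \<subseteq> U" using \<B>_base[OF U] by blast
    fix B and n :: nat assume B: "B \<in> \<B> \<and> x \<in> B \<and> B \<subseteq> U"
    then obtain B' where B': "B' \<in> \<B>" "x \<in> B'" "X closure_of B' \<subseteq> B"
      using regular_base[of B x] \<B>_open by blast
    have "B' \<subseteq> X closure_of B'" using closure_of_subset[OF openin_subset[OF \<B>_open[OF B'(1)]]] .
    then show "\<exists>B'. (B' \<in> \<B> \<and> x \<in> B' \<and> B' \<subseteq> U) \<and> X closure_of B' \<subseteq> B" using B B' by blast
  qed
  then obtain W where W: "\<And>n. W n \<in> \<B>" "\<And>n. x \<in> W n" "\<And>n. W n \<subseteq> U"
    "\<And>n. X closure_of (W (Suc n)) \<subseteq> W n" by metis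
  have sub: "W n \<subseteq> X closure_of (W n)" for n
    using closure_of_subset[OF openin_subset[OF \<B>_open[OF W(1)]]] .
  have eq: "M \<inter> \<Inter>(range W) = (\<Inter>n. X closure_of (W n))"
  proof
    show "M \<inter> \<Inter>(range W) \<subseteq> (\<Inter>n. X closure_of (W n))" using sub by blast
    show "(\<Inter>n. X closure_of (W n)) \<subseteq> M \<inter> \<Inter>(range W)"
      using W(4) closure_of_subset_topspace[of X "W 0"] by blast
  qed
  have "closedin X (M \<inter> \<Inter>(range W))" unfolding eq by (intro closedin_Inter) auto
  moreover have "range W \<subseteq> \<B>" using W(1) by blast
  ultimately have "M \<inter> \<Inter>(range W) \<in> \<C>"
    unfolding \<C>_def by (intro CollectI exI[of _ "range W"] conjI refl small_countable)
  moreover have "x \<in> M \<inter> \<Inter>(range W)" using W(2) openin_subset[OF U(1)] U(2) by blast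
  moreover have "M \<inter> \<Inter>(range W) \<subseteq> U" using W(3) by blast
  ultimately show ?thesis by blast
qed

lemma openin_\<T>: "openin \<T> U \<longleftrightarrow> (\<forall>x\<in>U. \<exists>C\<in>\<C>. x \<in> C \<and> C \<subseteq> U)"
  unfolding \<T>_def
proof (rule openin_topology_generated_by_base)
  fix A B x assume AB: "A \<in> \<C>" "B \<in> \<C>" "x \<in> A" "x \<in> B"
  have "M \<inter> \<Inter>{A, B} \<in> \<C>" by (rule \<C>_Inter[OF _ small_finite]) (use AB in auto)
  moreover have "x \<in> M" using AB(1,3) \<C>_closed closedin_subset by blast
  ultimately show "\<exists>C\<in>\<C>. x \<in> C \<and> C \<subseteq> A \<inter> B" using AB by (intro bexI[of _ "M \<inter> \<Inter>{A, B}"]) auto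
qed

lemma \<T>_finer: "openin X U \<Longrightarrow> openin \<T> U"
  unfolding openin_\<T> using \<C>_base_X by blast

lemma topspace_\<T>: "topspace \<T> = M"
proof
  show "topspace \<T> \<subseteq> M"
    unfolding \<T>_def topology_generated_by_topspace using \<C>_closed closedin_subset by blast
  show "M \<subseteq> topspace \<T>" using openin_subset[OF \<T>_finer[OF openin_topspace]] .
qed

lemma \<C>_openin_\<T>: "C \<in> \<C> \<Longrightarrow> openin \<T> C"
  unfolding openin_\<T> by blast

lemma closedin_\<T>I: "closedin X K \<Longrightarrow> closedin \<T> K"
  using \<T>_finer unfolding closedin_def topspace_\<T> by blast

lemma \<T>_additive: "kappa_additive \<kappa> \<T>"
  unfolding kappa_additive_def
proof (intro allI impI, elim conjE)
  fix \<U> assume small: "|\<U>| <o \<kappa>" and op: "\<forall>U\<in>\<U>. openin \<T> U"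
  show "openin \<T> (topspace \<T> \<inter> \<Inter>\<U>)"
    unfolding openin_\<T> topspace_\<T>
  proof
    fix x assume x: "x \<in> M \<inter> \<Inter>\<U>"
    have "\<forall>U\<in>\<U>. \<exists>C. C \<in> \<C> \<and> x \<in> C \<and> C \<subseteq> U" using op x unfolding openin_\<T> by blast
    then obtain C where C: "\<And>U. U \<in> \<U> \<Longrightarrow> C U \<in> \<C> \<and> x \<in> C U \<and> C U \<subseteq> U" by metis
    have "M \<inter> \<Inter>(C ` \<U>) \<in> \<C>" by (rule \<C>_Inter[OF _ small_image[OF small]]) (use C in blast)
    moreover have "x \<in> M \<inter> \<Inter>(C ` \<U>)" using C x by blast
    moreover have "M \<inter> \<Inter>(C ` \<U>) \<subseteq> M \<inter> \<Inter>\<U>" using C by blast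
    ultimately show "\<exists>C\<in>\<C>. x \<in> C \<and> C \<subseteq> M \<inter> \<Inter>\<U>" by blast
  qed
qed

lemma openin_\<T>_Inter:
  "|I| <o \<kappa> \<Longrightarrow> (\<And>i. i \<in> I \<Longrightarrow> openin \<T> (F i)) \<Longrightarrow> openin \<T> (M \<inter> (\<Inter>i\<in>I. F i))"
  using \<T>_additive[unfolded kappa_additive_def, rule_format, of "F ` I"] small_image[of I F]
  by (simp add: topspace_\<T>)

text \<open>An additive topology is its own additive refinement.\<close>

lemma \<T>_eq_if_additive:
  assumes "kappa_additive \<kappa> X" "openin \<T> U"
  shows "openin X U"
proof -
  have "openin X C" if "C \<in> \<C>" for C
    using that assms(1) \<B>_open unfolding \<C>_def kappa_additive_def by blast
  then have "openin X (\<Union>{C \<in> \<C>. C \<subseteq> U})" by (intro openin_Union) blast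
  moreover have "U = \<Union>{C \<in> \<C>. C \<subseteq> U}" using assms(2) unfolding openin_\<T> by blast
  ultimately show ?thesis by simp
qed

lemma openin_\<T>_imp_Borel:
  assumes "openin \<T> U"
  shows "U \<in> kappa_Borel \<kappa> X"
proof -
  have "C \<in> kappa_Borel \<kappa> X" if "C \<in> \<C>" for C
  proof -
    have "openin X (M - C)" "C \<subseteq> M" using \<C>_closed[OF that] by (auto simp: closedin_def)
    then have "M - (M - C) \<in> kappa_Borel \<kappa> X" using kappa_Borel.compl kappa_Borel.openin by blast
    then show ?thesis using double_diff[OF \<open>C \<subseteq> M\<close> order_refl] by simp
  qed
  moreover have "|{C \<in> \<C>. C \<subseteq> U}| \<le>o \<kappa>" by (rule leq_subset[OF _ \<C>_leq]) blast
  ultimately have "\<Union>{C \<in> \<C>. C \<subseteq> U} \<in> kappa_Borel \<kappa> X"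
    by (intro kappa_Borel.Union) auto
  moreover have "U = \<Union>{C \<in> \<C>. C \<subseteq> U}" using assms unfolding openin_\<T> by blast
  ultimately show ?thesis by simp
qed

text \<open>Enumerate the suitable basic clopen sets and remove from each of them its predecessors,
  of which there are fewer than \<open>\<kappa>\<close>.\<close>

lemma clopen_partition:
  assumes A: "openin \<T> A" and N: "\<And>x. x \<in> A \<Longrightarrow> openin \<T> (N x) \<and> x \<in> N x"
  obtains D where "\<And>y. y \<in> A \<Longrightarrow> y \<in> D y \<and> D y \<subseteq> A \<and> openin \<T> (D y) \<and> closedin \<T> (D y)"
    "\<And>y z. y \<in> A \<Longrightarrow> z \<in> D y \<Longrightarrow> D z = D y"
    "\<And>y. y \<in> A \<Longrightarrow> \<exists>x\<in>A. D y \<subseteq> N x"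
proof -
  define \<G> where "\<G> = {B \<in> \<C>. B \<subseteq> A \<and> (\<exists>x\<in>A. B \<subseteq> N x)}"
  have cover: "\<exists>B\<in>\<G>. y \<in> B" if y: "y \<in> A" for y
  proof -
    have "openin \<T> (N y \<inter> A)" "y \<in> N y \<inter> A" using A N[OF y] y by auto
    then obtain B where "B \<in> \<C>" "y \<in> B" "B \<subseteq> N y \<inter> A" unfolding openin_\<T> by blast
    then show ?thesis unfolding \<G>_def using y by blast
  qed
  have "|\<G>| \<le>o \<kappa>" by (rule leq_subset[OF _ \<C>_leq]) (auto simp: \<G>_def)
  then obtain e where e: "inj_on e \<G>" "e ` \<G> \<subseteq> Field \<kappa>" by (rule leq_index)
  have "\<exists>B. B \<in> \<G> \<and> y \<in> B \<and> (\<forall>B'\<in>\<G>. y \<in> B' \<longrightarrow> (e B, e B') \<in> \<kappa>)" if y: "y \<in> A" for y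
  proof -
    let ?S = "e ` {B \<in> \<G>. y \<in> B}"
    have "?S \<subseteq> Field \<kappa>" "?S \<noteq> {}" using e(2) cover[OF y] by blast+
    then obtain m where "m \<in> ?S" "\<And>s. s \<in> ?S \<Longrightarrow> (m, s) \<in> \<kappa>" using least by blast
    then show ?thesis by blast
  qed
  then obtain b where b: "\<And>y. y \<in> A \<Longrightarrow> b y \<in> \<G> \<and> y \<in> b y \<and> (\<forall>B'\<in>\<G>. y \<in> B' \<longrightarrow> (e (b y), e B') \<in> \<kappa>)"
    by metis
  define earlier where "earlier B = {B' \<in> \<G>. e B' \<in> underS \<kappa> (e B)}" for B
  define D where "D y = b y - \<Union>(earlier (b y))" for y
  have eF: "e B \<in> Field \<kappa>" if "B \<in> \<G>" for B using e(2) that by blast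
  have clopen: "openin \<T> B \<and> closedin \<T> B" if "B \<in> \<G>" for B
    using that \<C>_openin_\<T> \<C>_closed closedin_\<T>I unfolding \<G>_def by blast
  have D: "y \<in> D y \<and> D y \<subseteq> A \<and> openin \<T> (D y) \<and> closedin \<T> (D y)" if y: "y \<in> A" for y
  proof -
    have bys: "b y \<in> \<G>" "y \<in> b y" using b[OF y] by blast+
    have small: "|earlier (b y)| <o \<kappa>"
    proof -
      have "|e ` earlier (b y)| <o \<kappa>"
        by (rule small_subset[OF _ small_underS[OF eF[OF bys(1)]]]) (auto simp: earlier_def)
      moreover have "inj_on e (earlier (b y))" using e(1) by (rule inj_on_subset) (auto simp: earlier_def)
      ultimately show ?thesis
        using ordIso_ordLess_trans[OF card_of_ordIsoI[OF inj_on_imp_bij_betw]] by blast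
    qed
    have "openin \<T> (M \<inter> (\<Inter>B\<in>earlier (b y). M - B))"
      by (rule openin_\<T>_Inter[OF small]) (use clopen in \<open>auto simp: earlier_def closedin_def topspace_\<T>\<close>)
    moreover have "D y = b y \<inter> (M \<inter> (\<Inter>B\<in>earlier (b y). M - B))"
      using openin_subset[of \<T> "b y"] clopen[OF bys(1)] unfolding D_def topspace_\<T> by blast
    ultimately have op: "openin \<T> (D y)" using clopen[OF bys(1)] by (simp add: openin_Int)
    have "openin \<T> (\<Union>(earlier (b y)))" using clopen by (intro openin_Union) (auto simp: earlier_def)
    then have cl: "closedin \<T> (D y)" using clopen[OF bys(1)] unfolding D_def by (simp add: closedin_diff)
    have "y \<notin> B" if B: "B \<in> earlier (b y)" for B
    proof
      assume "y \<in> B"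
      then have "(e (b y), e B) \<in> \<kappa>" using b[OF y] B by (auto simp: earlier_def)
      then show False using not_underS B by (auto simp: earlier_def)
    qed
    then have "y \<in> D y" using bys(2) unfolding D_def by blast
    moreover have "D y \<subseteq> A" using bys(1) unfolding D_def \<G>_def by blast
    ultimately show ?thesis using op cl by blast
  qed
  have D_eq: "D z = D y" if y: "y \<in> A" and z: "z \<in> D y" for y z
  proof -
    have zA: "z \<in> A" using D[OF y] z by blast
    have zb: "z \<in> b y" using z unfolding D_def by blast
    have 1: "(e (b z), e (b y)) \<in> \<kappa>" using b[OF zA] b[OF y] zb by blast
    have "b z \<notin> earlier (b y)" using z b[OF zA] unfolding D_def by blast
    then have "e (b z) \<notin> underS \<kappa> (e (b y))" using b[OF zA] unfolding earlier_def by blast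
    then have "e (b z) = e (b y)" using 1 unfolding underS_iff by blast
    then have "b z = b y" using e(1) b[OF zA] b[OF y] by (auto dest: inj_onD)
    then show ?thesis unfolding D_def by simp
  qed
  have D_O: "\<exists>x\<in>A. D y \<subseteq> N x" if y: "y \<in> A" for y
    using b[OF y] unfolding D_def \<G>_def by blast
  show ?thesis by (rule that[OF D D_eq D_O])
qed

text \<open>Let \<open>P \<alpha> = (B, B')\<close>, where \<open>B'\<close> contains the closure of \<open>B\<close>. In round \<open>\<alpha>\<close>, I can play inside \<open>B'\<close> or
  inside the complement of the closure of \<open>B\<close>, whichever contains the point that I plays. In both
  cases the answer of II lies inside \<open>B'\<close> if it meets \<open>B\<close>. Hence if I acts like this for all pairs, then
  the answers of II shrink to every point that belongs to all of them.\<close>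

lemma separating_pairs:
  obtains P where "\<And>\<alpha>. \<alpha> \<in> Field \<kappa> \<Longrightarrow> openin X (fst (P \<alpha>)) \<and> openin X (snd (P \<alpha>)) \<and>
      X closure_of (fst (P \<alpha>)) \<subseteq> snd (P \<alpha>)"
    "\<And>U x. openin X U \<Longrightarrow> x \<in> U \<Longrightarrow> \<exists>\<alpha>\<in>Field \<kappa>. x \<in> fst (P \<alpha>) \<and> snd (P \<alpha>) \<subseteq> U"
proof -
  let ?Q = "{Q \<in> \<B> \<times> \<B>. X closure_of (fst Q) \<subseteq> snd Q}"
  let ?P = "insert ({}, M) ?Q"
  have "|?Q| \<le>o \<kappa>" by (rule leq_subset[OF _ leq_Times[OF \<B>_leq \<B>_leq]]) blast
  moreover have "|{({} :: 'a set, M)}| \<le>o \<kappa>" by (rule small_imp_leq[OF small_finite]) simp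
  ultimately have "|{({}, M)} \<union> ?Q| \<le>o \<kappa>" by (intro leq_Un)
  then have leq: "|?P| \<le>o \<kappa>" by simp
  obtain P where P: "P ` Field \<kappa> = ?P" by (rule leq_enum[OF leq insert_not_empty])
  have 1: "openin X (fst (P \<alpha>)) \<and> openin X (snd (P \<alpha>)) \<and> X closure_of (fst (P \<alpha>)) \<subseteq> snd (P \<alpha>)"
    if "\<alpha> \<in> Field \<kappa>" for \<alpha>
  proof -
    have "P \<alpha> \<in> ?P" using P that by blast
    then show ?thesis using \<B>_open by auto
  qed
  have 2: "\<exists>\<alpha>\<in>Field \<kappa>. x \<in> fst (P \<alpha>) \<and> snd (P \<alpha>) \<subseteq> U" if U: "openin X U" "x \<in> U" for U x
  proof -
    obtain B' where B': "B' \<in> \<B>" "x \<in> B'" "B' \<subseteq> U" using \<B>_base[OF U] by blast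
    obtain B where B: "B \<in> \<B>" "x \<in> B" "X closure_of B \<subseteq> B'"
      using regular_base[OF \<B>_open[OF B'(1)] B'(2)] by blast
    have "(B, B') \<in> P ` Field \<kappa>" unfolding P using B B' by simp
    then obtain \<alpha> where "\<alpha> \<in> Field \<kappa>" "P \<alpha> = (B, B')" by (auto simp: eq_commute)
    then show ?thesis using B(2) B'(3) by (intro bexI[of _ \<alpha>]) simp_all
  qed
  show ?thesis by (rule that[OF 1 2])
qed

end


section \<open>Partition trees from winning strategies\<close>

context regular_cardinal
begin

text \<open>A branch over a set of levels without a maximum extends to the downward closure of the set,
  which is either all of \<open>\<kappa>\<close> or the set of predecessors of a limit.\<close>

lemma spherically_complete_treeI:
  assumes tree: "partition_tree M C" and full: "complete_on M C (Field \<kappa>)"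
    and limit: "\<And>\<gamma>. limit_below \<kappa> \<gamma> \<Longrightarrow> complete_on M C (underS \<kappa> \<gamma>)"
  shows "spherically_complete_tree M C"
proof -
  have "\<exists>w\<in>M. \<forall>\<alpha>\<in>I. w \<in> C \<alpha> (z \<alpha>)"
    if I: "I \<subseteq> Field \<kappa>" "I \<noteq> {}" and z: "branch_on M C I z" for I z
  proof (cases "\<exists>m\<in>I. \<forall>\<alpha>\<in>I. (\<alpha>, m) \<in> \<kappa>")
    case True
    then obtain m where "m \<in> I" "\<forall>\<alpha>\<in>I. (\<alpha>, m) \<in> \<kappa>" by blast
    then show ?thesis using z unfolding branch_on_def by blast
  next
    case no_max: False
    have zM: "z \<alpha> \<in> M" if "\<alpha> \<in> I" for \<alpha> using z that unfolding branch_on_def by blast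
    have coh: "z \<beta> \<in> C \<alpha> (z \<alpha>)" if "\<alpha> \<in> I" "\<beta> \<in> I" "(\<alpha>, \<beta>) \<in> \<kappa>" for \<alpha> \<beta>
      using z that unfolding branch_on_def by blast
    define J where "J = {\<beta> \<in> Field \<kappa>. \<exists>\<alpha>\<in>I. (\<beta>, \<alpha>) \<in> \<kappa>}"
    have IJ: "I \<subseteq> J" using I(1) ord_refl unfolding J_def by blast
    have down: "\<beta> \<in> J" if "\<alpha> \<in> J" "(\<beta>, \<alpha>) \<in> \<kappa>" for \<alpha> \<beta>
      using that ord_trans in_Field(1) unfolding J_def by blast
    have "\<forall>\<beta>\<in>J. \<exists>\<alpha>. \<alpha> \<in> I \<and> (\<beta>, \<alpha>) \<in> \<kappa>" unfolding J_def by blast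
    then obtain \<iota> where \<iota>: "\<And>\<beta>. \<beta> \<in> J \<Longrightarrow> \<iota> \<beta> \<in> I \<and> (\<beta>, \<iota> \<beta>) \<in> \<kappa>" by metis
    have branch: "branch_on M C J (\<lambda>\<beta>. z (\<iota> \<beta>))"
      unfolding branch_on_def
    proof (intro conjI ballI impI)
      show "z (\<iota> \<alpha>) \<in> M" if "\<alpha> \<in> J" for \<alpha> using zM \<iota>[OF that] by blast
      fix \<alpha> \<beta> assume \<alpha>: "\<alpha> \<in> J" and \<beta>: "\<beta> \<in> J" and le: "(\<alpha>, \<beta>) \<in> \<kappa>"
      have F: "\<alpha> \<in> Field \<kappa>" using in_Field(1)[OF le] .
      have i: "\<iota> \<alpha> \<in> I" "\<iota> \<beta> \<in> I" "(\<alpha>, \<iota> \<alpha>) \<in> \<kappa>" "(\<alpha>, \<iota> \<beta>) \<in> \<kappa>"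
        using \<iota>[OF \<alpha>] \<iota>[OF \<beta>] ord_trans[OF le] by blast+
      have "(\<iota> \<alpha>, \<iota> \<beta>) \<in> \<kappa> \<or> (\<iota> \<beta>, \<iota> \<alpha>) \<in> \<kappa>" using ord_total i(1,2) I(1) by blast
      then show "z (\<iota> \<beta>) \<in> C \<alpha> (z (\<iota> \<alpha>))"
      proof
        assume "(\<iota> \<alpha>, \<iota> \<beta>) \<in> \<kappa>"
        then show ?thesis using coh[OF i(1,2)] class_mono[OF tree i(3) zM[OF i(1)]] by blast
      next
        assume "(\<iota> \<beta>, \<iota> \<alpha>) \<in> \<kappa>"
        then have "z (\<iota> \<alpha>) \<in> C \<alpha> (z (\<iota> \<beta>))"
          using coh[OF i(2,1)] class_mono[OF tree i(4) zM[OF i(2)]] by blast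
        then show ?thesis by (rule class_sym[OF tree F zM[OF i(2)]])
      qed
    qed
    have "complete_on M C J"
    proof (cases "J = Field \<kappa>")
      case True
      then show ?thesis using full by simp
    next
      case False
      then have "Field \<kappa> - J \<noteq> {}" unfolding J_def by blast
      then obtain \<gamma> where \<gamma>: "\<gamma> \<in> Field \<kappa>" "\<gamma> \<notin> J" "\<And>\<beta>. \<beta> \<in> Field \<kappa> - J \<Longrightarrow> (\<gamma>, \<beta>) \<in> \<kappa>"
        using least[of "Field \<kappa> - J"] by blast
      have J: "underS \<kappa> \<gamma> = J"
      proof
        show "underS \<kappa> \<gamma> \<subseteq> J"
          using \<gamma>(3) not_underS underS_Field by blast
        show "J \<subseteq> underS \<kappa> \<gamma>"
        proof
          fix \<beta> assume \<beta>: "\<beta> \<in> J"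
          then have "\<not> (\<gamma>, \<beta>) \<in> \<kappa>" using down \<gamma>(2) by blast
          then show "\<beta> \<in> underS \<kappa> \<gamma>" using linear[of \<gamma> \<beta>] \<gamma>(1) \<beta> unfolding J_def by blast
        qed
      qed
      have "\<exists>\<delta>\<in>J. \<beta> \<in> underS \<kappa> \<delta>" if \<beta>: "\<beta> \<in> J" for \<beta>
      proof -
        obtain \<delta> where \<delta>: "\<delta> \<in> I" "(\<delta>, \<iota> \<beta>) \<notin> \<kappa>" using no_max \<iota>[OF \<beta>] by blast
        then have "\<iota> \<beta> \<in> underS \<kappa> \<delta>" using linear[of \<delta> "\<iota> \<beta>"] linear[of "\<iota> \<beta>" \<delta>] \<iota>[OF \<beta>] I(1)
          unfolding underS_iff by blast
        then have "\<beta> \<in> underS \<kappa> \<delta>" using underS_trans(2) \<iota>[OF \<beta>] by blast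
        then show ?thesis using \<delta>(1) IJ by blast
      qed
      moreover have "J \<noteq> {}" using I(2) IJ by blast
      ultimately have "limit_below \<kappa> \<gamma>" unfolding limit_below_def J using \<gamma>(1) by blast
      then show ?thesis using limit J by metis
    qed
    then obtain w where w: "w \<in> M" "\<And>\<beta>. \<beta> \<in> J \<Longrightarrow> w \<in> C \<beta> (z (\<iota> \<beta>))"
      using branch unfolding complete_on_def by blast
    have "w \<in> C \<alpha> (z \<alpha>)" if \<alpha>: "\<alpha> \<in> I" for \<alpha>
    proof -
      have "\<iota> \<alpha> \<in> I" "(\<alpha>, \<iota> \<alpha>) \<in> \<kappa>" "\<alpha> \<in> J" using \<iota> \<alpha> IJ by blast+
      then have "C \<alpha> (z (\<iota> \<alpha>)) = C \<alpha> (z \<alpha>)"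
        using class_eq[OF tree _ zM[OF \<alpha>] coh[OF \<alpha>]] in_Field(1) by blast
      then show ?thesis using w(2)[OF \<open>\<alpha> \<in> J\<close>] by simp
    qed
    then show ?thesis using w(1) by blast
  qed
  then show ?thesis
    unfolding spherically_complete_tree_def complete_on_def using tree by blast
qed

end

locale fair_space = small_weight_space \<kappa> X \<B> for \<kappa> :: "'k rel" and X :: "'a topology" and \<B> +
  fixes \<sigma> :: "'k \<Rightarrow> ('k \<Rightarrow> 'a set \<times> 'a) \<Rightarrow> 'a set"
  assumes winning: "fair_winning \<kappa> X \<sigma>"
begin

abbreviation "V \<equiv> responses \<kappa> \<sigma>"

abbreviation "legal p \<equiv> legal_I \<kappa> X p (V p)"

lemma legal_cong:
  assumes "\<alpha> \<in> Field \<kappa>" "\<And>\<beta>. \<beta> \<in> under \<kappa> \<alpha> \<Longrightarrow> p \<beta> = q \<beta>"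
  shows "legal p \<alpha> \<longleftrightarrow> legal q \<alpha>"
proof -
  have "V p \<beta> = V q \<beta>" if "\<beta> \<in> underS \<kappa> \<alpha>" for \<beta>
    by (rule responses_cong) (use assms(2) that ord_trans in \<open>auto simp: under_iff underS_iff\<close>)
  then have "stage \<kappa> X (V p) \<alpha> = stage \<kappa> X (V q) \<alpha>" by (rule stage_cong)
  moreover have "p \<alpha> = q \<alpha>" using assms ord_refl by (simp add: under_iff)
  ultimately show ?thesis by (simp add: legal_I_def)
qed

lemma answer:
  assumes "\<alpha> \<in> Field \<kappa>" "\<forall>\<beta>\<in>under \<kappa> \<alpha>. legal p \<beta>"
  shows "openin (subtopology X (stage \<kappa> X (V p) \<alpha>)) (V p \<alpha>)" "snd (p \<alpha>) \<in> V p \<alpha>" "V p \<alpha> \<subseteq> fst (p \<alpha>)"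
proof -
  have "legal_II \<kappa> X p (V p) \<alpha>"
    using winning assms unfolding fair_winning_def strategy_legal_def by blast
  then show "openin (subtopology X (stage \<kappa> X (V p) \<alpha>)) (V p \<alpha>)" "snd (p \<alpha>) \<in> V p \<alpha>" "V p \<alpha> \<subseteq> fst (p \<alpha>)"
    by (auto simp: legal_II_def split: prod.splits)
qed

lemma openin_\<T>_answer_if_stage:
  assumes "\<alpha> \<in> Field \<kappa>" "\<forall>\<beta>\<in>under \<kappa> \<alpha>. legal p \<beta>" "openin \<T> (stage \<kappa> X (V p) \<alpha>)"
  shows "openin \<T> (V p \<alpha>)"
proof -
  obtain U where "openin X U" "V p \<alpha> = U \<inter> stage \<kappa> X (V p) \<alpha>"
    using answer(1)[OF assms(1,2)] unfolding openin_subtopology by blast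
  then show ?thesis using assms(3) \<T>_finer by (simp add: openin_Int)
qed

lemma openin_\<T>_stage:
  assumes "\<alpha> \<in> Field \<kappa>" "\<forall>\<beta>\<in>underS \<kappa> \<alpha>. legal p \<beta>"
  shows "openin \<T> (stage \<kappa> X (V p) \<alpha>)"
  using assms
proof (induction rule: ordinal_induct)
  case (less \<alpha>)
  have "openin \<T> (V p \<beta>)" if \<beta>: "\<beta> \<in> underS \<kappa> \<alpha>" for \<beta>
  proof (rule openin_\<T>_answer_if_stage[OF underS_Field[OF \<beta>]])
    have "\<gamma> \<in> underS \<kappa> \<alpha>" if "\<gamma> \<in> under \<kappa> \<beta>" for \<gamma>
      using underS_trans(2)[OF _ \<beta>] that by (simp add: under_iff)
    then show leg: "\<forall>\<gamma>\<in>under \<kappa> \<beta>. legal p \<gamma>" using less.prems by blast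
    then show "openin \<T> (stage \<kappa> X (V p) \<beta>)"
      using less.IH[OF \<beta>] by (auto simp: under_iff underS_iff)
  qed
  then show ?case
    unfolding stage_def by (intro openin_\<T>_Inter small_underS less.hyps)
qed

text \<open>A position in round \<open>\<alpha>\<close>: the moves \<open>p\<close> of I in the earlier rounds, and a set \<open>A\<close> of points
  that are still possible. The set \<open>A\<close> is split into classes \<open>D y\<close>, and each class is assigned a
  move \<open>m y\<close> of I that is answered by a superset of the class. If \<open>A\<close> is open in \<open>X\<close> itself, then I
  plays inside \<open>A\<close>, so that along a branch of limit length the answers of II and the classes have the
  same intersection.\<close>

definition position :: "'k \<Rightarrow> 'a set \<Rightarrow> ('k \<Rightarrow> 'a set \<times> 'a) \<Rightarrow> bool" where
  "position \<alpha> A p \<longleftrightarrow> (\<forall>\<beta>\<in>underS \<kappa> \<alpha>. legal p \<beta>) \<and> openin \<T> A \<and> A \<subseteq> stage \<kappa> X (V p) \<alpha>"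

definition split_class ::
    "('k \<Rightarrow> 'a set \<times> 'a set) \<Rightarrow> 'k \<Rightarrow> 'a set \<Rightarrow> ('k \<Rightarrow> 'a set \<times> 'a) \<Rightarrow>
      ('a \<Rightarrow> 'a set) \<times> ('a \<Rightarrow> 'a set \<times> 'a) \<Rightarrow> bool" where
  "split_class P \<alpha> A p Dm \<longleftrightarrow> (case Dm of (D, m) \<Rightarrow> \<forall>y\<in>A.
     y \<in> D y \<and> D y \<subseteq> A \<and> openin \<T> (D y) \<and> closedin \<T> (D y) \<and>
     (\<forall>z\<in>D y. D z = D y \<and> m z = m y) \<and>
     (let q = p(\<alpha> := m y) in
       legal q \<alpha> \<and> D y \<subseteq> V q \<alpha> \<and> (V q \<alpha> \<subseteq> snd (P \<alpha>) \<or> V q \<alpha> \<inter> fst (P \<alpha>) = {}) \<and>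
       (openin X A \<longrightarrow> V q \<alpha> \<subseteq> A)))"

text \<open>The answers of II to the moves \<open>mv x\<close> form a \<open>\<T>\<close>-open cover of \<open>A\<close>, which is refined to a
  partition. To each class is attached the move \<open>mv x\<close> for one point \<open>x\<close> whose answer contains the
  class. The point \<open>x\<close> itself may belong to another class.\<close>

lemma split_class_exists:
  assumes P: "openin X (fst (P \<alpha>)) \<and> openin X (snd (P \<alpha>)) \<and> X closure_of (fst (P \<alpha>)) \<subseteq> snd (P \<alpha>)"
    and \<alpha>: "\<alpha> \<in> Field \<kappa>" and pos: "position \<alpha> A p"
  shows "\<exists>Dm. split_class P \<alpha> A p Dm"
proof -
  let ?S = "stage \<kappa> X (V p) \<alpha>"
  define W where "W x = (if x \<in> snd (P \<alpha>) then snd (P \<alpha>) else M - X closure_of (fst (P \<alpha>)))" for x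
  define mv where "mv x = ((if openin X A then A else ?S) \<inter> W x, x)" for x
  define q where "q x = p(\<alpha> := mv x)" for x
  have AM: "A \<subseteq> M" using pos openin_subset[of \<T> A] unfolding position_def topspace_\<T> by blast
  have AS: "A \<subseteq> ?S" using pos unfolding position_def by blast
  have W_open: "openin X (W x)" for x
    using P unfolding W_def by (auto intro: openin_diff)
  have W_self: "x \<in> W x" if "x \<in> M" for x
    using P that unfolding W_def by auto
  have W_cases: "U \<subseteq> snd (P \<alpha>) \<or> U \<inter> fst (P \<alpha>) = {}" if "U \<subseteq> W x" for U x
  proof -
    have "fst (P \<alpha>) \<subseteq> X closure_of (fst (P \<alpha>))"
      using P closure_of_subset openin_subset by metis
    then show ?thesis using that unfolding W_def by (auto split: if_splits)
  qed
  have q_before: "V (q x) \<beta> = V p \<beta>" "legal (q x) \<beta> \<longleftrightarrow> legal p \<beta>" if \<beta>: "\<beta> \<in> underS \<kappa> \<alpha>" for x \<beta>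
  proof -
    have eq: "q x \<gamma> = p \<gamma>" if "\<gamma> \<in> under \<kappa> \<beta>" for \<gamma>
      using not_underS[of \<alpha> \<beta>] that \<beta> by (auto simp: q_def under_iff)
    show "V (q x) \<beta> = V p \<beta>" by (rule responses_cong) (rule eq)
    show "legal (q x) \<beta> \<longleftrightarrow> legal p \<beta>" by (rule legal_cong[OF underS_Field[OF \<beta>]]) (rule eq)
  qed
  have stage_q: "stage \<kappa> X (V (q x)) \<alpha> = ?S" for x
    by (rule stage_cong) (rule q_before(1))
  have q_at: "q x \<alpha> = mv x" for x by (simp add: q_def)
  have legal_q: "\<forall>\<beta>\<in>under \<kappa> \<alpha>. legal (q x) \<beta>" if x: "x \<in> A" for x
  proof
    fix \<beta> assume \<beta>: "\<beta> \<in> under \<kappa> \<alpha>"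
    show "legal (q x) \<beta>"
    proof (cases "\<beta> = \<alpha>")
      case True
      have "openin (subtopology X ?S) (fst (mv x))"
      proof (cases "openin X A")
        case True
        then have "openin X (A \<inter> W x)" using W_open by (rule openin_Int)
        moreover have "A \<inter> W x = (A \<inter> W x) \<inter> ?S" using AS by blast
        ultimately show ?thesis unfolding openin_subtopology mv_def using True by auto
      next
        case False
        then show ?thesis using W_open unfolding openin_subtopology mv_def by (auto simp: Int_commute)
      qed
      moreover have "x \<in> fst (mv x)" using x AS AM W_self unfolding mv_def by auto
      ultimately show ?thesis using True by (simp add: legal_I_def q_at stage_q mv_def)
    next
      case False
      then have "\<beta> \<in> underS \<kappa> \<alpha>" using \<beta> by (simp add: under_iff underS_iff)
      then show ?thesis using q_before(2) pos unfolding position_def by blast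
    qed
  qed
  define R where "R x = V (q x) \<alpha>" for x
  have R: "openin \<T> (R x) \<and> x \<in> R x" and R_sub: "R x \<subseteq> fst (mv x)" if x: "x \<in> A" for x
  proof -
    have "openin \<T> (stage \<kappa> X (V (q x)) \<alpha>)"
      using openin_\<T>_stage[OF \<alpha>] pos stage_q unfolding position_def by metis
    then show "openin \<T> (R x) \<and> x \<in> R x" "R x \<subseteq> fst (mv x)"
      using openin_\<T>_answer_if_stage[OF \<alpha> legal_q[OF x]] answer(2,3)[OF \<alpha> legal_q[OF x]]
      by (simp_all add: R_def q_at mv_def)
  qed
  have A_open: "openin \<T> A" using pos unfolding position_def by blast
  obtain D where D: "\<And>y. y \<in> A \<Longrightarrow> y \<in> D y \<and> D y \<subseteq> A \<and> openin \<T> (D y) \<and> closedin \<T> (D y)"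
    and D_eq: "\<And>y z. y \<in> A \<Longrightarrow> z \<in> D y \<Longrightarrow> D z = D y"
    and D_R: "\<And>y. y \<in> A \<Longrightarrow> \<exists>x\<in>A. D y \<subseteq> R x"
    by (rule clopen_partition[of A R, OF A_open R]) (assumption | rule that)+
  define c where "c E = (SOME x. x \<in> A \<and> E \<subseteq> R x)" for E
  have c: "c (D y) \<in> A \<and> D y \<subseteq> R (c (D y))" if "y \<in> A" for y
    unfolding c_def by (rule someI_ex) (use D_R[OF that] in blast)
  have "split_class P \<alpha> A p (D, \<lambda>y. mv (c (D y)))"
    unfolding split_class_def prod.case Let_def
  proof (intro ballI conjI impI)
    fix y assume y: "y \<in> A"
    have cA: "c (D y) \<in> A" using c[OF y] by blast
    show "y \<in> D y" "D y \<subseteq> A" "openin \<T> (D y)" "closedin \<T> (D y)" using D[OF y] by blast+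
    show "D z = D y" if "z \<in> D y" for z using D_eq[OF y that] .
    show "mv (c (D z)) = mv (c (D y))" if "z \<in> D y" for z using D_eq[OF y that] by simp
    have qc: "p(\<alpha> := mv (c (D y))) = q (c (D y))" by (simp add: q_def)
    show "legal (p(\<alpha> := mv (c (D y)))) \<alpha>"
      unfolding qc using legal_q[OF cA] ord_refl[OF \<alpha>] by (simp add: under_iff)
    show "D y \<subseteq> V (p(\<alpha> := mv (c (D y)))) \<alpha>"
      unfolding qc using c[OF y] by (simp add: R_def)
    have sub: "V (q (c (D y))) \<alpha> \<subseteq> fst (mv (c (D y)))" using R_sub[OF cA] by (simp add: R_def)
    then have "V (q (c (D y))) \<alpha> \<subseteq> W (c (D y))" by (auto simp: mv_def)
    then show "V (p(\<alpha> := mv (c (D y)))) \<alpha> \<subseteq> snd (P \<alpha>) \<or> V (p(\<alpha> := mv (c (D y)))) \<alpha> \<inter> fst (P \<alpha>) = {}"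
      unfolding qc by (rule W_cases)
    show "V (p(\<alpha> := mv (c (D y)))) \<alpha> \<subseteq> A" if "openin X A"
      unfolding qc using sub that by (auto simp: mv_def)
  qed
  then show ?thesis by blast
qed

end


locale paired_fair_space = fair_space \<kappa> X \<B> \<sigma>
  for \<kappa> :: "'k rel" and X :: "'a topology" and \<B> \<sigma> +
  fixes P :: "'k \<Rightarrow> 'a set \<times> 'a set"
  assumes P_open: "\<And>\<alpha>. \<alpha> \<in> Field \<kappa> \<Longrightarrow> openin X (fst (P \<alpha>)) \<and> openin X (snd (P \<alpha>)) \<and>
      X closure_of (fst (P \<alpha>)) \<subseteq> snd (P \<alpha>)"
    and P_base: "\<And>U x. openin X U \<Longrightarrow> x \<in> U \<Longrightarrow> \<exists>\<alpha>\<in>Field \<kappa>. x \<in> fst (P \<alpha>) \<and> snd (P \<alpha>) \<subseteq> U"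
begin

text \<open>The class of \<open>y\<close> in round \<open>\<alpha>\<close> and the move of I attached to it, by recursion on \<open>\<alpha>\<close>. The
  points of a class have the same history, so that they are split in the same way.\<close>

definition split_step :: "'a \<Rightarrow> ('k \<Rightarrow> 'a set \<times> ('a set \<times> 'a)) \<Rightarrow> 'k \<Rightarrow> 'a set \<times> ('a set \<times> 'a)" where
  "split_step y h \<alpha> =
     (let Dm = SOME Dm. split_class P \<alpha> (M \<inter> (\<Inter>\<beta>\<in>underS \<kappa> \<alpha>. fst (h \<beta>))) (snd \<circ> h) Dm
      in (fst Dm y, snd Dm y))"

definition node :: "'a \<Rightarrow> 'k \<Rightarrow> 'a set \<times> ('a set \<times> 'a)" where
  "node y = wfrec (\<kappa> - Id) (split_step y)"

definition cell :: "'k \<Rightarrow> 'a \<Rightarrow> 'a set" where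
  "cell \<alpha> y = fst (node y \<alpha>)"

definition move :: "'a \<Rightarrow> 'k \<Rightarrow> 'a set \<times> 'a" where
  "move y \<alpha> = snd (node y \<alpha>)"

definition earlier_cell :: "'k \<Rightarrow> 'a \<Rightarrow> 'a set" where
  "earlier_cell \<alpha> y = M \<inter> (\<Inter>\<beta>\<in>underS \<kappa> \<alpha>. cell \<beta> y)"

text \<open>By \<^const>\<open>cut\<close>, the moves from round \<open>\<alpha>\<close> onwards are erased, so that points with the same earlier
  nodes have equal histories.\<close>

definition history :: "'a \<Rightarrow> 'k \<Rightarrow> 'k \<Rightarrow> 'a set \<times> 'a" where
  "history y \<alpha> = snd \<circ> cut (node y) (\<kappa> - Id) \<alpha>"

definition chosen :: "'k \<Rightarrow> 'a \<Rightarrow> ('a \<Rightarrow> 'a set) \<times> ('a \<Rightarrow> 'a set \<times> 'a)" where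
  "chosen \<alpha> y = (SOME Dm. split_class P \<alpha> (earlier_cell \<alpha> y) (history y \<alpha>) Dm)"

lemma history_before: "\<beta> \<in> underS \<kappa> \<alpha> \<Longrightarrow> history y \<alpha> \<beta> = move y \<beta>"
  by (simp add: history_def move_def cut_def underS_iff)

lemma node_eq: "node y \<alpha> = (fst (chosen \<alpha> y) y, snd (chosen \<alpha> y) y)"
proof -
  have "node y \<alpha> = split_step y (cut (node y) (\<kappa> - Id) \<alpha>) \<alpha>"
    unfolding node_def by (rule wfrec[OF wf])
  moreover have "(\<Inter>\<beta>\<in>underS \<kappa> \<alpha>. fst (cut (node y) (\<kappa> - Id) \<alpha> \<beta>)) = (\<Inter>\<beta>\<in>underS \<kappa> \<alpha>. cell \<beta> y)"
    by (auto simp: cut_def underS_iff cell_def)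
  ultimately show ?thesis
    by (simp add: split_step_def chosen_def earlier_cell_def history_def Let_def)
qed

lemma cell_eq: "cell \<alpha> y = fst (chosen \<alpha> y) y" and move_eq: "move y \<alpha> = snd (chosen \<alpha> y) y"
  by (simp_all add: cell_def move_def node_eq[of y \<alpha>])

text \<open>The invariant of the recursion. That the class is part of the answer of II makes the next
  \<^const>\<open>earlier_cell\<close> part of the next stage of the game; that nodes are constant on the class
  makes I follow one and the same run at all points of a class.\<close>

definition good :: "'k \<Rightarrow> 'a \<Rightarrow> bool" where
  "good \<alpha> y \<longleftrightarrow> y \<in> cell \<alpha> y \<and> cell \<alpha> y \<subseteq> earlier_cell \<alpha> y \<and>
     openin \<T> (earlier_cell \<alpha> y) \<and> openin \<T> (cell \<alpha> y) \<and> closedin \<T> (cell \<alpha> y) \<and>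
     (\<forall>z\<in>cell \<alpha> y. node z \<alpha> = node y \<alpha>) \<and>
     legal (move y) \<alpha> \<and> cell \<alpha> y \<subseteq> V (move y) \<alpha> \<and>
     (V (move y) \<alpha> \<subseteq> snd (P \<alpha>) \<or> V (move y) \<alpha> \<inter> fst (P \<alpha>) = {}) \<and>
     (openin X (earlier_cell \<alpha> y) \<longrightarrow> V (move y) \<alpha> \<subseteq> earlier_cell \<alpha> y)"

lemma good: "\<alpha> \<in> Field \<kappa> \<Longrightarrow> y \<in> M \<Longrightarrow> good \<alpha> y"
proof (induction arbitrary: y rule: ordinal_induct)
  case (less \<alpha>)
  let ?A = "earlier_cell \<alpha> y" and ?p = "history y \<alpha>"
  have IH: "good \<beta> z" if "\<beta> \<in> underS \<kappa> \<alpha>" "z \<in> M" for \<beta> z using less.IH that by blast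
  have yA: "y \<in> ?A" unfolding earlier_cell_def using IH less.prems unfolding good_def by blast
  have A_open: "openin \<T> ?A"
    unfolding earlier_cell_def
    by (rule openin_\<T>_Inter[OF small_underS[OF less.hyps]]) (use IH less.prems in \<open>auto simp: good_def\<close>)
  have before: "V ?p \<beta> = V (move y) \<beta>" "legal ?p \<beta> \<longleftrightarrow> legal (move y) \<beta>" if \<beta>: "\<beta> \<in> underS \<kappa> \<alpha>" for \<beta>
  proof -
    have eq: "?p \<gamma> = move y \<gamma>" if "\<gamma> \<in> under \<kappa> \<beta>" for \<gamma>
      by (rule history_before) (use underS_trans(2)[OF _ \<beta>] that in \<open>simp add: under_iff\<close>)
    show "V ?p \<beta> = V (move y) \<beta>" by (rule responses_cong) (rule eq)
    show "legal ?p \<beta> \<longleftrightarrow> legal (move y) \<beta>" by (rule legal_cong[OF underS_Field[OF \<beta>]]) (rule eq)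
  qed
  have "?A \<subseteq> stage \<kappa> X (V ?p) \<alpha>"
  proof -
    have "cell \<beta> y \<subseteq> V ?p \<beta>" if "\<beta> \<in> underS \<kappa> \<alpha>" for \<beta>
      using IH[OF that less.prems] before(1)[OF that] unfolding good_def by simp
    then show ?thesis unfolding earlier_cell_def stage_def by blast
  qed
  then have pos: "position \<alpha> ?A ?p"
    unfolding position_def using A_open before(2) IH less.prems unfolding good_def by blast
  have "split_class P \<alpha> ?A ?p (chosen \<alpha> y)"
    unfolding chosen_def
    by (rule someI_ex[OF split_class_exists[where P = P, OF P_open[OF less.hyps] less.hyps pos]])
  moreover obtain D m where Dm: "chosen \<alpha> y = (D, m)" by (cases "chosen \<alpha> y")
  ultimately have "split_class P \<alpha> ?A ?p (D, m)" by simp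
  note split = bspec[OF this[unfolded split_class_def prod.case Let_def] yA]
  have cell: "cell \<alpha> y = D y" and move: "move y \<alpha> = m y" by (simp_all add: cell_eq move_eq Dm)
  have eq: "(?p(\<alpha> := m y)) \<beta> = move y \<beta>" if "\<beta> \<in> under \<kappa> \<alpha>" for \<beta>
    using history_before[of \<beta> \<alpha> y] move that by (auto simp: under_iff underS_iff)
  have V_eq: "V (?p(\<alpha> := m y)) \<alpha> = V (move y) \<alpha>" by (rule responses_cong) (rule eq)
  have legal_eq: "legal (?p(\<alpha> := m y)) \<alpha> \<longleftrightarrow> legal (move y) \<alpha>"
    by (rule legal_cong[OF less.hyps]) (rule eq)
  have node_const: "node z \<alpha> = node y \<alpha>" if z: "z \<in> D y" for z
  proof -
    have "z \<in> ?A" using split z by blast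
    then have nodes: "node z \<beta> = node y \<beta>" if "\<beta> \<in> underS \<kappa> \<alpha>" for \<beta>
      using IH[OF that less.prems] that unfolding good_def earlier_cell_def by blast
    have "cut (node z) (\<kappa> - Id) \<alpha> = cut (node y) (\<kappa> - Id) \<alpha>"
      unfolding cuts_eq using nodes by (auto simp: underS_iff)
    moreover have "earlier_cell \<alpha> z = ?A"
      unfolding earlier_cell_def cell_def using nodes by auto
    ultimately have "chosen \<alpha> z = chosen \<alpha> y" by (simp add: chosen_def history_def)
    moreover have "D z = D y" "m z = m y" using split z by blast+
    ultimately show ?thesis unfolding node_eq[of z \<alpha>] node_eq[of y \<alpha>] Dm by simp
  qed
  show ?case
    unfolding good_def cell
  proof (intro conjI ballI)
    show "openin \<T> ?A" by (rule A_open)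
    show "node z \<alpha> = node y \<alpha>" if "z \<in> D y" for z by (rule node_const[OF that])
  qed (use split in \<open>unfold V_eq legal_eq, blast+\<close>)
qed

lemma goodD:
  assumes "\<alpha> \<in> Field \<kappa>" "y \<in> M"
  shows "y \<in> cell \<alpha> y" "cell \<alpha> y \<subseteq> earlier_cell \<alpha> y" "openin \<T> (earlier_cell \<alpha> y)" "openin \<T> (cell \<alpha> y)"
    "closedin \<T> (cell \<alpha> y)" "\<And>z. z \<in> cell \<alpha> y \<Longrightarrow> node z \<alpha> = node y \<alpha>" "legal (move y) \<alpha>"
    "cell \<alpha> y \<subseteq> V (move y) \<alpha>" "V (move y) \<alpha> \<subseteq> snd (P \<alpha>) \<or> V (move y) \<alpha> \<inter> fst (P \<alpha>) = {}"
    "openin X (earlier_cell \<alpha> y) \<Longrightarrow> V (move y) \<alpha> \<subseteq> earlier_cell \<alpha> y"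
  using good[OF assms] unfolding good_def by blast+

text \<open>The answer of II in the round \<open>\<alpha>\<close> of a suitable pair \<open>P \<alpha>\<close> contains \<open>x\<close>, so that it lies in
  the given neighbourhood.\<close>

lemma cell_shrinks:
  assumes "openin X U" "x \<in> U"
  shows "\<exists>\<alpha>\<in>Field \<kappa>. cell \<alpha> x \<subseteq> U"
proof -
  obtain \<alpha> where \<alpha>: "\<alpha> \<in> Field \<kappa>" "x \<in> fst (P \<alpha>)" "snd (P \<alpha>) \<subseteq> U" using P_base[OF assms] by blast
  have x: "x \<in> M" using assms openin_subset by blast
  note g = goodD[OF \<alpha>(1) x]
  show ?thesis using g(1,8,9) \<alpha> by blast
qed

lemma partition_tree_cell: "partition_tree M cell"
  unfolding partition_tree_def
proof (intro conjI ballI allI impI)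
  fix \<alpha> x assume \<alpha>: "\<alpha> \<in> Field \<kappa>" and x: "x \<in> M"
  note g = goodD[OF \<alpha> x]
  show "x \<in> cell \<alpha> x" by (rule g(1))
  show "cell \<alpha> x \<subseteq> M" using g(2) unfolding earlier_cell_def by blast
  show "cell \<alpha> y = cell \<alpha> x" if "y \<in> cell \<alpha> x" for y using g(6)[OF that] by (simp add: cell_def)
next
  fix \<alpha> \<beta> x assume le: "(\<alpha>, \<beta>) \<in> \<kappa>" and x: "x \<in> M"
  show "cell \<beta> x \<subseteq> cell \<alpha> x"
  proof (cases "\<alpha> = \<beta>")
    case False
    then have "\<alpha> \<in> underS \<kappa> \<beta>" using le by (simp add: underS_iff)
    then show ?thesis using goodD(2)[OF in_Field(2)[OF le] x] unfolding earlier_cell_def by blast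
  qed simp
next
  fix x y assume "x \<in> M" "y \<in> M" "x \<noteq> y"
  then obtain U where "openin X U" "x \<in> U" "y \<notin> U"
    using Hausdorff_X unfolding Hausdorff_space_def disjnt_iff by metis
  then show "\<exists>\<alpha>\<in>Field \<kappa>. y \<notin> cell \<alpha> x" using cell_shrinks by blast
qed

text \<open>A branch of the tree determines a run of the game in which I follows the moves attached to
  the classes of the branch.\<close>

lemma branch_run:
  assumes I: "I \<subseteq> Field \<kappa>" "\<forall>\<alpha>\<in>I. under \<kappa> \<alpha> \<subseteq> I" and z: "branch_on M cell I z" and \<alpha>: "\<alpha> \<in> I"
  shows "V (\<lambda>\<beta>. move (z \<beta>) \<beta>) \<alpha> = V (move (z \<alpha>)) \<alpha>" "legal (\<lambda>\<beta>. move (z \<beta>) \<beta>) \<alpha>"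
proof -
  have eq: "move (z \<beta>) \<beta> = move (z \<alpha>) \<beta>" if \<beta>: "\<beta> \<in> under \<kappa> \<alpha>" for \<beta>
  proof -
    have "\<beta> \<in> I" using I(2) \<alpha> \<beta> by blast
    then have "z \<alpha> \<in> cell \<beta> (z \<beta>)" "\<beta> \<in> Field \<kappa>" "z \<beta> \<in> M"
      using z \<alpha> \<beta> I(1) unfolding branch_on_def by (auto simp: under_iff)
    then show ?thesis using goodD(6) by (simp add: move_def)
  qed
  have \<alpha>F: "\<alpha> \<in> Field \<kappa>" "z \<alpha> \<in> M" using \<alpha> I(1) z unfolding branch_on_def by blast+
  show "V (\<lambda>\<beta>. move (z \<beta>) \<beta>) \<alpha> = V (move (z \<alpha>)) \<alpha>" by (rule responses_cong) (rule eq)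
  have "legal (\<lambda>\<beta>. move (z \<beta>) \<beta>) \<alpha> \<longleftrightarrow> legal (move (z \<alpha>)) \<alpha>"
    by (rule legal_cong[OF \<alpha>F(1)]) (rule eq)
  then show "legal (\<lambda>\<beta>. move (z \<beta>) \<beta>) \<alpha>" using goodD(7)[OF \<alpha>F] by simp
qed

text \<open>The point \<open>x\<close> provided by the game belongs to all answers of II, but the classes are only
  subsets of these. However, the answers shrink to \<open>x\<close>, so that by regularity of \<open>\<kappa>\<close> every
  \<open>\<T>\<close>-neighbourhood of \<open>x\<close> meets the classes of the branch, which are \<open>\<T>\<close>-closed.\<close>

lemma complete_on_Field: "complete_on M cell (Field \<kappa>)"
  unfolding complete_on_def
proof (intro allI impI)
  fix z assume z: "branch_on M cell (Field \<kappa>) z"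
  have down: "\<forall>\<alpha>\<in>Field \<kappa>. under \<kappa> \<alpha> \<subseteq> Field \<kappa>" using in_Field by (auto simp: under_iff)
  let ?p = "\<lambda>\<beta>. move (z \<beta>) \<beta>"
  note run = branch_run[OF order_refl down z]
  have zM: "z \<alpha> \<in> M" if "\<alpha> \<in> Field \<kappa>" for \<alpha> using z that unfolding branch_on_def by blast
  have coh: "z \<beta> \<in> cell \<alpha> (z \<alpha>)" if le: "(\<alpha>, \<beta>) \<in> \<kappa>" for \<alpha> \<beta>
    using z in_Field(1)[OF le] in_Field(2)[OF le] le unfolding branch_on_def by simp
  have "\<forall>\<alpha>\<in>Field \<kappa>. legal ?p \<alpha>" using run(2) by blast
  then have "final_stage \<kappa> X (V ?p) \<noteq> {}"
    using winning unfolding fair_winning_def by blast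
  then obtain x where x: "x \<in> M" "\<And>\<alpha>. \<alpha> \<in> Field \<kappa> \<Longrightarrow> x \<in> V ?p \<alpha>" unfolding final_stage_def by blast
  have "x \<in> cell \<beta> (z \<beta>)" if \<beta>: "\<beta> \<in> Field \<kappa>" for \<beta>
  proof (rule ccontr)
    assume "x \<notin> cell \<beta> (z \<beta>)"
    moreover have "openin \<T> (M - cell \<beta> (z \<beta>))"
      using goodD(5)[OF \<beta> zM[OF \<beta>]] by (simp add: closedin_def topspace_\<T>)
    ultimately obtain C where C: "C \<in> \<C>" "x \<in> C" "C \<subseteq> M - cell \<beta> (z \<beta>)"
      using x(1) unfolding openin_\<T> by blast
    obtain S where S: "S \<subseteq> \<B>" "|S| <o \<kappa>" "C = M \<inter> \<Inter>S" using C(1) unfolding \<C>_def by blast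
    have "\<exists>\<alpha>. \<alpha> \<in> Field \<kappa> \<and> V ?p \<alpha> \<subseteq> B" if "B \<in> S" for B
    proof -
      have "openin X B" "x \<in> B" using \<B>_open S C(2) that by blast+
      then obtain \<alpha> where \<alpha>: "\<alpha> \<in> Field \<kappa>" "x \<in> fst (P \<alpha>)" "snd (P \<alpha>) \<subseteq> B" using P_base by blast
      have "V ?p \<alpha> \<subseteq> snd (P \<alpha>)"
        using goodD(9)[OF \<alpha>(1) zM[OF \<alpha>(1)]] run(1)[OF \<alpha>(1)] x(2)[OF \<alpha>(1)] \<alpha>(2) by auto
      then show ?thesis using \<alpha> by blast
    qed
    then obtain a where a: "\<And>B. B \<in> S \<Longrightarrow> a B \<in> Field \<kappa> \<and> V ?p (a B) \<subseteq> B" by metis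
    have "insert \<beta> (a ` S) \<subseteq> Field \<kappa>" using \<beta> a by blast
    moreover have "|insert \<beta> (a ` S)| <o \<kappa>"
      using small_Un[OF small_finite[of "{\<beta>}"] small_image[OF S(2), of a]] by simp
    ultimately obtain \<gamma> where \<gamma>: "\<gamma> \<in> Field \<kappa>" "insert \<beta> (a ` S) \<subseteq> underS \<kappa> \<gamma>" by (rule bounded)
    have zg: "z \<gamma> \<in> cell \<alpha> (z \<alpha>)" if "\<alpha> \<in> insert \<beta> (a ` S)" for \<alpha>
    proof -
      have "\<alpha> \<in> underS \<kappa> \<gamma>" using \<gamma>(2) that by (rule subsetD)
      then have "(\<alpha>, \<gamma>) \<in> \<kappa>" unfolding underS_iff by simp
      then show ?thesis by (rule coh)
    qed
    have "z \<gamma> \<in> B" if B: "B \<in> S" for B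
    proof -
      have aB: "a B \<in> Field \<kappa>" "V ?p (a B) \<subseteq> B" using a[OF B] by blast+
      have "z \<gamma> \<in> V (move (z (a B))) (a B)"
        using zg[of "a B"] B goodD(8)[OF aB(1) zM[OF aB(1)]] by blast
      then show ?thesis using run(1)[OF aB(1)] aB(2) by auto
    qed
    then have "z \<gamma> \<in> C" unfolding S(3) using zM[OF \<gamma>(1)] by blast
    then show False using C(3) zg[of \<beta>] by blast
  qed
  then show "\<exists>w\<in>M. \<forall>\<alpha>\<in>Field \<kappa>. w \<in> cell \<alpha> (z \<alpha>)" using x(1) by blast
qed

text \<open>In an additive space the sets \<^const>\<open>earlier_cell\<close> are open, so that I plays inside them, and a
  point that belongs to all answers belongs to all classes.\<close>

lemma spherically_complete_if_additive:
  assumes additive: "kappa_additive \<kappa> X" and strong: "strong_winning \<kappa> X \<sigma>"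
  shows "spherically_complete_tree M cell"
proof (rule spherically_complete_treeI[OF partition_tree_cell complete_on_Field])
  fix \<gamma> assume \<gamma>: "limit_below \<kappa> \<gamma>"
  have I: "underS \<kappa> \<gamma> \<subseteq> Field \<kappa>" using underS_Field by blast
  have down: "\<forall>\<alpha>\<in>underS \<kappa> \<gamma>. under \<kappa> \<alpha> \<subseteq> underS \<kappa> \<gamma>" using underS_trans(2) by (auto simp: under_iff)
  show "complete_on M cell (underS \<kappa> \<gamma>)"
    unfolding complete_on_def
  proof (intro allI impI)
    fix z assume z: "branch_on M cell (underS \<kappa> \<gamma>) z"
    let ?p = "\<lambda>\<beta>. move (z \<beta>) \<beta>"
    note run = branch_run[OF I down z]
    have "\<forall>\<alpha>\<in>underS \<kappa> \<gamma>. legal ?p \<alpha>" using run(2) by blast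
    then have "stage \<kappa> X (V ?p) \<gamma> \<noteq> {}"
      using strong \<gamma> unfolding strong_winning_def by blast
    then obtain x where x: "x \<in> M" "\<And>\<alpha>. \<alpha> \<in> underS \<kappa> \<gamma> \<Longrightarrow> x \<in> V ?p \<alpha>" unfolding stage_def by blast
    have "x \<in> cell \<beta> (z \<beta>)" if \<beta>: "\<beta> \<in> underS \<kappa> \<gamma>" for \<beta>
    proof -
      obtain \<delta> where \<delta>: "\<delta> \<in> underS \<kappa> \<gamma>" "\<beta> \<in> underS \<kappa> \<delta>" using \<gamma> \<beta> unfolding limit_below_def by blast
      have \<delta>F: "\<delta> \<in> Field \<kappa>" "z \<delta> \<in> M" and \<beta>F: "\<beta> \<in> Field \<kappa>" "z \<beta> \<in> M"
        using \<delta>(1) \<beta> underS_Field z unfolding branch_on_def by blast+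
      have "openin X (earlier_cell \<delta> (z \<delta>))"
        by (rule \<T>_eq_if_additive[OF additive goodD(3)[OF \<delta>F]])
      then have "V (move (z \<delta>)) \<delta> \<subseteq> cell \<beta> (z \<delta>)"
        using goodD(10)[OF \<delta>F] \<delta>(2) unfolding earlier_cell_def by blast
      moreover have "(\<beta>, \<delta>) \<in> \<kappa>" using \<delta>(2) by (simp add: underS_iff)
      then have "z \<delta> \<in> cell \<beta> (z \<beta>)" using z \<beta> \<delta>(1) unfolding branch_on_def by blast
      ultimately show ?thesis
        using x(2)[OF \<delta>(1)] run(1)[OF \<delta>(1)] class_eq[OF partition_tree_cell \<beta>F] by blast
    qed
    then show "\<exists>w\<in>M. \<forall>\<alpha>\<in>underS \<kappa> \<gamma>. w \<in> cell \<alpha> (z \<alpha>)" using x(1) by blast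
  qed
qed

text \<open>The classes of one level are disjoint \<open>\<T>\<close>-open sets, so that there are at most \<open>\<kappa>\<close> of them.\<close>

lemma classes_leq: "|classes M cell| \<le>o \<kappa>"
proof -
  have level: "|cell \<alpha> ` M| \<le>o \<kappa>" if \<alpha>: "\<alpha> \<in> Field \<kappa>" for \<alpha>
  proof -
    have "\<forall>E\<in>cell \<alpha> ` M. \<exists>C. C \<in> \<C> \<and> C \<noteq> {} \<and> C \<subseteq> E"
    proof
      fix E assume "E \<in> cell \<alpha> ` M"
      then obtain x where x: "x \<in> M" "E = cell \<alpha> x" by blast
      then obtain C where "C \<in> \<C>" "x \<in> C" "C \<subseteq> E"
        using goodD(1,4)[OF \<alpha> x(1)] unfolding openin_\<T> by blast
      then show "\<exists>C. C \<in> \<C> \<and> C \<noteq> {} \<and> C \<subseteq> E" by blast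
    qed
    then obtain c where c: "\<And>E. E \<in> cell \<alpha> ` M \<Longrightarrow> c E \<in> \<C> \<and> c E \<noteq> {} \<and> c E \<subseteq> E" by metis
    have "inj_on c (cell \<alpha> ` M)"
    proof (rule inj_onI)
      fix E E' assume E: "E \<in> cell \<alpha> ` M" "E' \<in> cell \<alpha> ` M" "c E = c E'"
      then obtain x y where xy: "x \<in> M" "y \<in> M" "E = cell \<alpha> x" "E' = cell \<alpha> y" by blast
      obtain w where "w \<in> c E" using c[OF E(1)] by blast
      then have "w \<in> E" "w \<in> E'" using c E by auto
      then show "E = E'" using class_common[OF partition_tree_cell \<alpha> xy(1,2)] xy(3,4) by blast
    qed
    moreover have "c ` cell \<alpha> ` M \<subseteq> \<C>" using c by blast
    ultimately show ?thesis using leq_inj \<C>_leq by metis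
  qed
  have "classes M cell = (\<Union>\<alpha>\<in>Field \<kappa>. cell \<alpha> ` M)" unfolding classes_def by blast
  then show ?thesis using leq_UN[OF Field_leq, of "\<lambda>\<alpha>. cell \<alpha> ` M"] level by simp
qed

end

context regular_cardinal
begin

lemma winning_strategy_yields_tree:
  assumes two_power: "two_power_less \<kappa> =o \<kappa>" and X: "kappa_space \<kappa> X" and winning: "fair_winning \<kappa> X \<sigma>"
  shows "\<exists>C. partition_tree (topspace X) C \<and> complete_on (topspace X) C (Field \<kappa>) \<and>
    |classes (topspace X) C| \<le>o \<kappa> \<and> classes (topspace X) C \<subseteq> kappa_Borel \<kappa> X \<and>
    (\<forall>U x. openin X U \<and> x \<in> U \<longrightarrow> (\<exists>\<alpha>\<in>Field \<kappa>. C \<alpha> x \<subseteq> U)) \<and>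
    (kappa_additive \<kappa> X \<longrightarrow> (\<forall>E\<in>classes (topspace X) C. openin X E)) \<and>
    (kappa_additive \<kappa> X \<and> strong_winning \<kappa> X \<sigma> \<longrightarrow> spherically_complete_tree (topspace X) C)"
proof -
  obtain \<B> where \<B>: "|\<B>| \<le>o \<kappa>" "\<forall>V\<in>\<B>. openin X V"
    "\<forall>U x. openin X U \<and> x \<in> U \<longrightarrow> (\<exists>V\<in>\<B>. x \<in> V \<and> V \<subseteq> U)"
    using X unfolding kappa_space_def weight_le_def by blast
  interpret fair_space \<kappa> X \<B> \<sigma>
    by unfold_locales (use X two_power \<B> winning in \<open>auto simp: kappa_space_def\<close>)
  obtain P where P: "\<And>\<alpha>. \<alpha> \<in> Field \<kappa> \<Longrightarrow> openin X (fst (P \<alpha>)) \<and> openin X (snd (P \<alpha>)) \<and>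
      X closure_of (fst (P \<alpha>)) \<subseteq> snd (P \<alpha>)"
    "\<And>U x. openin X U \<Longrightarrow> x \<in> U \<Longrightarrow> \<exists>\<alpha>\<in>Field \<kappa>. x \<in> fst (P \<alpha>) \<and> snd (P \<alpha>) \<subseteq> U"
    by (rule separating_pairs) (rule that)
  interpret paired_fair_space \<kappa> X \<B> \<sigma> P
    by unfold_locales (rule P; assumption)+
  have op: "openin \<T> E" if "E \<in> classes M cell" for E
    using that goodD(4) unfolding classes_def by blast
  show ?thesis
  proof (intro exI[of _ cell] conjI partition_tree_cell complete_on_Field classes_leq)
    show "classes M cell \<subseteq> kappa_Borel \<kappa> X" using op openin_\<T>_imp_Borel by blast
    show "\<forall>U x. openin X U \<and> x \<in> U \<longrightarrow> (\<exists>\<alpha>\<in>Field \<kappa>. cell \<alpha> x \<subseteq> U)" using cell_shrinks by blast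
    show "kappa_additive \<kappa> X \<longrightarrow> (\<forall>E\<in>classes M cell. openin X E)" using op \<T>_eq_if_additive by blast
    show "kappa_additive \<kappa> X \<and> strong_winning \<kappa> X \<sigma> \<longrightarrow> spherically_complete_tree M cell"
      using spherically_complete_if_additive by blast
  qed
qed

end


section \<open>Filling the gaps of a tree\<close>

context regular_cardinal
begin

text \<open>A decreasing sequence of classes without a common point is represented by the set of all
  classes that contain one of its members, so that cofinal sequences yield the same gap.\<close>

definition gaps :: "'a set \<Rightarrow> ('k \<Rightarrow> 'a \<Rightarrow> 'a set) \<Rightarrow> 'a set set set" where
  "gaps M C = {e. e \<subseteq> classes M C \<and> (\<forall>E\<in>e. \<forall>E'\<in>e. E \<subseteq> E' \<or> E' \<subseteq> E) \<and>
     (\<forall>E\<in>e. \<forall>E'\<in>classes M C. E \<subseteq> E' \<longrightarrow> E' \<in> e) \<and> \<Inter>e = {}}"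

text \<open>The classes that a point of the filled tree belongs to: a gap, as a new point, belongs to its
  own elements.\<close>

fun trace :: "'a set \<Rightarrow> ('k \<Rightarrow> 'a \<Rightarrow> 'a set) \<Rightarrow> 'a + 'a set set \<Rightarrow> 'a set set" where
  "trace M C (Inl x) = {E \<in> classes M C. x \<in> E}"
| "trace M C (Inr e) = e"

text \<open>Two points are in the same class at level \<open>\<alpha>\<close> if they belong to the same old class at that level.
  From the level on at which a gap ends, its new point is alone in its class.\<close>

definition filled ::
    "'a set \<Rightarrow> ('k \<Rightarrow> 'a \<Rightarrow> 'a set) \<Rightarrow> 'k \<Rightarrow> 'a + 'a set set \<Rightarrow> ('a + 'a set set) set" where
  "filled M C \<alpha> u = {v \<in> M <+> gaps M C.
     v = u \<or> (\<exists>x\<in>M. C \<alpha> x \<in> trace M C u \<and> C \<alpha> x \<in> trace M C v)}"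

context
  fixes M :: "'a set" and C :: "'k \<Rightarrow> 'a \<Rightarrow> 'a set"
  assumes tree: "partition_tree M C"
begin

abbreviation "Z \<equiv> M <+> gaps M C"
abbreviation "tr \<equiv> trace M C"

lemma class_in_classes: "\<alpha> \<in> Field \<kappa> \<Longrightarrow> x \<in> M \<Longrightarrow> C \<alpha> x \<in> classes M C"
  unfolding classes_def by blast

lemma classE:
  assumes "E \<in> classes M C"
  obtains \<alpha> x where "\<alpha> \<in> Field \<kappa>" "x \<in> M" "E = C \<alpha> x"
  using assms unfolding classes_def by blast

lemma classes_nonempty: "E \<in> classes M C \<Longrightarrow> E \<noteq> {}"
  using class_self[OF tree] unfolding classes_def by blast

lemma classes_comparable:
  assumes "E \<in> classes M C" "E' \<in> classes M C" "w \<in> E" "w \<in> E'"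
  shows "E \<subseteq> E' \<or> E' \<subseteq> E"
proof -
  obtain \<alpha> x where E: "\<alpha> \<in> Field \<kappa>" "x \<in> M" "E = C \<alpha> x" using classE[OF assms(1)] .
  obtain \<beta> y where E': "\<beta> \<in> Field \<kappa>" "y \<in> M" "E' = C \<beta> y" using classE[OF assms(2)] .
  have "(\<alpha>, \<beta>) \<in> \<kappa> \<or> (\<beta>, \<alpha>) \<in> \<kappa>" using ord_total E(1) E'(1) by blast
  then show ?thesis
    using class_comparable[OF tree _ E(2) E'(2), of \<alpha> \<beta> w] class_comparable[OF tree _ E'(2) E(2), of \<beta> \<alpha> w]
      assms(3,4) E(3) E'(3) by blast
qed

lemma trace_props:
  assumes "u \<in> Z"
  shows "tr u \<subseteq> classes M C"
    and "E \<in> tr u \<Longrightarrow> E' \<in> tr u \<Longrightarrow> E \<subseteq> E' \<or> E' \<subseteq> E"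
    and "E \<in> tr u \<Longrightarrow> E' \<in> classes M C \<Longrightarrow> E \<subseteq> E' \<Longrightarrow> E' \<in> tr u"
proof -
  have *: "tr u \<subseteq> classes M C \<and> (\<forall>E\<in>tr u. \<forall>E'\<in>tr u. E \<subseteq> E' \<or> E' \<subseteq> E) \<and>
      (\<forall>E\<in>tr u. \<forall>E'\<in>classes M C. E \<subseteq> E' \<longrightarrow> E' \<in> tr u)"
  proof (cases u)
    case (Inl x)
    then show ?thesis using classes_comparable by auto
  next
    case (Inr e)
    then have "e \<in> gaps M C" using assms by blast
    then show ?thesis
      unfolding Inr trace.simps gaps_def mem_Collect_eq by (elim conjE) (intro conjI)
  qed
  show "tr u \<subseteq> classes M C" by (rule conjunct1[OF *])
  show "E \<in> tr u \<Longrightarrow> E' \<in> tr u \<Longrightarrow> E \<subseteq> E' \<or> E' \<subseteq> E"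
    by (rule bspec[OF bspec[OF conjunct1[OF conjunct2[OF *]]]])
  show "E \<in> tr u \<Longrightarrow> E' \<in> classes M C \<Longrightarrow> E \<subseteq> E' \<Longrightarrow> E' \<in> tr u"
    by (rule mp[OF bspec[OF bspec[OF conjunct2[OF conjunct2[OF *]]]]])
qed

lemma trace_common_point:
  assumes "u \<in> Z" "E \<in> tr u" "E' \<in> tr u"
  obtains w where "w \<in> E" "w \<in> E'"
proof -
  have "E \<noteq> {}" "E' \<noteq> {}" using classes_nonempty trace_props(1)[OF assms(1)] assms(2,3) by blast+
  then show ?thesis using trace_props(2)[OF assms] that by blast
qed

lemma trace_level_unique:
  assumes "u \<in> Z" "\<alpha> \<in> Field \<kappa>" "x \<in> M" "y \<in> M" "C \<alpha> x \<in> tr u" "C \<alpha> y \<in> tr u"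
  shows "C \<alpha> x = C \<alpha> y"
proof -
  obtain w where "w \<in> C \<alpha> x" "w \<in> C \<alpha> y" by (rule trace_common_point[OF assms(1,5,6)])
  then show ?thesis by (rule class_common[OF tree assms(2-4)])
qed

lemma trace_level_decreasing:
  assumes "u \<in> Z" "(\<alpha>, \<beta>) \<in> \<kappa>" "x \<in> M" "y \<in> M" "C \<alpha> x \<in> tr u" "C \<beta> y \<in> tr u"
  shows "C \<beta> y \<subseteq> C \<alpha> x"
proof -
  obtain w where "w \<in> C \<alpha> x" "w \<in> C \<beta> y" by (rule trace_common_point[OF assms(1,5,6)])
  then show ?thesis by (rule class_comparable[OF tree assms(2-4)])
qed

lemma trace_level_down:
  assumes "u \<in> Z" "(\<alpha>, \<beta>) \<in> \<kappa>" "x \<in> M" "C \<beta> x \<in> tr u"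
  shows "C \<alpha> x \<in> tr u"
  using trace_props(3)[OF assms(1,4) class_in_classes[OF in_Field(1)[OF assms(2)] assms(3)]
    class_mono[OF tree assms(2,3)]] .

text \<open>By completeness over all levels, only the old points belong to classes at every level.\<close>

lemma full_trace_is_point:
  assumes full: "complete_on M C (Field \<kappa>)" and u: "u \<in> Z"
    and x: "\<And>\<alpha>. \<alpha> \<in> Field \<kappa> \<Longrightarrow> x \<alpha> \<in> M \<and> C \<alpha> (x \<alpha>) \<in> tr u"
  shows "\<exists>w\<in>M. u = Inl w \<and> (\<forall>\<alpha>\<in>Field \<kappa>. w \<in> C \<alpha> (x \<alpha>))"
proof -
  have "branch_on M C (Field \<kappa>) x"
    unfolding branch_on_def
  proof (intro conjI ballI impI)
    fix \<alpha> \<beta> assume \<alpha>: "\<alpha> \<in> Field \<kappa>" and \<beta>: "\<beta> \<in> Field \<kappa>" and le: "(\<alpha>, \<beta>) \<in> \<kappa>"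
    have "C \<beta> (x \<beta>) \<subseteq> C \<alpha> (x \<alpha>)" using trace_level_decreasing[OF u le] x \<alpha> \<beta> by blast
    then show "x \<beta> \<in> C \<alpha> (x \<alpha>)" using class_self[OF tree \<beta>] x[OF \<beta>] by blast
  qed (use x in blast)
  then obtain w where w: "w \<in> M" "\<forall>\<alpha>\<in>Field \<kappa>. w \<in> C \<alpha> (x \<alpha>)"
    using full unfolding complete_on_def by blast
  have w_all: "w \<in> E" if E: "E \<in> tr u" for E
  proof -
    obtain \<alpha> y where y: "\<alpha> \<in> Field \<kappa>" "y \<in> M" "E = C \<alpha> y"
      using classE trace_props(1)[OF u] E by blast
    then have "E = C \<alpha> (x \<alpha>)" using trace_level_unique[OF u y(1,2)] x[OF y(1)] E by blast
    then show ?thesis using w(2) y(1) by blast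
  qed
  have "u = Inl w"
  proof (cases u)
    case (Inl y)
    have "y = w"
    proof (rule ccontr)
      assume "y \<noteq> w"
      moreover have y: "y \<in> M" using u Inl by blast
      ultimately obtain \<alpha> where "\<alpha> \<in> Field \<kappa>" "w \<notin> C \<alpha> y" using class_separates[OF tree y w(1)] by blast
      moreover then have "C \<alpha> y \<in> tr u" using class_in_classes class_self[OF tree] y Inl by simp
      ultimately show False using w_all by blast
    qed
    then show ?thesis using Inl by simp
  next
    case (Inr e)
    then have "e \<in> gaps M C" using u by blast
    then have "\<Inter>e = {}" by (simp add: gaps_def)
    then show ?thesis using w_all Inr by auto
  qed
  then show ?thesis using w by blast
qed

text \<open>A gap ends at some level \<open>\<alpha>\<close>, and it has at most one element at each level below \<open>\<alpha>\<close>.\<close>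

lemma gap_small:
  assumes full: "complete_on M C (Field \<kappa>)" and e: "e \<in> gaps M C"
  shows "|e| <o \<kappa>"
proof -
  have u: "Inr e \<in> Z" using e by blast
  have "\<exists>\<alpha>\<in>Field \<kappa>. \<forall>x\<in>M. C \<alpha> x \<notin> e"
  proof (rule ccontr)
    assume "\<not> ?thesis"
    then have "\<forall>\<alpha>\<in>Field \<kappa>. \<exists>x. x \<in> M \<and> C \<alpha> x \<in> tr (Inr e)" by auto
    then obtain x where "\<And>\<alpha>. \<alpha> \<in> Field \<kappa> \<Longrightarrow> x \<alpha> \<in> M \<and> C \<alpha> (x \<alpha>) \<in> tr (Inr e)" by metis
    then show False using full_trace_is_point[OF full u] by blast
  qed
  then obtain \<alpha> where \<alpha>: "\<alpha> \<in> Field \<kappa>" "\<And>x. x \<in> M \<Longrightarrow> C \<alpha> x \<notin> e" by blast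
  define f where "f \<beta> = C \<beta> (SOME x. x \<in> M \<and> C \<beta> x \<in> e)" for \<beta>
  have "e \<subseteq> f ` underS \<kappa> \<alpha>"
  proof
    fix E assume E: "E \<in> e"
    then obtain \<beta> y where y: "\<beta> \<in> Field \<kappa>" "y \<in> M" "E = C \<beta> y"
      using classE trace_props(1)[OF u] by (metis subsetD trace.simps(2))
    have "(\<alpha>, \<beta>) \<notin> \<kappa>" using trace_level_down[OF u _ y(2), of \<alpha> \<beta>] \<alpha>(2)[OF y(2)] E y(3) by auto
    then have "\<beta> \<in> underS \<kappa> \<alpha>" using linear \<alpha>(1) y(1) by blast
    moreover have "E = f \<beta>"
    proof -
      have "(SOME x. x \<in> M \<and> C \<beta> x \<in> e) \<in> M \<and> C \<beta> (SOME x. x \<in> M \<and> C \<beta> x \<in> e) \<in> e"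
        by (rule someI_ex) (use E y in blast)
      then show ?thesis using trace_level_unique[OF u y(1,2)] E y(3) unfolding f_def by auto
    qed
    ultimately show "E \<in> f ` underS \<kappa> \<alpha>" by blast
  qed
  then show ?thesis using small_subset small_image[OF small_underS[OF \<alpha>(1)]] by blast
qed

lemma gaps_leq:
  assumes "two_power_less \<kappa> =o \<kappa>" "complete_on M C (Field \<kappa>)" "|classes M C| \<le>o \<kappa>"
  shows "|gaps M C| \<le>o \<kappa>"
proof (rule leq_subset[OF _ small_subsets_leq[OF assms(1,3)]])
  show "gaps M C \<subseteq> {S. S \<subseteq> classes M C \<and> |S| <o \<kappa>}"
  proof
    fix e assume e: "e \<in> gaps M C"
    have "e \<subseteq> classes M C" using e by (simp add: gaps_def)
    then show "e \<in> {S. S \<subseteq> classes M C \<and> |S| <o \<kappa>}" using gap_small[OF assms(2) e] by simp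
  qed
qed

lemma filled_eq_trace:
  assumes "u \<in> Z" "\<alpha> \<in> Field \<kappa>" "x \<in> M" "C \<alpha> x \<in> tr u"
  shows "filled M C \<alpha> u = {v \<in> Z. C \<alpha> x \<in> tr v}"
proof -
  have eq: "C \<alpha> y = C \<alpha> x" if "y \<in> M" "C \<alpha> y \<in> tr u" for y
    using trace_level_unique[OF assms(1,2) that(1) assms(3) that(2) assms(4)] .
  have "v = u \<or> (\<exists>y\<in>M. C \<alpha> y \<in> tr u \<and> C \<alpha> y \<in> tr v) \<longleftrightarrow> C \<alpha> x \<in> tr v" (is "?l \<longleftrightarrow> ?r") for v
  proof
    assume ?l
    then show ?r
    proof
      assume "\<exists>y\<in>M. C \<alpha> y \<in> tr u \<and> C \<alpha> y \<in> tr v"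
      then obtain y where y: "y \<in> M" "C \<alpha> y \<in> tr u" "C \<alpha> y \<in> tr v" by blast
      show ?r using eq[OF y(1,2)] y(3) by simp
    qed (use assms(4) in simp)
  next
    assume ?r
    then show ?l using assms(3,4) by blast
  qed
  then show ?thesis unfolding filled_def by simp
qed

lemma filled_eq_singleton:
  "u \<in> Z \<Longrightarrow> (\<And>x. x \<in> M \<Longrightarrow> C \<alpha> x \<notin> tr u) \<Longrightarrow> filled M C \<alpha> u = {u}"
  unfolding filled_def by blast

lemma trace_Inl: "\<alpha> \<in> Field \<kappa> \<Longrightarrow> x \<in> M \<Longrightarrow> C \<alpha> x \<in> tr (Inl y) \<longleftrightarrow> y \<in> C \<alpha> x"
  using class_in_classes by simp

text \<open>Two points that are never separated belong to the same classes at all levels, so both of them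
  are the old point determined by these classes.\<close>

lemma partition_tree_filled:
  assumes full: "complete_on M C (Field \<kappa>)"
  shows "partition_tree Z (filled M C)"
  unfolding partition_tree_def
proof (intro conjI ballI allI impI)
  fix \<alpha> u assume \<alpha>: "\<alpha> \<in> Field \<kappa>" and u: "u \<in> Z"
  show "u \<in> filled M C \<alpha> u" "filled M C \<alpha> u \<subseteq> Z" using u unfolding filled_def by blast+
  fix v assume v: "v \<in> filled M C \<alpha> u"
  show "filled M C \<alpha> v = filled M C \<alpha> u"
  proof (cases "\<exists>x\<in>M. C \<alpha> x \<in> tr u")
    case True
    then obtain x where x: "x \<in> M" "C \<alpha> x \<in> tr u" by blast
    then have "v \<in> Z" "C \<alpha> x \<in> tr v" using v filled_eq_trace[OF u \<alpha> x] by blast+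
    then show ?thesis using filled_eq_trace[OF u \<alpha> x] filled_eq_trace[OF _ \<alpha> x(1)] by simp
  next
    case False
    then have "v = u" using v unfolding filled_def by blast
    then show ?thesis by simp
  qed
next
  fix \<alpha> \<beta> u assume le: "(\<alpha>, \<beta>) \<in> \<kappa>" and u: "u \<in> Z"
  show "filled M C \<beta> u \<subseteq> filled M C \<alpha> u"
    unfolding filled_def using trace_level_down[OF _ le] u by blast
next
  fix u v assume uv: "u \<in> Z" "v \<in> Z" "u \<noteq> v"
  show "\<exists>\<alpha>\<in>Field \<kappa>. v \<notin> filled M C \<alpha> u"
  proof (rule ccontr)
    assume "\<not> ?thesis"
    then have "\<forall>\<alpha>\<in>Field \<kappa>. \<exists>x. x \<in> M \<and> C \<alpha> x \<in> tr u \<and> C \<alpha> x \<in> tr v"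
      using uv(3) unfolding filled_def by blast
    then obtain x where x: "\<And>\<alpha>. \<alpha> \<in> Field \<kappa> \<Longrightarrow> x \<alpha> \<in> M \<and> C \<alpha> (x \<alpha>) \<in> tr u \<and> C \<alpha> (x \<alpha>) \<in> tr v"
      by metis
    obtain w where w: "w \<in> M" "u = Inl w" "\<forall>\<alpha>\<in>Field \<kappa>. w \<in> C \<alpha> (x \<alpha>)"
      using full_trace_is_point[OF full uv(1), of x] x by blast
    obtain w' where w': "w' \<in> M" "v = Inl w'" "\<forall>\<alpha>\<in>Field \<kappa>. w' \<in> C \<alpha> (x \<alpha>)"
      using full_trace_is_point[OF full uv(2), of x] x by blast
    have "w \<noteq> w'" using uv(3) w(2) w'(2) by blast
    then obtain \<alpha> where "\<alpha> \<in> Field \<kappa>" "w' \<notin> C \<alpha> w" using class_separates[OF tree w(1) w'(1)] by blast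
    then show False using w(3) w'(3) x class_eq[OF tree, of \<alpha> "x \<alpha>" w] by blast
  qed
qed

lemma upward_closure_is_gap:
  assumes I: "I \<subseteq> Field \<kappa>" "I \<noteq> {}"
    and x: "\<And>\<alpha>. \<alpha> \<in> I \<Longrightarrow> x \<alpha> \<in> M"
    and coh: "\<And>\<alpha> \<beta>. \<alpha> \<in> I \<Longrightarrow> \<beta> \<in> I \<Longrightarrow> (\<alpha>, \<beta>) \<in> \<kappa> \<Longrightarrow> x \<beta> \<in> C \<alpha> (x \<alpha>)"
    and none: "\<not> (\<exists>w\<in>M. \<forall>\<alpha>\<in>I. w \<in> C \<alpha> (x \<alpha>))"
  shows "{E \<in> classes M C. \<exists>\<alpha>\<in>I. C \<alpha> (x \<alpha>) \<subseteq> E} \<in> gaps M C" (is "?e \<in> _")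
  unfolding gaps_def
proof (rule CollectI, intro conjI ballI impI)
  show "?e \<subseteq> classes M C" by blast
  show "E' \<in> ?e" if "E \<in> ?e" "E' \<in> classes M C" "E \<subseteq> E'" for E E' using that by blast
  have self: "x \<beta> \<in> C \<beta> (x \<beta>)" if "\<beta> \<in> I" for \<beta> using class_self[OF tree _ x[OF that]] I(1) that by blast
  show "E \<subseteq> E' \<or> E' \<subseteq> E" if E: "E \<in> ?e" "E' \<in> ?e" for E E'
  proof -
    obtain \<alpha> where \<alpha>: "\<alpha> \<in> I" "C \<alpha> (x \<alpha>) \<subseteq> E" using E(1) by blast
    obtain \<beta> where \<beta>: "\<beta> \<in> I" "C \<beta> (x \<beta>) \<subseteq> E'" using E(2) by blast
    have "(\<alpha>, \<beta>) \<in> \<kappa> \<or> (\<beta>, \<alpha>) \<in> \<kappa>" using ord_total \<alpha>(1) \<beta>(1) I(1) by blast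
    then have "\<exists>w. w \<in> E \<and> w \<in> E'"
    proof
      assume "(\<alpha>, \<beta>) \<in> \<kappa>"
      then show ?thesis using coh[OF \<alpha>(1) \<beta>(1)] self[OF \<beta>(1)] \<alpha>(2) \<beta>(2) by blast
    next
      assume "(\<beta>, \<alpha>) \<in> \<kappa>"
      then show ?thesis using coh[OF \<beta>(1) \<alpha>(1)] self[OF \<alpha>(1)] \<alpha>(2) \<beta>(2) by blast
    qed
    then show ?thesis using classes_comparable[of E E'] E by blast
  qed
  show "\<Inter>?e = {}"
  proof (rule ccontr)
    assume "\<Inter>?e \<noteq> {}"
    then obtain w where w: "w \<in> \<Inter>?e" by blast
    have "C \<alpha> (x \<alpha>) \<in> ?e" if "\<alpha> \<in> I" for \<alpha> using class_in_classes x I(1) that by blast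
    then have "w \<in> C \<alpha> (x \<alpha>)" if "\<alpha> \<in> I" for \<alpha> using w that by blast
    moreover then have "w \<in> M" using I class_subset[OF tree] x by blast
    ultimately show False using none by blast
  qed
qed

text \<open>If the branch contains a class that is not an old class, then this class consists of a single
  point, which is on the branch ever after. Otherwise the branch is given by old classes, and these
  have a common old point or form a gap.\<close>

lemma spherically_complete_tree_filled:
  assumes full: "complete_on M C (Field \<kappa>)"
  shows "spherically_complete_tree Z (filled M C)"
proof -
  have "\<exists>w\<in>Z. \<forall>\<alpha>\<in>I. w \<in> filled M C \<alpha> (z \<alpha>)"
    if I: "I \<subseteq> Field \<kappa>" "I \<noteq> {}" and z: "branch_on Z (filled M C) I z" for I z
  proof -
    have zZ: "z \<alpha> \<in> Z" if "\<alpha> \<in> I" for \<alpha> using z that unfolding branch_on_def by blast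
    have coh: "z \<beta> \<in> filled M C \<alpha> (z \<alpha>)" if "\<alpha> \<in> I" "\<beta> \<in> I" "(\<alpha>, \<beta>) \<in> \<kappa>" for \<alpha> \<beta>
      using z that unfolding branch_on_def by blast
    show ?thesis
    proof (cases "\<exists>\<alpha>\<in>I. \<forall>x\<in>M. C \<alpha> x \<notin> tr (z \<alpha>)")
      case True
      then obtain \<alpha> where \<alpha>: "\<alpha> \<in> I" "\<And>x. x \<in> M \<Longrightarrow> C \<alpha> x \<notin> tr (z \<alpha>)" by blast
      have single: "filled M C \<alpha> (z \<alpha>) = {z \<alpha>}" by (rule filled_eq_singleton[OF zZ[OF \<alpha>(1)] \<alpha>(2)])
      have point: "z \<alpha> \<in> filled M C \<beta> (z \<beta>)" if \<beta>: "\<beta> \<in> I" for \<beta>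
      proof -
        have F: "\<alpha> \<in> Field \<kappa>" "\<beta> \<in> Field \<kappa>" using I(1) \<alpha>(1) \<beta> by blast+
        have "(\<alpha>, \<beta>) \<in> \<kappa> \<or> (\<beta>, \<alpha>) \<in> \<kappa>" using ord_total[OF F] .
        then show ?thesis
        proof
          assume "(\<alpha>, \<beta>) \<in> \<kappa>"
          then have "z \<beta> = z \<alpha>" using coh[OF \<alpha>(1) \<beta>] single by blast
          then show ?thesis using class_self[OF partition_tree_filled[OF full] F(2) zZ[OF \<beta>]] by simp
        next
          assume "(\<beta>, \<alpha>) \<in> \<kappa>"
          then show ?thesis by (rule coh[OF \<beta> \<alpha>(1)])
        qed
      qed
      show ?thesis by (intro bexI[OF _ zZ[OF \<alpha>(1)]] ballI) (rule point)
    next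
      case False
      then have "\<forall>\<alpha>\<in>I. \<exists>x. x \<in> M \<and> C \<alpha> x \<in> tr (z \<alpha>)" by blast
      then obtain x where x: "\<And>\<alpha>. \<alpha> \<in> I \<Longrightarrow> x \<alpha> \<in> M \<and> C \<alpha> (x \<alpha>) \<in> tr (z \<alpha>)" by metis
      have F: "\<alpha> \<in> Field \<kappa>" if "\<alpha> \<in> I" for \<alpha> using I(1) that by blast
      have filled_z: "filled M C \<alpha> (z \<alpha>) = {v \<in> Z. C \<alpha> (x \<alpha>) \<in> tr v}" if \<alpha>: "\<alpha> \<in> I" for \<alpha>
        using filled_eq_trace[OF zZ[OF \<alpha>] F[OF \<alpha>]] x[OF \<alpha>] by blast
      have xcoh: "x \<beta> \<in> C \<alpha> (x \<alpha>)" if \<alpha>: "\<alpha> \<in> I" and \<beta>: "\<beta> \<in> I" and le: "(\<alpha>, \<beta>) \<in> \<kappa>" for \<alpha> \<beta>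
      proof -
        have "C \<alpha> (x \<alpha>) \<in> tr (z \<beta>)" using coh[OF \<alpha> \<beta> le] filled_z[OF \<alpha>] by blast
        then have "C \<beta> (x \<beta>) \<subseteq> C \<alpha> (x \<alpha>)"
          using trace_level_decreasing[OF zZ[OF \<beta>] le] x[OF \<alpha>] x[OF \<beta>] by blast
        then show ?thesis using class_self[OF tree F[OF \<beta>]] x[OF \<beta>] by blast
      qed
      have xM: "x \<alpha> \<in> M" if "\<alpha> \<in> I" for \<alpha> using x[OF that] by blast
      have "\<exists>v\<in>Z. \<forall>\<alpha>\<in>I. C \<alpha> (x \<alpha>) \<in> tr v"
      proof (cases "\<exists>w\<in>M. \<forall>\<alpha>\<in>I. w \<in> C \<alpha> (x \<alpha>)")
        case True
        then obtain w where w: "w \<in> M" "\<And>\<alpha>. \<alpha> \<in> I \<Longrightarrow> w \<in> C \<alpha> (x \<alpha>)" by blast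
        then have "\<forall>\<alpha>\<in>I. C \<alpha> (x \<alpha>) \<in> tr (Inl w)" using trace_Inl[OF F xM] by blast
        then show ?thesis using w(1) by blast
      next
        case False
        let ?e = "{E \<in> classes M C. \<exists>\<alpha>\<in>I. C \<alpha> (x \<alpha>) \<subseteq> E}"
        have e: "?e \<in> gaps M C" by (rule upward_closure_is_gap[OF I xM xcoh False])
        have "C \<alpha> (x \<alpha>) \<in> tr (Inr ?e)" if "\<alpha> \<in> I" for \<alpha>
          using class_in_classes[OF F[OF that] xM[OF that]] that by auto
        then show ?thesis using InrI[OF e, of M] by blast
      qed
      then show ?thesis using filled_z by blast
    qed
  qed
  then show ?thesis
    unfolding spherically_complete_tree_def complete_on_def
    using partition_tree_filled[OF full] by blast
qed

lemma filled_class_cases: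
  assumes "F \<in> classes Z (filled M C)"
  shows "(\<exists>E\<in>classes M C. F = {v \<in> Z. E \<in> tr v}) \<or> (\<exists>e\<in>gaps M C. F = {Inr e})"
proof -
  obtain \<alpha> u where u: "\<alpha> \<in> Field \<kappa>" "u \<in> Z" "F = filled M C \<alpha> u"
    using assms unfolding classes_def by blast
  show ?thesis
  proof (cases "\<exists>x\<in>M. C \<alpha> x \<in> tr u")
    case True
    then obtain x where x: "x \<in> M" "C \<alpha> x \<in> tr u" by blast
    then have "F = {v \<in> Z. C \<alpha> x \<in> tr v}" using filled_eq_trace[OF u(2,1) x] u(3) by simp
    then show ?thesis using class_in_classes[OF u(1) x(1)] by blast
  next
    case False
    then have F: "F = {u}" using filled_eq_singleton[OF u(2)] u(3) by blast
    show ?thesis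
    proof (cases u)
      case (Inl x)
      then have "x \<in> M" using u(2) by blast
      then show ?thesis using False class_self[OF tree u(1)] trace_Inl[OF u(1)] Inl by blast
    next
      case (Inr e)
      then show ?thesis using u(2) F by blast
    qed
  qed
qed

lemma filled_classes_leq:
  assumes "|classes M C| \<le>o \<kappa>" "|gaps M C| \<le>o \<kappa>"
  shows "|classes Z (filled M C)| \<le>o \<kappa>"
proof (rule leq_subset[OF _ leq_Un[OF leq_image[OF assms(1)] leq_image[OF assms(2)]]])
  show "classes Z (filled M C) \<subseteq>
      (\<lambda>E. {v \<in> Z. E \<in> tr v}) ` classes M C \<union> (\<lambda>e. {Inr e}) ` gaps M C"
    using filled_class_cases by blast
qed

lemma Inl_vimage_filled:
  assumes "F \<in> classes Z (filled M C)"
  shows "Inl -` F \<in> insert {} (classes M C)"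
  using filled_class_cases[OF assms]
proof
  assume "\<exists>E\<in>classes M C. F = {v \<in> Z. E \<in> tr v}"
  then obtain E where E: "E \<in> classes M C" "F = {v \<in> Z. E \<in> tr v}" by blast
  then have "E \<subseteq> M" using class_subset[OF tree] unfolding classes_def by blast
  then have "Inl -` F = E" using E by auto
  then show ?thesis using E(1) by simp
qed auto

lemma Inl_vimage_filled_Inl:
  assumes "\<alpha> \<in> Field \<kappa>" "x \<in> M"
  shows "Inl -` filled M C \<alpha> (Inl x) = C \<alpha> x"
proof -
  have "C \<alpha> x \<in> tr (Inl x)" using trace_Inl[OF assms] class_self[OF tree assms] by blast
  then have "filled M C \<alpha> (Inl x) = {v \<in> Z. C \<alpha> x \<in> tr v}"
    using filled_eq_trace[OF _ assms] assms(2) by blast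
  then show ?thesis using trace_Inl[OF assms] class_subset[OF tree assms] by auto
qed

end

lemma spherically_complete_tree_transport:
  assumes sct: "spherically_complete_tree L F" and g: "bij_betw g M L"
  shows "spherically_complete_tree M (\<lambda>\<alpha> x. {y \<in> M. g y \<in> F \<alpha> (g x)})" (is "spherically_complete_tree M ?G")
proof -
  have tree: "partition_tree L F" using sct unfolding spherically_complete_tree_def by blast
  have gL: "g x \<in> L" if "x \<in> M" for x using g that unfolding bij_betw_def by blast
  have "partition_tree M ?G"
    unfolding partition_tree_def
  proof (intro conjI ballI allI impI)
    fix \<alpha> x assume \<alpha>: "\<alpha> \<in> Field \<kappa>" and x: "x \<in> M"
    show "x \<in> ?G \<alpha> x" "?G \<alpha> x \<subseteq> M" using class_self[OF tree \<alpha> gL[OF x]] x by auto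
    show "?G \<alpha> y = ?G \<alpha> x" if "y \<in> ?G \<alpha> x" for y
      using class_eq[OF tree \<alpha> gL[OF x], of "g y"] that by simp
  next
    fix \<alpha> \<beta> x assume "(\<alpha>, \<beta>) \<in> \<kappa>" "x \<in> M"
    then show "?G \<beta> x \<subseteq> ?G \<alpha> x" using class_mono[OF tree _ gL] by blast
  next
    fix x y assume "x \<in> M" "y \<in> M" "x \<noteq> y"
    moreover then have "g x \<noteq> g y" using g unfolding bij_betw_def inj_on_def by blast
    ultimately show "\<exists>\<alpha>\<in>Field \<kappa>. y \<notin> ?G \<alpha> x" using class_separates[OF tree gL gL] by blast
  qed
  moreover have "\<exists>w\<in>M. \<forall>\<alpha>\<in>I. w \<in> ?G \<alpha> (z \<alpha>)"
    if I: "I \<subseteq> Field \<kappa>" "I \<noteq> {}" and z: "branch_on M ?G I z" for I z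
  proof -
    have "branch_on L F I (\<lambda>\<alpha>. g (z \<alpha>))" using z gL unfolding branch_on_def by blast
    then obtain v where v: "v \<in> L" "\<forall>\<alpha>\<in>I. v \<in> F \<alpha> (g (z \<alpha>))"
      using sct I unfolding spherically_complete_tree_def complete_on_def by blast
    obtain w where "w \<in> M" "g w = v" using g v(1) unfolding bij_betw_def by blast
    then show ?thesis using v(2) by blast
  qed
  ultimately show ?thesis
    unfolding spherically_complete_tree_def complete_on_def by blast
qed

end


section \<open>Comparing the Borel sets\<close>

lemma kappa_Borel_subset_topspace: "A \<in> kappa_Borel \<kappa> X \<Longrightarrow> A \<subseteq> topspace X"
  by (induction rule: kappa_Borel.induct) (auto dest: openin_subset)

lemma kappa_Borel_mono:
  assumes "topspace X = topspace Y" "\<And>U. openin X U \<Longrightarrow> U \<in> kappa_Borel \<kappa> Y"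
  shows "kappa_Borel \<kappa> X \<subseteq> kappa_Borel \<kappa> Y"
proof
  fix A assume "A \<in> kappa_Borel \<kappa> X"
  then show "A \<in> kappa_Borel \<kappa> Y"
  proof induction
    case (compl A)
    then show ?case using kappa_Borel.compl assms(1) by metis
  qed (auto intro: assms(2) kappa_Borel.Union)
qed

lemma same_kappa_Borel_imp_isomorphic:
  assumes "topspace X = topspace Y" "kappa_Borel \<kappa> X = kappa_Borel \<kappa> Y"
  shows "kappa_Borel_isomorphic \<kappa> X Y"
proof -
  have "topspace X \<inter> id -` B \<in> kappa_Borel \<kappa> X" if "B \<in> kappa_Borel \<kappa> Y" for B
    using that kappa_Borel_subset_topspace[OF that] assms by (simp add: Int_absorb1)
  then have "kappa_Borel_isomorphism \<kappa> X Y id"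
    unfolding kappa_Borel_isomorphism_def using assms by simp
  then show ?thesis unfolding kappa_Borel_isomorphic_def by blast
qed

context regular_cardinal
begin

abbreviation "Bor \<equiv> kappa_Borel \<kappa>"

lemma kappa_Borel_Un:
  assumes "A \<in> Bor X" "B \<in> Bor X"
  shows "A \<union> B \<in> Bor X"
proof -
  have "\<Union>{A, B} \<in> Bor X"
    by (rule kappa_Borel.Union[OF small_imp_leq[OF small_finite]]) (use assms in auto)
  then show ?thesis by simp
qed

lemma kappa_Borel_Diff:
  assumes "A \<in> Bor X" "B \<in> Bor X"
  shows "A - B \<in> Bor X"
proof -
  have "A - B = topspace X - ((topspace X - A) \<union> B)"
    using kappa_Borel_subset_topspace[OF assms(1)] by blast
  then show ?thesis using kappa_Borel.compl kappa_Borel_Un assms by metis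
qed

lemma kappa_Borel_if_leq:
  assumes "Hausdorff_space X" "A \<subseteq> topspace X" "|A| \<le>o \<kappa>"
  shows "A \<in> Bor X"
proof -
  have "{x} \<in> Bor X" if x: "x \<in> A" for x
  proof -
    have "closedin X {x}"
      using closedin_t1_singleton[OF Hausdorff_imp_t1_space[OF assms(1)]] x assms(2) by blast
    then have "openin X (topspace X - {x})" by (rule openin_diff[OF openin_topspace])
    then have "topspace X - (topspace X - {x}) \<in> Bor X"
      using kappa_Borel.compl kappa_Borel.openin by blast
    moreover have "topspace X - (topspace X - {x}) = {x}" using x assms(2) by blast
    ultimately show ?thesis by simp
  qed
  moreover have "|(\<lambda>x. {x}) ` A| \<le>o \<kappa>" by (rule leq_image[OF assms(3)])
  ultimately have "\<Union>((\<lambda>x. {x}) ` A) \<in> Bor X" by (intro kappa_Borel.Union) auto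
  then show ?thesis by simp
qed

lemma kappa_Borel_union_of_classes:
  assumes "|classes M C| \<le>o \<kappa>" "\<And>E. E \<in> classes M C \<Longrightarrow> E \<in> Bor X"
    and tree: "partition_tree M C" and U: "U \<subseteq> M" "\<forall>x\<in>U. \<exists>\<alpha>\<in>Field \<kappa>. C \<alpha> x \<subseteq> U"
  shows "U \<in> Bor X"
proof -
  have "|{E \<in> classes M C. E \<subseteq> U}| \<le>o \<kappa>" by (rule leq_subset[OF _ assms(1)]) blast
  then have "\<Union>{E \<in> classes M C. E \<subseteq> U} \<in> Bor X"
    using assms(2) by (intro kappa_Borel.Union) auto
  moreover have "\<Union>{E \<in> classes M C. E \<subseteq> U} = U"
  proof
    show "U \<subseteq> \<Union>{E \<in> classes M C. E \<subseteq> U}"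
    proof
      fix x assume x: "x \<in> U"
      then obtain \<alpha> where \<alpha>: "\<alpha> \<in> Field \<kappa>" "C \<alpha> x \<subseteq> U" using U(2) by blast
      have xM: "x \<in> M" using x U(1) by blast
      have "C \<alpha> x \<in> classes M C" unfolding classes_def using \<alpha>(1) xM by blast
      then show "x \<in> \<Union>{E \<in> classes M C. E \<subseteq> U}" using \<alpha>(2) class_self[OF tree \<alpha>(1) xM] by blast
    qed
  qed blast
  ultimately show ?thesis by simp
qed

text \<open>If \<open>N\<close> has size \<open>\<kappa>\<close>, then so has the disjoint union of \<open>N\<close> and \<open>G\<close>. Thus room can be made for
  \<open>G\<close> by moving the points of \<open>N\<close> only.\<close>

lemma absorbing_bijection:
  assumes "\<not> |M| \<le>o \<kappa>" "|G| \<le>o \<kappa>"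
  shows "\<exists>N g. N \<subseteq> M \<and> |N| \<le>o \<kappa> \<and> bij_betw g M (M <+> G) \<and> (\<forall>x\<in>M - N. g x = Inl x)"
proof -
  have "\<kappa> \<le>o |M|" using assms(1) ordLeq_total[OF card_of_Well_order wo] by blast
  then have "|Field \<kappa>| \<le>o |M|"
    using card_of_Field_ordIso[OF Card] ordIso_ordLeq_trans by blast
  then obtain f where f: "inj_on f (Field \<kappa>) \<and> f ` Field \<kappa> \<subseteq> M"
    by (elim exE[OF iffD2[OF card_of_ordLeq]])
  define N where "N = f ` Field \<kappa>"
  have N_leq: "|N| \<le>o \<kappa>" unfolding N_def by (rule leq_image[OF Field_leq])
  have "bij_betw f (Field \<kappa>) N" using f unfolding N_def bij_betw_def by blast
  then have iso: "|Field \<kappa>| =o |N|" by (rule card_of_ordIsoI)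
  have infinite: "infinite N" using f Field_infinite finite_imageD unfolding N_def by blast
  have "\<kappa> =o |N|"
    by (rule ordIso_transitive[OF ordIso_symmetric[OF card_of_Field_ordIso[OF Card]] iso])
  then have "|G| \<le>o |N|" by (rule ordLeq_ordIso_trans[OF assms(2)])
  then have "|N| =o |N <+> G|" by (rule ordIso_symmetric[OF card_of_Plus_infinite1[OF infinite]])
  then obtain h where h: "bij_betw h N (N <+> G)" by (elim exE[OF iffD2[OF card_of_ordIso]])
  define g where "g x = (if x \<in> N then h x else Inl x)" for x
  have "bij_betw g N (N <+> G)"
    using h by (rule bij_betw_cong[THEN iffD1, rotated]) (simp add: g_def)
  moreover have "bij_betw g (M - N) (Inl ` (M - N))"
    unfolding bij_betw_def by (auto simp: g_def inj_on_def)
  moreover have "(N <+> G) \<inter> Inl ` (M - N) = {}" by auto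
  ultimately have "bij_betw g (N \<union> (M - N)) ((N <+> G) \<union> Inl ` (M - N))" by (rule bij_betw_combine)
  moreover have "N \<subseteq> M" using f unfolding N_def by blast
  moreover then have "N \<union> (M - N) = M" "(N <+> G) \<union> Inl ` (M - N) = M <+> G" by auto
  ultimately show ?thesis using N_leq by (intro exI[of _ N] exI[of _ g]) (simp add: g_def)
qed

text \<open>Up to at most \<open>\<kappa>\<close> points, every class of the filled tree is empty or an old class, and every old
  class is a class of the filled tree. Points are \<open>\<kappa>\<close>-Borel in Hausdorff spaces, so the exceptional
  points do not matter.\<close>

lemma fSC_space_has_spherically_complete_tree:
  assumes two_power: "two_power_less \<kappa> =o \<kappa>" and X: "fSC_space \<kappa> X"
  shows "\<exists>G. spherically_complete_tree (topspace X) G \<and> |classes (topspace X) G| \<le>o \<kappa> \<and>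
    Bor (tree_topology (topspace X) G) = Bor X"
proof (cases "|topspace X| \<le>o \<kappa>")
  case small: True
  let ?M = "topspace X"
  have "partition_tree ?M (\<lambda>\<alpha> x. {x})"
    unfolding partition_tree_def using Field_nonempty by auto
  moreover have "complete_on ?M (\<lambda>\<alpha> x. {x}) I" if I: "I \<subseteq> Field \<kappa>" "I \<noteq> {}" for I
    unfolding complete_on_def
  proof (intro allI impI)
    fix z assume z: "branch_on ?M (\<lambda>\<alpha> x. {x}) I z"
    obtain \<alpha> where \<alpha>: "\<alpha> \<in> I" using I(2) by blast
    have coh: "z \<beta> = z \<alpha>" if "\<alpha> \<in> I" "\<beta> \<in> I" "(\<alpha>, \<beta>) \<in> \<kappa>" for \<alpha> \<beta>
      using z that unfolding branch_on_def by simp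
    have "z \<alpha> = z \<beta>" if \<beta>: "\<beta> \<in> I" for \<beta>
    proof -
      have "(\<alpha>, \<beta>) \<in> \<kappa> \<or> (\<beta>, \<alpha>) \<in> \<kappa>" using ord_total \<alpha> \<beta> I(1) by blast
      then show ?thesis using coh[OF \<alpha> \<beta>] coh[OF \<beta> \<alpha>] by auto
    qed
    then show "\<exists>w\<in>?M. \<forall>\<alpha>\<in>I. w \<in> {z \<alpha>}" using z \<alpha> unfolding branch_on_def by auto
  qed
  ultimately have sct: "spherically_complete_tree ?M (\<lambda>\<alpha> x. {x})"
    unfolding spherically_complete_tree_def by blast
  then have tree: "partition_tree ?M (\<lambda>\<alpha> x. {x})" unfolding spherically_complete_tree_def by blast
  have leq: "|classes ?M (\<lambda>\<alpha> x. {x})| \<le>o \<kappa>"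
    by (rule leq_subset[OF _ leq_image[OF small, of "\<lambda>x. {x}"]]) (auto simp: classes_def)
  let ?Y = "tree_topology ?M (\<lambda>\<alpha> x. {x})"
  have top: "topspace ?Y = ?M" by (rule topspace_tree_topology[OF tree])
  have "Hausdorff_space X" "Hausdorff_space ?Y"
    using X kappa_space_tree_topology[OF tree leq] unfolding fSC_space_def kappa_space_def by blast+
  then have all: "A \<in> Bor X" "A \<in> Bor ?Y" if "A \<subseteq> ?M" for A
    using kappa_Borel_if_leq[of X A] kappa_Borel_if_leq[of ?Y A] leq_subset[OF that small] that top
    by simp_all
  have "Bor ?Y = Bor X"
  proof
    show "Bor ?Y \<subseteq> Bor X"
      using kappa_Borel_subset_topspace[of _ \<kappa> ?Y] all(1) unfolding top by blast
    show "Bor X \<subseteq> Bor ?Y"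
      using kappa_Borel_subset_topspace[of _ \<kappa> X] all(2) by blast
  qed
  then show ?thesis using sct leq by blast
next
  case large: False
  let ?M = "topspace X"
  obtain \<sigma> where winning: "fair_winning \<kappa> X \<sigma>" and space: "kappa_space \<kappa> X"
    using X unfolding fSC_space_def by blast
  obtain C where tree: "partition_tree ?M C" and full: "complete_on ?M C (Field \<kappa>)"
    and leq: "|classes ?M C| \<le>o \<kappa>" and Borel: "classes ?M C \<subseteq> Bor X"
    and finer: "\<forall>U x. openin X U \<and> x \<in> U \<longrightarrow> (\<exists>\<alpha>\<in>Field \<kappa>. C \<alpha> x \<subseteq> U)"
    using winning_strategy_yields_tree[OF two_power space winning] by (elim exE conjE) (rule that)
  have gaps_leq: "|gaps ?M C| \<le>o \<kappa>" by (rule gaps_leq[OF tree two_power full leq])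
  let ?Z = "?M <+> gaps ?M C" and ?F = "filled ?M C"
  obtain N g where N: "N \<subseteq> ?M" "|N| \<le>o \<kappa>" and g: "bij_betw g ?M ?Z"
    and g_Inl: "\<forall>x\<in>?M - N. g x = Inl x"
    using absorbing_bijection[OF large gaps_leq] by blast
  have gZ: "g x \<in> ?Z" if "x \<in> ?M" for x using g that unfolding bij_betw_def by blast
  define G where "G \<alpha> x = {y \<in> ?M. g y \<in> ?F \<alpha> (g x)}" for \<alpha> x
  have sct: "spherically_complete_tree ?M G"
    using spherically_complete_tree_transport[OF spherically_complete_tree_filled[OF tree full] g]
    unfolding G_def .
  then have treeG: "partition_tree ?M G" unfolding spherically_complete_tree_def by blast
  have filled_class: "?F \<alpha> (g x) \<in> classes ?Z ?F" if "\<alpha> \<in> Field \<kappa>" "x \<in> ?M" for \<alpha> x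
    unfolding classes_def using that gZ by blast
  have "classes ?M G \<subseteq> (\<lambda>F. {y \<in> ?M. g y \<in> F}) ` classes ?Z ?F"
    using filled_class unfolding classes_def[of ?M G] G_def by blast
  then have leqG: "|classes ?M G| \<le>o \<kappa>"
    by (rule leq_subset[OF _ leq_image[OF filled_classes_leq[OF tree leq gaps_leq]]])
  let ?Y = "tree_topology ?M G"
  have top: "topspace ?Y = ?M" by (rule topspace_tree_topology[OF treeG])
  have Hausdorff: "Hausdorff_space X" "Hausdorff_space ?Y"
    using space kappa_space_tree_topology[OF treeG leqG] unfolding kappa_space_def by blast+
  have few: "A \<in> Bor X" "A \<in> Bor ?Y" if "A \<subseteq> N" for A
    using kappa_Borel_if_leq[OF Hausdorff(1), of A] kappa_Borel_if_leq[OF Hausdorff(2), of A]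
      leq_subset[OF that N(2)] that N(1) top by auto
  \<comment> \<open>Changing a set within \<open>N\<close> does not affect whether it is Borel.\<close>
  have modify: "A \<in> Bor T"
    if T: "T = X \<or> T = ?Y" and B: "B \<in> Bor T" "A - N = B - N" for A B T
  proof -
    have "A \<inter> N \<in> Bor T" "N \<in> Bor T" using few[of "A \<inter> N"] few[of N] T by auto
    then have "(B - N) \<union> (A \<inter> N) \<in> Bor T" using kappa_Borel_Un kappa_Borel_Diff B(1) by blast
    moreover have "(B - N) \<union> (A \<inter> N) = A" using B(2) by blast
    ultimately show ?thesis by simp
  qed
  have G_vimage: "G \<alpha> x - N = (Inl -` ?F \<alpha> (g x)) \<inter> ?M - N" for \<alpha> x
    using g_Inl unfolding G_def by auto
  have "E \<in> Bor X" if E: "E \<in> classes ?M G" for E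
  proof -
    obtain \<alpha> x where x: "\<alpha> \<in> Field \<kappa>" "x \<in> ?M" "E = G \<alpha> x" using E unfolding classes_def by blast
    let ?B = "Inl -` ?F \<alpha> (g x)"
    have "?B \<in> insert {} (classes ?M C)" by (rule Inl_vimage_filled[OF tree filled_class[OF x(1,2)]])
    then have B: "?B \<in> Bor X" using Borel kappa_Borel.openin[OF openin_empty, of \<kappa> X] by auto
    then have "E - N = ?B - N" using kappa_Borel_subset_topspace G_vimage x(3) by blast
    then show ?thesis using modify B by blast
  qed
  then have YX: "Bor ?Y \<subseteq> Bor X"
    using kappa_Borel_union_of_classes[OF leqG _ treeG] openin_tree_topology[OF treeG]
    by (intro kappa_Borel_mono top) blast
  have "E \<in> Bor ?Y" if E: "E \<in> classes ?M C" for E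
  proof -
    obtain \<alpha> x where x: "\<alpha> \<in> Field \<kappa>" "x \<in> ?M" "E = C \<alpha> x" using E unfolding classes_def by blast
    have "Inl x \<in> g ` ?M" using g x(2) unfolding bij_betw_def by blast
    then obtain x' where x': "x' \<in> ?M" "g x' = Inl x" by force
    have "E \<subseteq> ?M" using class_subset[OF tree x(1,2)] x(3) by simp
    then have "E - N = G \<alpha> x' - N"
      unfolding G_vimage x'(2) Inl_vimage_filled_Inl[OF tree x(1,2)] x(3) by blast
    then show ?thesis
      using modify[of ?Y "G \<alpha> x'" E] kappa_Borel.openin[OF openin_class[OF treeG x(1) x'(1)]] by blast
  qed
  moreover have "U \<subseteq> ?M \<and> (\<forall>x\<in>U. \<exists>\<alpha>\<in>Field \<kappa>. C \<alpha> x \<subseteq> U)" if "openin X U" for U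
    using that finer openin_subset by blast
  ultimately have "Bor X \<subseteq> Bor ?Y"
    using kappa_Borel_union_of_classes[OF leq _ tree]
    by (intro kappa_Borel_mono) (simp_all add: top)
  then show ?thesis using sct leqG YX by blast
qed

lemma strong_winning_imp_fair_winning: "strong_winning \<kappa> X \<sigma> \<Longrightarrow> fair_winning \<kappa> X \<sigma>"
  unfolding strong_winning_def fair_winning_def by simp

lemma additive_SC_space_imp_sph_complete_G_Polish:
  assumes two_power: "two_power_less \<kappa> =o \<kappa>"
    and deg: "has_Deg TYPE('g::linordered_ab_group_add) \<kappa>" and X: "additive_SC_space \<kappa> X"
  shows "sph_complete_G_Polish TYPE('g) \<kappa> X"
proof -
  let ?M = "topspace X"
  obtain \<sigma> where additive: "kappa_additive \<kappa> X" and space: "kappa_space \<kappa> X"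
    and strong: "strong_winning \<kappa> X \<sigma>"
    using X unfolding additive_SC_space_def SC_space_def by blast
  obtain C where finer: "\<forall>U x. openin X U \<and> x \<in> U \<longrightarrow> (\<exists>\<alpha>\<in>Field \<kappa>. C \<alpha> x \<subseteq> U)"
    and "kappa_additive \<kappa> X \<longrightarrow> (\<forall>E\<in>classes ?M C. openin X E)"
    and "kappa_additive \<kappa> X \<and> strong_winning \<kappa> X \<sigma> \<longrightarrow> spherically_complete_tree ?M C"
    using winning_strategy_yields_tree[OF two_power space strong_winning_imp_fair_winning[OF strong]]
    by (elim exE conjE) (rule that)
  then have op: "\<forall>E\<in>classes ?M C. openin X E" and sct: "spherically_complete_tree ?M C"
    using additive strong by simp_all
  have tree: "partition_tree ?M C" using sct unfolding spherically_complete_tree_def by blast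
  have "openin X U \<longleftrightarrow> U \<subseteq> ?M \<and> (\<forall>x\<in>U. \<exists>\<alpha>\<in>Field \<kappa>. C \<alpha> x \<subseteq> U)" for U
  proof
    assume "openin X U"
    then show "U \<subseteq> ?M \<and> (\<forall>x\<in>U. \<exists>\<alpha>\<in>Field \<kappa>. C \<alpha> x \<subseteq> U)" using finer openin_subset by blast
  next
    assume U: "U \<subseteq> ?M \<and> (\<forall>x\<in>U. \<exists>\<alpha>\<in>Field \<kappa>. C \<alpha> x \<subseteq> U)"
    have "\<exists>T. openin X T \<and> x \<in> T \<and> T \<subseteq> U" if x: "x \<in> U" for x
    proof -
      obtain \<alpha> where \<alpha>: "\<alpha> \<in> Field \<kappa>" "C \<alpha> x \<subseteq> U" "x \<in> ?M" using U x by blast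
      then have "openin X (C \<alpha> x)" using op unfolding classes_def by blast
      then show ?thesis using \<alpha>(2) class_self[OF tree \<alpha>(1,3)] by blast
    qed
    then show "openin X U" by (subst openin_subopen) blast
  qed
  then show ?thesis
    by (rule spherically_complete_tree_imp_sph_complete_G_Polish[OF deg sct space HOL.refl])
qed

lemma fSC_space_Borel_isomorphic_to_additive_SC_space:
  fixes X :: "'a topology"
  assumes two_power: "two_power_less \<kappa> =o \<kappa>"
    and deg: "has_Deg TYPE('g::linordered_ab_group_add) \<kappa>" and X: "fSC_space \<kappa> X"
  shows "\<exists>Y :: 'a topology. additive_SC_space \<kappa> Y \<and> kappa_Borel_isomorphic \<kappa> X Y"
proof -
  let ?M = "topspace X"
  obtain G where sct: "spherically_complete_tree ?M G" and leq: "|classes ?M G| \<le>o \<kappa>"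
    and Borel: "Bor (tree_topology ?M G) = Bor X"
    using fSC_space_has_spherically_complete_tree[OF two_power X] by blast
  have tree: "partition_tree ?M G" using sct unfolding spherically_complete_tree_def by blast
  let ?Y = "tree_topology ?M G"
  have top: "topspace ?Y = ?M" by (rule topspace_tree_topology[OF tree])
  have "sph_complete_G_Polish TYPE('g) \<kappa> ?Y"
    by (rule spherically_complete_tree_imp_sph_complete_G_Polish[OF deg sct
          kappa_space_tree_topology[OF tree leq] top openin_tree_topology[OF tree]])
  then have "additive_SC_space \<kappa> ?Y" by (rule sph_complete_G_Polish_imp_additive_SC_space[OF deg])
  moreover have "kappa_Borel_isomorphic \<kappa> X ?Y"
    by (rule same_kappa_Borel_imp_isomorphic) (simp_all add: top Borel)
  ultimately show ?thesis by blast
qed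

end

theorem theorem2p37:
  fixes \<kappa> :: "'k rel"
  assumes "Card_order \<kappa>" and "natLeq <o \<kappa>" and "regularCard \<kappa>"
    and "two_power_less \<kappa> =o \<kappa>"
    and "has_Deg TYPE('g::linordered_ab_group_add) \<kappa>"
  shows "(\<forall>X :: 'a topology. additive_SC_space \<kappa> X \<longleftrightarrow> sph_complete_G_Polish TYPE('g) \<kappa> X) \<and>
    (\<forall>\<C> \<in> {fSC_space \<kappa>, SC_space \<kappa>, G_Polish TYPE('g) \<kappa>, additive_SC_space \<kappa>}.
     \<forall>\<D> \<in> {fSC_space \<kappa>, SC_space \<kappa>, G_Polish TYPE('g) \<kappa>, additive_SC_space \<kappa>}.
       same_up_to_kappa_Borel_isomorphism \<kappa> \<C> (\<D> :: 'a topology \<Rightarrow> bool))"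
proof -
  interpret regular_cardinal \<kappa> by unfold_locales (use assms in auto)
  note two_power = assms(4) and deg = assms(5)
  let ?classes = "{fSC_space \<kappa>, SC_space \<kappa>, G_Polish TYPE('g) \<kappa>, additive_SC_space \<kappa>} ::
    ('a topology \<Rightarrow> bool) set"
  have equal: "additive_SC_space \<kappa> X \<longleftrightarrow> sph_complete_G_Polish TYPE('g) \<kappa> X" for X :: "'a topology"
    using additive_SC_space_imp_sph_complete_G_Polish[OF two_power deg]
      sph_complete_G_Polish_imp_additive_SC_space[OF deg] by blast
  have SC_fSC: "fSC_space \<kappa> X" if "SC_space \<kappa> X" for X :: "'a topology"
    using that strong_winning_imp_fair_winning unfolding SC_space_def fSC_space_def by blast
  have largest: "fSC_space \<kappa> X" if "\<C> \<in> ?classes" "\<C> X" for \<C> and X :: "'a topology"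
    using that SC_fSC G_Polish_imp_fSC_space[OF deg] unfolding additive_SC_space_def by auto
  have smallest: "\<D> Y" if "\<D> \<in> ?classes" "additive_SC_space \<kappa> Y" for \<D> and Y :: "'a topology"
  proof -
    have "SC_space \<kappa> Y" using that(2) unfolding additive_SC_space_def by blast
    moreover have "G_Polish TYPE('g) \<kappa> Y"
      using that(2) equal unfolding sph_complete_G_Polish_def G_Polish_def by blast
    ultimately show ?thesis using that SC_fSC by auto
  qed
  have "\<exists>Y. \<D> Y \<and> kappa_Borel_isomorphic \<kappa> X Y"
    if "\<C> \<in> ?classes" "\<D> \<in> ?classes" "\<C> X" for \<C> \<D> and X :: "'a topology"
    using fSC_space_Borel_isomorphic_to_additive_SC_space[OF two_power deg largest[OF that(1,3)]]
      smallest[OF that(2)] by blast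
  then have "same_up_to_kappa_Borel_isomorphism \<kappa> \<C> \<D>" if "\<C> \<in> ?classes" "\<D> \<in> ?classes" for \<C> \<D>
    unfolding same_up_to_kappa_Borel_isomorphism_def using that by blast
  then show ?thesis using equal by blast
qed

end
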